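(* Let $d\ge1$, $\alpha>s>d$, $\rho(r)=r^{-s}$, $\phi(r)=r^{-\alpha}$, and $F\in C^1((0,\infty))$. Define for $r>0$ $$g(r):=r^{1-\alpha/s}F'(r),\qquad h(r):=F(r)-\frac{s}{\alpha}rF'(r),$$ and let $I:=\{r>0:F'(r)<0\}$. Assume that $g$ is strictly increasing on $I$, that $g(I)=(-\infty,0)$, and that $h\circ g^{-1}$ is strictly decreasing on $(-\infty,0)$, where $g^{-1}:(-\infty,0)\to I$ is the inverse of $g|_I$. Consider $\mathcal E[L]=F(E_\rho[L])+E_\phi[L]=F(\zeta_L(s))+\zeta_L(\alpha)$. Then for every $L\in\mathcal L_d(1)$ the map $\lambda\mapsto\mathcal E[\lambda L]$ has a unique minimizer $\lambda^{\mathcal E}_L>0$, and for $L_d\in\mathcal L_d(1)$ the following are equivalent: (i) $L_d$ is the unique minimizer on $\mathcal L_d(1)$ of $e^*(L):=\zeta_L(\alpha)^s/\zeta_L(s)^\alpha$; (ii) $\lambda^{\mathcal E}_{L_d}L_d$ is the unique minimizer of $\mathcal E$ on $\mathcal L_d$; (iii) $\lambda^{\bar\phi}_{L_d}L_d$ is the unique minimizer on $\mathcal L_d$ of $E_{\bar\phi}$, where $\bar\phi(r)=r^{-\alpha}-r^{-s}$ and $\lambda^{\bar\phi}_{L}=\big(\alpha\zeta_L(\alpha)/(s\zeta_L(s))\big)^{1/(\alpha-s)}$ is the unique minimizer of $\lambda\mapsto E_{\bar\phi}[\lambda L]$. In particular, if $d=2$ and $H(\alpha)<H(s)$, then the unique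 minimizer of $\mathcal E$ on $\mathcal L_2$ is $\lambda^{\mathcal E}_{\mathsf A_2}\mathsf A_2$. Furthermore, if $L_d$ is the unique minimizer of $L\mapsto\zeta_L(s)$ on $\mathcal L_d(1)$ and also a minimizer of $e^*$ on $\mathcal L_d(1)$, then $L_d$ is the unique minimizer of $L\mapsto\lambda^{\mathcal E}_L$ on $\mathcal L_d(1)$.
   Context: $\mathcal L_d$ denotes the set of all lattices $L=\bigoplus_{i=1}^d\mathbb Z u_i$ with $\{u_i\}$ a basis of $\mathbb R^d$, and $\mathcal L_d(1)\subset\mathcal L_d$ the lattices with $|\det(u_1,\dots,u_d)|=1$. For $s>d$, $\zeta_L(s)=\sum_{q\in L\setminus\{0\}}|q|^{-s}$ (Epstein zeta function). For $f$ decaying like $O(r^{-d-\eta})$, $E_f[L]:=\sum_{q\in L\setminus\{0\}}f(|q|)$. $\mathsf A_2:=\sqrt{2/\sqrt3}\,[\mathbb Z(1,0)\oplus\mathbb Z(1/2,\sqrt3/2)]$ is the triangular lattice of unit density. $H(t):=\frac12\pi^{-t/2}\Gamma(t/2)\,t$ with $\Gamma(r)=\int_0^\infty x^{r-1}e^{-x}\,dx$. Uniqueness of minimizers among lattices is understood up to isometries. *)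

theory Defs
  imports "HOL-Analysis.Analysis"
begin

definition lattice_gen :: "real^'n^'n \<Rightarrow> (real^'n) set" where
  "lattice_gen B = {B *v (\<chi> i. real_of_int (k $ i)) | k :: int^'n. True}"

definition lattices :: "(real^'n) set set" where
  "lattices = {lattice_gen B | B. invertible B}"

definition lattices1 :: "(real^'n) set set" where
  "lattices1 = {lattice_gen B | B. invertible B \<and> \<bar>det B\<bar> = 1}"

definition lat_energy :: "(real \<Rightarrow> real) \<Rightarrow> (real^'n) set \<Rightarrow> real" where
  "lat_energy f L = infsum (\<lambda>q. f (norm q)) (L - {0})"

definition epstein :: "(real^'n) set \<Rightarrow> real \<Rightarrow> real" where
  "epstein L s = lat_energy (\<lambda>r. r powr (- s)) L"

definition scale_lat :: "real \<Rightarrow> (real^'n) set \<Rightarrow> (real^'n) set" where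
  "scale_lat c L = (\<lambda>x. c *\<^sub>R x) ` L"

definition isometric_lat :: "(real^'n) set \<Rightarrow> (real^'n) set \<Rightarrow> bool" where
  "isometric_lat L L' \<longleftrightarrow> (\<exists>T. orthogonal_transformation T \<and> T ` L = L')"

definition unique_min_lat :: "(real^'n) set set \<Rightarrow> ((real^'n) set \<Rightarrow> real) \<Rightarrow> (real^'n) set \<Rightarrow> bool" where
  "unique_min_lat S f L \<longleftrightarrow> L \<in> S \<and> (\<forall>L'\<in>S. f L \<le> f L') \<and>
     (\<forall>L'\<in>S. f L' = f L \<longrightarrow> isometric_lat L L')"

definition unique_min_pos :: "(real \<Rightarrow> real) \<Rightarrow> real \<Rightarrow> bool" where
  "unique_min_pos f c \<longleftrightarrow> c > 0 \<and> (\<forall>\<mu>>0. \<mu> \<noteq> c \<longrightarrow> f c < f \<mu>)"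

definition argmin_pos :: "(real \<Rightarrow> real) \<Rightarrow> real" where
  "argmin_pos f = (THE c. c > 0 \<and> (\<forall>\<mu>>0. f c \<le> f \<mu>))"

definition energyE :: "(real \<Rightarrow> real) \<Rightarrow> real \<Rightarrow> real \<Rightarrow> (real^'n) set \<Rightarrow> real" where
  "energyE F \<alpha> s L = F (lat_energy (\<lambda>r. r powr (- s)) L) + lat_energy (\<lambda>r. r powr (- \<alpha>)) L"

definition lamE :: "(real \<Rightarrow> real) \<Rightarrow> real \<Rightarrow> real \<Rightarrow> (real^'n) set \<Rightarrow> real" where
  "lamE F \<alpha> s L = argmin_pos (\<lambda>c. energyE F \<alpha> s (scale_lat c L))"

definition e_star :: "real \<Rightarrow> real \<Rightarrow> (real^'n) set \<Rightarrow> real" where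
  "e_star \<alpha> s L = epstein L \<alpha> powr s / epstein L s powr \<alpha>"

definition phibar :: "real \<Rightarrow> real \<Rightarrow> real \<Rightarrow> real" where
  "phibar \<alpha> s r = r powr (- \<alpha>) - r powr (- s)"

definition lam_bar :: "real \<Rightarrow> real \<Rightarrow> (real^'n) set \<Rightarrow> real" where
  "lam_bar \<alpha> s L = (\<alpha> * epstein L \<alpha> / (s * epstein L s)) powr (1 / (\<alpha> - s))"

definition H_fun :: "real \<Rightarrow> real" where
  "H_fun t = 1/2 * pi powr (- t / 2) * Gamma (t / 2) * t"

text \<open>Triangular lattice of unit density.\<close>
definition A2 :: "(real^2) set" where
  "A2 = scale_lat (sqrt (2 / sqrt 3))
     {real_of_int a *\<^sub>R vector [1, 0] + real_of_int b *\<^sub>R vector [1/2, sqrt 3 / 2] | a b. True}"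

end

theory Submission
  imports Defs "HOL-Probability.Characteristic_Functions"
begin

text \<open>
  With \<open>r = \<lambda>\<^sup>-\<^sup>s \<zeta>\<^sub>L(s)\<close> the energy of \<open>\<lambda>L\<close> becomes \<open>F(r) + K r\<^sup>p\<close>, where \<open>p = \<alpha>/s\<close> and \<open>K\<close> is the
  \<open>s\<close>-th root of \<open>e\<^sup>*(L)\<close>. Its derivative is \<open>r\<^sup>p\<^sup>-\<^sup>1 (g(r) + K p)\<close>, so the minimizer is unique, decreases
  with \<open>K\<close>, and the minimal value strictly increases with \<open>K\<close>. This gives the equivalences; \<open>\<phi>\<close>-bar is
  the special case \<open>F(r) = -r\<close>.

  In the plane, let \<open>\<theta>\<^sub>L(u)\<close> be the sum of \<open>exp(-\<pi>u|q|\<^sup>2)\<close> over nonzero \<open>q\<close>, for unit density. For \<open>u \<ge> 1\<close>,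
  \<open>\<theta>\<^sub>L(u)\<close> is at least the value for the triangular lattice: if the shortest vector of \<open>L\<close> is short, it alone
  suffices; otherwise the inequality holds for each orbit of the rotation of order three separately. By Poisson
  summation \<open>\<Psi>(w) = exp(w/2) (\<theta>\<^sub>L - \<theta>\<^sub>A)(exp w)\<close> is even, hence nonnegative, and
  \<open>\<pi>\<^sup>-\<^sup>t\<^sup>/\<^sup>2 \<Gamma>(t/2) (\<zeta>\<^sub>L(t) - \<zeta>\<^sub>A(t))\<close> is the integral of \<open>\<Psi>(w) cosh((t-1)w/2)\<close>, which increases with \<open>t\<close>.
  Under \<open>H(\<alpha>) < H(s)\<close> this settles all lattices of density at least \<open>1/r\<^sub>0\<^sup>2\<close>, \<open>r\<^sub>0\<close> being the point beyond which
  \<open>\<phi>\<close>-bar increases. Any other lattice is improved by shrinking it, or by moving the rows parallel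
  to its shortest vector closer to each other, until its density is at least \<open>1/r\<^sub>0\<^sup>2\<close>.
\<close>

section \<open>Lattices and their energies\<close>

text \<open>\<open>e_star\<close> is never compared with its value at \<open>A2\<close> directly.
  The Mellin comparison controls differences of zeta values, and these combine linearly in the
  energy of \<open>phibar\<close> at a fixed scale c, which is c^(-\<alpha>) (zeta(\<alpha>) -
  c^(\<alpha> - s) zeta(s)). The condition on \<open>H_fun\<close> makes the difference favour
  \<open>A2\<close> as long as c^(\<alpha> - s) \<le> \<alpha>/s, which is exactly c \<le> r0: the
  linear comparison is available up to the very point where \<open>phibar\<close> begins to
  increase. Beyond it monotonicity takes over, hence the contractions.

  The orbit argument has to beat a loss. The mean of the form over an orbit is c times the
  triangular value with c \<ge> 1, so the mean exponent gets worse. The gain is the spread of the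
  orbit: by convexity roughly \<kappa>^2 (c - 1)/2 against \<kappa> (c - 1), where -\<kappa> is the
  exponent at the triangular lattice. Near c = 1 this needs \<kappa> > 2. For u \<ge> 1 one has
  \<kappa> \<ge> 2 pi / sqrt 3 > 36/10, while small u has to be reached by inversion.\<close>

definition rvec :: "int^'n \<Rightarrow> real^'n" where
  "rvec k = (\<chi> i. real_of_int (k $ i))"

lemma rvec_eq_iff [simp]: "rvec k = rvec l \<longleftrightarrow> k = l"
  by (simp add: rvec_def vec_eq_iff)

lemma rvec_0 [simp]: "rvec 0 = 0"
  by (simp add: rvec_def vec_eq_iff)

lemma rvec_eq_0_iff [simp]: "rvec k = 0 \<longleftrightarrow> k = 0"
  by (metis rvec_0 rvec_eq_iff)

lemma lattice_gen_eq: "lattice_gen B = range (\<lambda>k. B *v rvec k)"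
  by (auto simp: lattice_gen_def rvec_def)

lemma inj_mult_rvec:
  assumes "invertible (B :: real^'n^'n)"
  shows "inj (\<lambda>k. B *v rvec k)"
proof (rule injI)
  fix k l assume "B *v rvec k = B *v rvec l"
  hence "rvec k = rvec l"
    by (rule injD[OF inj_matrix_vector_mult[OF assms]])
  thus "k = l" by simp
qed

lemma mult_rvec_eq_0_iff:
  assumes "invertible (B :: real^'n^'n)"
  shows "B *v rvec k = 0 \<longleftrightarrow> k = 0"
  using inj_eq[OF inj_mult_rvec[OF assms], of k 0] by simp

lemma lattice_gen_minus_0:
  assumes "invertible (B :: real^'n^'n)"
  shows "lattice_gen B - {0} = (\<lambda>k. B *v rvec k) ` (UNIV - {0})"
  using mult_rvec_eq_0_iff[OF assms] by (auto simp: lattice_gen_eq)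

section \<open>Convergence of lattice sums\<close>

lemma summable_on_int_powr:
  assumes "t > (1::real)"
  shows "(\<lambda>k::int. (1 + \<bar>real_of_int k\<bar>) powr (-t)) summable_on UNIV"
proof -
  have "summable (\<lambda>n. real n powr (-t))"
    using assms by (simp add: summable_real_powr_iff)
  hence "summable (\<lambda>n. real (Suc n) powr (-t))"
    by (subst summable_Suc_iff)
  hence S: "(\<lambda>n::nat. (1 + real n) powr (-t)) summable_on UNIV"
    by (intro summable_nonneg_imp_summable_on) (auto simp: add.commute)
  have "(\<lambda>k::int. (1 + \<bar>real_of_int k\<bar>) powr (-t)) summable_on (range int)"
    using S by (subst summable_on_reindex) (auto simp: o_def)
  moreover have "(\<lambda>k::int. (1 + \<bar>real_of_int k\<bar>) powr (-t)) summable_on (range (\<lambda>n. - int n))"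
    using S by (subst summable_on_reindex) (auto simp: o_def inj_def)
  ultimately have "(\<lambda>k::int. (1 + \<bar>real_of_int k\<bar>) powr (-t)) summable_on (range int \<union> range (\<lambda>n. - int n))"
    by (rule summable_on_union)
  also have "range int \<union> range (\<lambda>n. - int n) = UNIV"
    by (metis (no_types, lifting) UNIV_eq_I UnI1 UnI2 int_cases2 range_eqI)
  finally show ?thesis .
qed

text \<open>A finite set of integer vectors lies in a cube with finite side \<open>Y\<close>. Over
  the cube the sum of products factors, so the partial sums are bounded by a power of the
  one-dimensional sum.\<close>

lemma summable_on_prod_vec:
  fixes f :: "int \<Rightarrow> real"
  assumes "f summable_on UNIV" and nn: "\<And>k. f k \<ge> 0"
  shows "(\<lambda>k::int^'n. \<Prod>i\<in>UNIV. f (k $ i)) summable_on UNIV"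
proof (rule nonneg_bounded_partial_sums_imp_summable_on)
  show "(\<Prod>i\<in>UNIV. f (k $ i)) \<ge> 0" for k :: "int^'n"
    by (simp add: nn prod_nonneg)
  define C where "C = (infsum f UNIV) ^ CARD('n)"
  have "sum (\<lambda>k::int^'n. \<Prod>i\<in>UNIV. f (k $ i)) X \<le> C" if X: "finite X" for X
  proof -
    define Y where "Y = (\<Union>k\<in>X. range (($) k))"
    have fY: "finite Y" using X by (auto simp: Y_def)
    have "sum (\<lambda>k::int^'n. \<Prod>i\<in>UNIV. f (k $ i)) X = sum (\<lambda>g. \<Prod>i\<in>UNIV. f (g i)) (($) ` X)"
      by (subst sum.reindex) (auto simp: inj_on_def vec_eq_iff fun_eq_iff)
    also have "\<dots> \<le> sum (\<lambda>g. \<Prod>i\<in>UNIV. f (g i)) (PiE (UNIV::'n set) (\<lambda>_. Y))"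
      using fY by (intro sum_mono2) (auto simp: Y_def nn prod_nonneg intro: finite_PiE)
    also have "\<dots> = (\<Prod>i\<in>(UNIV::'n set). sum f Y)"
      by (subst prod_sum_PiE) (use fY in auto)
    also have "\<dots> = (sum f Y) ^ CARD('n)" by simp
    also have "\<dots> \<le> C"
      unfolding C_def
      by (intro power_mono finite_sum_le_infsum) (use assms fY in \<open>auto simp: sum_nonneg\<close>)
    finally show ?thesis .
  qed
  thus "\<forall>\<^sub>F X in finite_subsets_at_top UNIV. sum (\<lambda>k::int^'n. \<Prod>i\<in>UNIV. f (k $ i)) X \<le> C"
    by (auto simp: eventually_finite_subsets_at_top intro!: exI[of _ "{}"])
qed

text \<open>A nonzero integer vector has norm at least 1, so every factor 1 + |k_i| is at most twice
  the norm. Multiplying over the coordinates splits the norm into one-dimensional factors with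
  exponent t/n, summable precisely when t exceeds the dimension.\<close>

lemma norm_rvec_powr_le:
  assumes "k \<noteq> (0 :: int^'n)" and t: "t > 0"
  shows "norm (rvec k) powr (-t) \<le> 2 powr t * (\<Prod>i\<in>UNIV. (1 + \<bar>real_of_int (k $ i)\<bar>) powr (- (t / real CARD('n))))"
proof -
  let ?n = "real CARD('n)"
  have le: "\<bar>real_of_int (k $ i)\<bar> \<le> norm (rvec k)" for i
    using component_le_norm_cart[of "rvec k" i] by (simp add: rvec_def)
  obtain j where "k $ j \<noteq> 0" using assms(1) by (auto simp: vec_eq_iff)
  hence "1 \<le> \<bar>real_of_int (k $ j)\<bar>" by linarith
  with le[of j] have 1: "1 \<le> norm (rvec k)" by linarith
  have "(\<Prod>i\<in>UNIV. 1 + \<bar>real_of_int (k $ i)\<bar>) \<le> (\<Prod>i\<in>(UNIV::'n set). 2 * norm (rvec k))"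
    by (intro prod_mono) (use 1 le in \<open>auto intro: order_trans[OF add_mono[OF 1 le]]\<close>)
  hence *: "(\<Prod>i\<in>UNIV. 1 + \<bar>real_of_int (k $ i)\<bar>) \<le> (2 * norm (rvec k)) ^ CARD('n)" by simp
  have pos: "0 < (\<Prod>i\<in>UNIV. 1 + \<bar>real_of_int (k $ i)\<bar>)" by (intro prod_pos) auto
  have "(2 * norm (rvec k)) powr (-t) = ((2 * norm (rvec k)) ^ CARD('n)) powr (- (t / ?n))"
    using 1 by (subst powr_realpow[symmetric]) (auto simp: powr_powr)
  also have "\<dots> \<le> (\<Prod>i\<in>UNIV. 1 + \<bar>real_of_int (k $ i)\<bar>) powr (- (t / ?n))"
    using t by (intro powr_mono2' * pos) auto
  also have "\<dots> = (\<Prod>i\<in>UNIV. (1 + \<bar>real_of_int (k $ i)\<bar>) powr (- (t / ?n)))"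
    by (subst prod_powr_distrib) auto
  finally have "2 powr t * (2 * norm (rvec k)) powr (-t) \<le> 2 powr t * (\<Prod>i\<in>UNIV. (1 + \<bar>real_of_int (k $ i)\<bar>) powr (- (t / ?n)))"
    by (intro mult_left_mono) auto
  moreover have "2 powr t * (2 * norm (rvec k)) powr (-t) = norm (rvec k) powr (-t)"
    by (simp add: powr_mult powr_minus)
  ultimately show ?thesis by simp
qed

lemma summable_on_lattice_gen:
  fixes B :: "real^'n^'n"
  assumes B: "invertible B" and t: "t > real CARD('n)"
  shows "(\<lambda>k. norm (B *v rvec k) powr (-t)) summable_on (UNIV - {0})"
proof -
  have t0: "t > 0" using t by (smt (verit) of_nat_0_le_iff)
  obtain c where c: "c > 0" "\<And>x. c * norm x \<le> norm (B *v x)"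
    using linear_inj_bounded_below_pos[OF matrix_vector_mul_linear inj_matrix_vector_mult[OF B]]
    by (metis mult.commute)
  have "(\<lambda>k::int^'n. \<Prod>i\<in>UNIV. (1 + \<bar>real_of_int (k $ i)\<bar>) powr (- (t / real CARD('n)))) summable_on UNIV"
    by (intro summable_on_prod_vec summable_on_int_powr) (use t in \<open>auto simp: field_simps\<close>)
  hence "(\<lambda>k::int^'n. \<Prod>i\<in>UNIV. (1 + \<bar>real_of_int (k $ i)\<bar>) powr (- (t / real CARD('n)))) summable_on (UNIV - {0})"
    by (rule summable_on_subset) auto
  hence S: "(\<lambda>k::int^'n. c powr (-t) * (2 powr t * (\<Prod>i\<in>UNIV. (1 + \<bar>real_of_int (k $ i)\<bar>) powr (- (t / real CARD('n)))))) summable_on (UNIV - {0})"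
    by (intro summable_on_cmult_right)
  show ?thesis
  proof (rule summable_on_comparison_test[OF S])
    fix k :: "int^'n" assume k: "k \<in> UNIV - {0}"
    have "norm (B *v rvec k) powr (-t) \<le> (c * norm (rvec k)) powr (-t)"
      using c k t0 by (intro powr_mono2') auto
    also have "\<dots> = c powr (-t) * norm (rvec k) powr (-t)"
      by (simp add: powr_mult)
    also have "\<dots> \<le> c powr (-t) * (2 powr t * (\<Prod>i\<in>UNIV. (1 + \<bar>real_of_int (k $ i)\<bar>) powr (- (t / real CARD('n)))))"
      using norm_rvec_powr_le[of k t] k t0 by (intro mult_left_mono) auto
    finally show "norm (B *v rvec k) powr (-t) \<le> \<dots>" .
  qed auto
qed

lemma summable_on_lattice:
  assumes "(L :: (real^'n) set) \<in> lattices" "t > real CARD('n)"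
  shows "(\<lambda>q. norm q powr (-t)) summable_on (L - {0})"
proof -
  obtain B where B: "invertible B" "L = lattice_gen B" using assms by (auto simp: lattices_def)
  have "inj_on (\<lambda>k. B *v rvec k) (UNIV - {0})"
    using inj_mult_rvec[OF B(1)] by (rule inj_on_subset) auto
  thus ?thesis unfolding B(2) lattice_gen_minus_0[OF B(1)]
    by (subst summable_on_reindex) (use summable_on_lattice_gen[OF B(1) assms(2)] in \<open>auto simp: o_def\<close>)
qed

lemma lattices1_subset: "lattices1 \<subseteq> lattices"
  by (auto simp: lattices_def lattices1_def)

lemma lattice_nonzero_element:
  assumes "(L :: (real^'n) set) \<in> lattices"
  shows "\<exists>q. q \<in> L - {0}"
proof -
  obtain B where B: "invertible B" "L = lattice_gen B" using assms by (auto simp: lattices_def)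
  have "(\<chi> i. 1 :: int^'n) \<noteq> (0 :: int^'n)" by (auto simp: vec_eq_iff)
  thus ?thesis unfolding B(2) lattice_gen_minus_0[OF B(1)] by blast
qed

lemma infsum_pos:
  fixes f :: "'a \<Rightarrow> real"
  assumes "f summable_on A" "\<And>x. x \<in> A \<Longrightarrow> f x \<ge> 0" "a \<in> A" "f a > 0"
  shows "infsum f A > 0"
  using finite_sum_le_infsum[OF assms(1), of "{a}"] assms by force

lemma epstein_pos:
  assumes "(L :: (real^'n) set) \<in> lattices" "t > real CARD('n)"
  shows "epstein L t > 0"
proof -
  obtain q where "q \<in> L - {0}" using lattice_nonzero_element[OF assms(1)] by blast
  thus ?thesis unfolding epstein_def lat_energy_def
    by (intro infsum_pos[OF summable_on_lattice[OF assms]]) auto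
qed

lemma lat_energy_scale:
  assumes "c > 0"
  shows "lat_energy f (scale_lat c L) = infsum (\<lambda>q. f (c * norm q)) (L - {0})"
proof -
  have "scale_lat c L - {0} = (\<lambda>x. c *\<^sub>R x) ` (L - {0})"
    using assms by (auto simp: scale_lat_def)
  thus ?thesis unfolding lat_energy_def
    by (simp only:, subst infsum_reindex) (use assms in \<open>auto simp: inj_on_def o_def\<close>)
qed

lemma lat_energy_powr_scale:
  assumes "c > 0"
  shows "lat_energy (\<lambda>r. r powr (-t)) (scale_lat c L) = c powr (-t) * epstein L t"
proof -
  have "lat_energy (\<lambda>r. r powr (-t)) (scale_lat c L) = infsum (\<lambda>q. c powr (-t) * norm q powr (-t)) (L - {0})"
    unfolding lat_energy_scale[OF assms] using assms by (simp add: powr_mult)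
  thus ?thesis by (simp add: infsum_cmult_right' epstein_def lat_energy_def)
qed

lemma scale_lattice_gen: "scale_lat c (lattice_gen B) = lattice_gen (c *\<^sub>R B)"
  by (auto simp: scale_lat_def lattice_gen_eq image_image scaleR_matrix_vector_assoc)

lemma det_scaleR: "det (c *\<^sub>R (B :: real^'n^'n)) = c ^ CARD('n) * det B"
proof -
  have "c *\<^sub>R B = (\<chi> i. c *s row i B)" by (simp add: vec_eq_iff row_def)
  thus ?thesis using det_rows_mul[of "\<lambda>_. c" "\<lambda>i. row i B"] by (simp add: row_def)
qed

lemma scale_lat_in_lattices:
  assumes "L \<in> lattices" "c > 0"
  shows "scale_lat c (L :: (real^'n) set) \<in> lattices"
proof -
  obtain B where B: "invertible B" "L = lattice_gen B" using assms by (auto simp: lattices_def)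
  have "invertible (c *\<^sub>R B)" using B assms(2) by (simp add: invertible_det_nz det_scaleR)
  thus ?thesis unfolding B scale_lattice_gen by (auto simp: lattices_def)
qed

lemma lattice_eq_scale:
  assumes "(L :: (real^'n) set) \<in> lattices"
  obtains c L1 where "c > 0" "L1 \<in> lattices1" "L = scale_lat c L1"
proof -
  obtain B where B: "invertible B" "L = lattice_gen B" using assms by (auto simp: lattices_def)
  define c where "c = root CARD('n) \<bar>det B\<bar>"
  have d: "det B \<noteq> 0" using B by (simp add: invertible_det_nz)
  have c: "c > 0" using d by (auto simp: c_def)
  have cn: "c ^ CARD('n) = \<bar>det B\<bar>" by (simp add: c_def)
  define B1 where "B1 = (1/c) *\<^sub>R B"
  have "\<bar>det B1\<bar> = 1" using c d cn by (simp add: B1_def det_scaleR abs_mult power_divide)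
  moreover from this have "invertible B1" by (auto simp: invertible_det_nz)
  moreover have "L = scale_lat c (lattice_gen B1)" using c by (simp add: scale_lattice_gen B1_def B)
  ultimately show ?thesis using c by (intro that[of c "lattice_gen B1"]) (auto simp: lattices1_def)
qed

section \<open>The covolume as an invariant\<close>

lemma det_of_int_matrix:
  "det (\<chi> i j. real_of_int (u i j)) \<in> \<int>"
  unfolding det_def by (auto intro!: Ints_sum Ints_mult Ints_prod)

text \<open>The columns of \<open>C\<close> are integer combinations of those of \<open>B\<close>,
  so \<open>C = B ** U\<close> with \<open>U\<close> integral; a nonzero integer determinant has
  absolute value at least 1.\<close>

lemma abs_det_le_of_lattice_gen_subset:
  fixes B C :: "real^'n^'n"
  assumes "invertible C" "lattice_gen C \<subseteq> lattice_gen B"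
  shows "\<bar>det B\<bar> \<le> \<bar>det C\<bar>"
proof -
  have "column j C \<in> lattice_gen B" for j
  proof -
    have "C *v rvec (axis j 1) = column j C"
      by (simp add: vec_eq_iff matrix_vector_mult_def rvec_def axis_def column_def if_distrib cong: if_cong)
    thus ?thesis using assms(2) unfolding lattice_gen_eq by (metis rangeI subsetD)
  qed
  hence "\<forall>j. \<exists>k. column j C = B *v rvec k" by (auto simp: lattice_gen_eq)
  then obtain k where k: "\<And>j. column j C = B *v rvec (k j)" by metis
  define U :: "real^'n^'n" where "U = (\<chi> i j. real_of_int (k j $ i))"
  have "C $ i $ j = (B ** U) $ i $ j" for i j
    using arg_cong[OF k[of j], of "\<lambda>v. v $ i"]
    by (simp add: column_def matrix_matrix_mult_def matrix_vector_mult_def rvec_def U_def)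
  hence CU: "C = B ** U" by (simp add: vec_eq_iff)
  hence d: "det C = det B * det U" by (simp add: det_mul)
  have "det U \<noteq> 0" using assms(1) d by (auto simp: invertible_det_nz)
  moreover have "det U \<in> \<int>" unfolding U_def by (rule det_of_int_matrix)
  ultimately have "\<bar>det U\<bar> \<ge> 1" using Ints_nonzero_abs_ge1 by blast
  thus ?thesis unfolding d abs_mult by (metis abs_ge_zero mult.right_neutral mult_left_mono)
qed

lemma abs_det_eq_of_lattice_gen_eq:
  assumes "invertible B" "invertible C" "lattice_gen B = lattice_gen (C :: real^'n^'n)"
  shows "\<bar>det B\<bar> = \<bar>det C\<bar>"
  using abs_det_le_of_lattice_gen_subset[of B C] abs_det_le_of_lattice_gen_subset[of C B] assms by auto

lemma orthogonal_image_lattice_gen: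
  assumes "orthogonal_transformation T"
  shows "T ` lattice_gen B = lattice_gen (matrix T ** B)"
  by (auto simp: lattice_gen_eq image_image matrix_vector_mul_assoc[symmetric]
      matrix_works orthogonal_transformation_linear[OF assms])

text \<open>Isometries preserve the covolume, and the covolume of a scaled unit-density lattice is
  the n-th power of the scale. Hence isometric multiples have the same factor, which can then be
  cancelled.\<close>

lemma isometric_scale_cancel:
  fixes L L' :: "(real^'n) set"
  assumes "L \<in> lattices1" "L' \<in> lattices1" "c > 0" "d > 0"
    and "isometric_lat (scale_lat c L) (scale_lat d L')"
  shows "c = d" "isometric_lat L L'"
proof -
  obtain T where T: "orthogonal_transformation T" "T ` scale_lat c L = scale_lat d L'"
    using assms by (auto simp: isometric_lat_def)
  obtain B where B: "invertible B" "\<bar>det B\<bar> = 1" "L = lattice_gen B"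
    using assms by (auto simp: lattices1_def)
  obtain C where C: "invertible C" "\<bar>det C\<bar> = 1" "L' = lattice_gen C"
    using assms by (auto simp: lattices1_def)
  have eq: "lattice_gen (matrix T ** (c *\<^sub>R B)) = lattice_gen (d *\<^sub>R C)"
    using T by (simp add: B C scale_lattice_gen orthogonal_image_lattice_gen)
  have dT: "\<bar>det (matrix T)\<bar> = 1" using T(1) by (metis abs_1 abs_neg_one det_orthogonal_matrix orthogonal_transformation_matrix)
  have dB: "\<bar>det (matrix T ** (c *\<^sub>R B))\<bar> = c ^ CARD('n)"
    using dT B assms by (simp add: det_mul det_scaleR abs_mult)
  have dC: "\<bar>det (d *\<^sub>R C)\<bar> = d ^ CARD('n)"
    using C assms by (simp add: det_scaleR abs_mult)
  have "c ^ CARD('n) = d ^ CARD('n)"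
    unfolding dB[symmetric] dC[symmetric]
    by (rule abs_det_eq_of_lattice_gen_eq[OF _ _ eq]) (use dB dC assms in \<open>auto simp: invertible_det_nz\<close>)
  thus cd: "c = d" using assms by (auto intro: power_eq_imp_eq_base)
  have lin: "T (c *\<^sub>R x) = c *\<^sub>R T x" for x
    using T(1) orthogonal_transformation_linear linear_cmul by blast
  have "(\<lambda>x. c *\<^sub>R x) ` (T ` L) = (\<lambda>x. c *\<^sub>R x) ` L'"
    using T(2) by (simp add: scale_lat_def image_image lin cd[symmetric])
  hence "T ` L = L'" using inj_image_eq_iff[of "\<lambda>x. c *\<^sub>R x" "T ` L" L'] assms(3) by (auto simp: inj_def simp del: image_image)
  thus "isometric_lat L L'" using T(1) by (auto simp: isometric_lat_def)
qed

lemma isometric_scale: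
  assumes "isometric_lat L L'"
  shows "isometric_lat (scale_lat c L) (scale_lat c L')"
proof -
  obtain T where T: "orthogonal_transformation T" "T ` L = L'"
    using assms by (auto simp: isometric_lat_def)
  have lin: "T (c *\<^sub>R x) = c *\<^sub>R T x" for x
    using T(1) orthogonal_transformation_linear linear_cmul by blast
  show ?thesis unfolding isometric_lat_def
    by (rule exI[of _ T]) (use T in \<open>auto simp: scale_lat_def image_image lin\<close>)
qed

lemma lat_energy_isometric:
  assumes "isometric_lat L L'"
  shows "lat_energy f L' = lat_energy f L"
proof -
  obtain T where T: "orthogonal_transformation T" "T ` L = L'"
    using assms by (auto simp: isometric_lat_def)
  have inj: "inj T" by (rule orthogonal_transformation_inj[OF T(1)])
  have T0: "T 0 = 0" using T(1) orthogonal_transformation_linear linear_0 by blast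
  have "L' - {0} = T ` (L - {0})" using T inj T0 by (auto simp: inj_def)
  thus ?thesis unfolding lat_energy_def
    using infsum_reindex[of T "L - {0}" "\<lambda>q. f (norm q)"] inj_on_subset[OF inj, of "L - {0}"]
    by (simp add: o_def orthogonal_transformation_norm[OF T(1)])
qed

section \<open>Minimization over the scale\<close>

lemma unique_min_posD:
  assumes "unique_min_pos f c"
  shows "c > 0" "\<mu> > 0 \<Longrightarrow> f c \<le> f \<mu>" "\<mu> > 0 \<Longrightarrow> f \<mu> \<le> f c \<Longrightarrow> \<mu> = c"
  using assms by (auto simp: unique_min_pos_def order.order_iff_strict not_less[symmetric])

lemma argmin_pos_eq:
  assumes "unique_min_pos f c"
  shows "argmin_pos f = c"
  unfolding argmin_pos_def
proof (rule the_equality)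
  show "c > 0 \<and> (\<forall>\<mu>>0. f c \<le> f \<mu>)" using unique_min_posD[OF assms] by blast
  show "d = c" if "d > 0 \<and> (\<forall>\<mu>>0. f d \<le> f \<mu>)" for d
    using unique_min_posD[OF assms] that by blast
qed

text \<open>\<open>p\<close> stands for \<alpha>/s, and \<open>r powr (1 - p) * F' r\<close> is the
  function g of the theorem. Isolating these conditions lets F(r) = -r be handled by the same
  lemmas.\<close>

definition embedding :: "real \<Rightarrow> (real \<Rightarrow> real) \<Rightarrow> (real \<Rightarrow> real) \<Rightarrow> bool" where
  "embedding p F F' \<longleftrightarrow>
     (\<forall>r>0. (F has_real_derivative F' r) (at r)) \<and> continuous_on {0<..} F' \<and>
     strict_mono_on {r. r > 0 \<and> F' r < 0} (\<lambda>r. r powr (1 - p) * F' r) \<and>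
     (\<lambda>r. r powr (1 - p) * F' r) ` {r. r > 0 \<and> F' r < 0} = {..<0}"

lemma embedding_neg_downward:
  assumes E: "embedding p F F'" and r: "0 < r" "r < t" "F' t < 0"
  shows "F' r < 0"
proof (rule ccontr)
  assume nr: "\<not> F' r < 0"
  define g where "g = (\<lambda>r. r powr (1 - p) * F' r)"
  have contF: "continuous_on {0<..} F'" and
       mono: "strict_mono_on {r. r > 0 \<and> F' r < 0} g"
    using E by (auto simp: embedding_def g_def)
  have "continuous_on {0<..} g" unfolding g_def
    by (intro continuous_intros contF) auto
  hence cont: "continuous_on {r..t} g" by (rule continuous_on_subset) (use r in auto)
  have gt: "g t < 0" using r by (simp add: g_def mult_pos_neg)
  have gr: "g r \<ge> 0" using r nr by (simp add: g_def)
  \<comment> \<open>By the intermediate value theorem \<open>g\<close> takes the value \<open>g t / 2\<close> left of \<open>t\<close>,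
    contradicting monotonicity on the set where it is negative.\<close>
  obtain x where x: "r \<le> x" "x \<le> t" "g x = g t / 2"
    using IVT2'[of g t "g t / 2" r] cont gt gr r by (auto simp: field_simps)
  have "g x < 0" using x gt by simp
  hence "F' x < 0" using x r by (auto simp: g_def mult_less_0_iff)
  moreover have "x < t" using x gt by (cases "x = t") auto
  ultimately have "g x < g t" using mono r x by (auto simp: strict_mono_on_def)
  thus False using x gt by simp
qed

text \<open>The minimizer is the solution of g(r) = -K p. To its left F' is still negative, so g is
  monotone there and lies below -K p. To its right g is either on its increasing branch or
  nonnegative. The two facts on F' at r are exported in order to compare minimizers for different
  K.\<close>

lemma embedding_min:
  assumes E: "embedding p F F'" and K: "K > 0" and p: "p > 0"
  shows "\<exists>r. unique_min_pos (\<lambda>r. F r + K * r powr p) r \<and> F' r < 0 \<and> r powr (1 - p) * F' r = - (K * p)"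
proof -
  define g where "g = (\<lambda>r. r powr (1 - p) * F' r)"
  define I where "I = {r. r > 0 \<and> F' r < 0}"
  have mono: "strict_mono_on I g" and img: "g ` I = {..<0}"
    using E by (auto simp: embedding_def g_def I_def)
  have "- (K * p) \<in> g ` I" using K p by (simp add: img)
  then obtain r where r: "r > 0" "F' r < 0" "g r = - (K * p)" by (auto simp: I_def)
  define G where "G = (\<lambda>r. F r + K * r powr p)"
  have deriv: "(G has_real_derivative x powr (p - 1) * (g x + K * p)) (at x)" if "x > 0" for x
  proof -
    have "(F has_real_derivative F' x) (at x)" using E that by (simp add: embedding_def)
    hence "(G has_real_derivative (F' x + K * (p * x powr (p - 1)))) (at x)"
      unfolding G_def using that by (auto intro!: derivative_eq_intros)
    also have "F' x + K * (p * x powr (p - 1)) = x powr (p - 1) * (g x + K * p)"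
      using that by (simp add: g_def algebra_simps flip: powr_add mult.assoc)
    finally show ?thesis .
  qed
  have left: "g x < - (K * p)" if "0 < x" "x < r" for x
    using mono r that embedding_neg_downward[OF E that r(2)]
    by (metis (mono_tags, lifting) I_def mem_Collect_eq strict_mono_onD)
  have right: "g x > - (K * p)" if "x > r" for x
  proof (cases "F' x < 0")
    case True thus ?thesis using mono r that by (metis (mono_tags, lifting) I_def mem_Collect_eq strict_mono_onD order_less_trans)
  next
    case False
    hence "g x \<ge> 0" by (simp add: g_def)
    moreover have "K * p > 0" using K p by simp
    ultimately show ?thesis by linarith
  qed
  have cont: "continuous_on S G" if "S \<subseteq> {0<..}" for S
    using deriv that by (intro continuous_at_imp_continuous_on ballI DERIV_isCont) auto
  have "G r < G x" if "x > 0" "x \<noteq> r" for x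
  proof (cases "x < r")
    case True
    show ?thesis
    proof (rule DERIV_neg_imp_decreasing_open[OF True])
      fix y assume y: "x < y" "y < r"
      have "y powr (p - 1) * (g y + K * p) < 0"
        using left[of y] y that by (intro mult_pos_neg) auto
      thus "\<exists>d. (G has_real_derivative d) (at y) \<and> d < 0" using deriv[of y] y that by auto
    qed (use that in \<open>auto intro: cont\<close>)
  next
    case False
    hence "r < x" using that by simp
    thus ?thesis
    proof (rule DERIV_pos_imp_increasing_open)
      fix y assume y: "r < y" "y < x"
      have "y powr (p - 1) * (g y + K * p) > 0"
        using right[of y] y r by (intro mult_pos_pos) auto
      thus "\<exists>d. (G has_real_derivative d) (at y) \<and> d > 0" using deriv[of y] y r by auto
    qed (use r in \<open>auto intro: cont\<close>)
  qed
  thus ?thesis using r by (auto simp: unique_min_pos_def G_def g_def)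
qed

text \<open>The minimizer \<open>r'\<close> for the larger coefficient is a competitor for the
  smaller one, where it costs strictly less.\<close>

lemma embedding_min_value_strict_mono:
  assumes "unique_min_pos (\<lambda>r. F r + K * r powr p) r" "unique_min_pos (\<lambda>r. F r + K' * r powr p) r'"
    and "K < K'"
  shows "F r + K * r powr p < F r' + K' * r' powr (p::real)"
proof -
  have "r' > 0" using assms by (simp add: unique_min_pos_def)
  have "F r + K * r powr p \<le> F r' + K * r' powr p"
    using unique_min_posD(2)[OF assms(1) \<open>r' > 0\<close>] .
  also have "\<dots> < F r' + K' * r' powr p" using assms(3) \<open>r' > 0\<close> by simp
  finally show ?thesis .
qed

text \<open>The minimizers solve g(r) = -K p with g increasing, so a larger K pushes the solution to
  the left.\<close>

lemma embedding_argmin_antimono: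
  assumes E: "embedding p F F'" and K: "0 < K" "K \<le> K'" and p: "p > 0"
    and r: "unique_min_pos (\<lambda>r. F r + K * r powr p) r" "unique_min_pos (\<lambda>r. F r + K' * r powr p) r'"
  shows "r' \<le> r"
proof (rule ccontr)
  assume "\<not> r' \<le> r"
  hence less: "r < r'" by simp
  have K': "K' > 0" using K by simp
  have uniq: "t = t'" if "unique_min_pos f t" "unique_min_pos f t'" for f t t'
    using argmin_pos_eq[OF that(1)] argmin_pos_eq[OF that(2)] by simp
  have 1: "F' r < 0" "r powr (1 - p) * F' r = - (K * p)" "r > 0"
    using embedding_min[OF E K(1) p] uniq[OF r(1)] unique_min_posD(1)[OF r(1)] by metis+
  have 2: "F' r' < 0" "r' powr (1 - p) * F' r' = - (K' * p)" "r' > 0"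
    using embedding_min[OF E K' p] uniq[OF r(2)] unique_min_posD(1)[OF r(2)] by metis+
  have "strict_mono_on {r. r > 0 \<and> F' r < 0} (\<lambda>r. r powr (1 - p) * F' r)"
    using E by (simp add: embedding_def)
  from strict_mono_onD[OF this _ _ less] 1 2 have "K' * p < K * p" by simp
  thus False using K p by simp
qed

text \<open>The constant K of the overview; the exponents are balanced so that it does not change
  when L is scaled.\<close>

definition coeff :: "real \<Rightarrow> real \<Rightarrow> (real^'n) set \<Rightarrow> real" where
  "coeff \<alpha> s L = epstein L \<alpha> / epstein L s powr (\<alpha> / s)"

lemma energyE_scale:
  assumes L: "(L :: (real^'n) set) \<in> lattices" and s: "s > real CARD('n)" and c: "c > 0"
  defines "r \<equiv> c powr (-s) * epstein L s"
  shows "energyE F \<alpha> s (scale_lat c L) = F r + coeff \<alpha> s L * r powr (\<alpha> / s)"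
proof -
  have s0: "s > 0" using s by (smt (verit) of_nat_0_le_iff)
  have b: "epstein L s > 0" by (rule epstein_pos[OF L s])
  have "r powr (\<alpha> / s) = c powr (-\<alpha>) * epstein L s powr (\<alpha> / s)"
    using b s0 by (simp add: r_def powr_mult powr_powr)
  thus ?thesis using b
    by (simp add: energyE_def lat_energy_powr_scale[OF c] r_def coeff_def)
qed

context
  fixes F F' :: "real \<Rightarrow> real" and \<alpha> s :: real and nn :: "'n::finite itself"
  assumes E: "embedding (\<alpha> / s) F F'" and s: "s > real CARD('n)" and as: "\<alpha> > s"
begin

private lemma s_pos: "s > 0" using s by (smt (verit) of_nat_0_le_iff)

private lemma p_pos: "\<alpha> / s > 0" using s_pos as by simp

lemma coeff_pos: "(L :: (real^'n) set) \<in> lattices \<Longrightarrow> coeff \<alpha> s L > 0"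
  using epstein_pos[of L s] epstein_pos[of L \<alpha>] s as by (simp add: coeff_def)

lemma e_star_eq: "(L :: (real^'n) set) \<in> lattices \<Longrightarrow> e_star \<alpha> s L = coeff \<alpha> s L powr s"
  using epstein_pos[of L s] epstein_pos[of L \<alpha>] s as s_pos
  by (simp add: coeff_def e_star_def powr_divide powr_powr)

lemma e_star_le_iff:
  "(L :: (real^'n) set) \<in> lattices \<Longrightarrow> (L' :: (real^'n) set) \<in> lattices \<Longrightarrow>
     e_star \<alpha> s L \<le> e_star \<alpha> s L' \<longleftrightarrow> coeff \<alpha> s L \<le> coeff \<alpha> s L'"
  using powr_mono2[of s "coeff \<alpha> s L" "coeff \<alpha> s L'"] coeff_pos[of L] coeff_pos[of L'] s_pos
    powr_less_mono2[of s "coeff \<alpha> s L'" "coeff \<alpha> s L"]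
  unfolding e_star_eq by linarith

definition rmin :: "(real^'n) set \<Rightarrow> real" where
  "rmin L = argmin_pos (\<lambda>r. F r + coeff \<alpha> s L * r powr (\<alpha> / s))"

lemma rmin:
  assumes "L \<in> lattices"
  shows "unique_min_pos (\<lambda>r. F r + coeff \<alpha> s L * r powr (\<alpha> / s)) (rmin L)"
  using embedding_min[OF E coeff_pos[OF assms] p_pos] argmin_pos_eq unfolding rmin_def by metis

text \<open>The map c -> c^(-s) zeta(s) is a bijection of the positive reals, so a unique minimizer
  in r pulls back to a unique minimizer in c.\<close>

lemma unique_min_pos_scale:
  assumes L: "(L :: (real^'n) set) \<in> lattices"
    and r: "unique_min_pos (\<lambda>r. F r + coeff \<alpha> s L * r powr (\<alpha> / s)) r"
  shows "unique_min_pos (\<lambda>c. energyE F \<alpha> s (scale_lat c L)) ((epstein L s / r) powr (1 / s))"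
proof -
  let ?c = "(epstein L s / r) powr (1 / s)"
  have b: "epstein L s > 0" by (rule epstein_pos[OF L s])
  have r0: "r > 0" using r by (simp add: unique_min_pos_def)
  have c0: "?c > 0" using b r0 by simp
  have rc: "?c powr (-s) * epstein L s = r"
    using b r0 s_pos by (simp add: powr_powr powr_minus powr_one)
  have "energyE F \<alpha> s (scale_lat ?c L) < energyE F \<alpha> s (scale_lat d L)" if d: "d > 0" "d \<noteq> ?c" for d
  proof -
    let ?t = "d powr (-s) * epstein L s"
    have "?t \<noteq> r"
    proof
      assume "?t = r"
      hence "epstein L s / r = d powr s" using b r0 d by (simp add: powr_minus field_simps)
      hence "?c = d" using d s_pos by (simp add: powr_powr)
      thus False using d by simp
    qed
    moreover have "?t > 0" using b d by simp
    ultimately show ?thesis using r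
      unfolding energyE_scale[OF L s c0] energyE_scale[OF L s d(1)] rc by (simp add: unique_min_pos_def)
  qed
  thus ?thesis using c0 by (simp add: unique_min_pos_def)
qed

lemma lamE_eq:
  assumes L: "(L :: (real^'n) set) \<in> lattices"
  shows "lamE F \<alpha> s L = (epstein L s / rmin L) powr (1 / s)"
  unfolding lamE_def by (rule argmin_pos_eq[OF unique_min_pos_scale[OF L rmin[OF L]]])

lemma unique_min_lamE:
  assumes L: "(L :: (real^'n) set) \<in> lattices"
  shows "unique_min_pos (\<lambda>c. energyE F \<alpha> s (scale_lat c L)) (lamE F \<alpha> s L)"
  using unique_min_pos_scale[OF L rmin[OF L]] lamE_eq[OF L] by simp

lemma energyE_lamE:
  assumes L: "(L :: (real^'n) set) \<in> lattices"
  shows "energyE F \<alpha> s (scale_lat (lamE F \<alpha> s L) L) = F (rmin L) + coeff \<alpha> s L * rmin L powr (\<alpha> / s)"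
proof -
  have b: "epstein L s > 0" by (rule epstein_pos[OF L s])
  have r0: "rmin L > 0" using rmin[OF L] by (simp add: unique_min_pos_def)
  have "lamE F \<alpha> s L powr (-s) * epstein L s = rmin L"
    using b r0 s_pos by (simp add: lamE_eq[OF L] powr_powr powr_minus powr_one)
  moreover have "lamE F \<alpha> s L > 0" using unique_min_lamE[OF L] by (simp add: unique_min_pos_def)
  ultimately show ?thesis using energyE_scale[OF L s, of "lamE F \<alpha> s L" F \<alpha>] by simp
qed

text \<open>The optimal value depends on L through \<open>coeff\<close> alone and is strictly
  increasing in it; for equal coefficients even the minimizers \<open>rmin\<close> agree.\<close>

lemma energyE_lamE_le_iff:
  assumes L: "(L :: (real^'n) set) \<in> lattices" and L': "(L' :: (real^'n) set) \<in> lattices"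
  shows "energyE F \<alpha> s (scale_lat (lamE F \<alpha> s L) L) \<le> energyE F \<alpha> s (scale_lat (lamE F \<alpha> s L') L')
    \<longleftrightarrow> e_star \<alpha> s L \<le> e_star \<alpha> s L'"
proof (cases "coeff \<alpha> s L" "coeff \<alpha> s L'" rule: linorder_cases)
  case less
  thus ?thesis using embedding_min_value_strict_mono[OF rmin[OF L] rmin[OF L'] less] L L'
    by (simp add: energyE_lamE e_star_le_iff)
next
  case equal
  thus ?thesis using L L' by (simp add: energyE_lamE e_star_le_iff rmin_def)
next
  case greater
  thus ?thesis using embedding_min_value_strict_mono[OF rmin[OF L'] rmin[OF L] greater] L L'
    by (simp add: energyE_lamE e_star_le_iff)
qed

lemma lamE_isometric:
  assumes "isometric_lat L (L' :: (real^'n) set)"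
  shows "lamE F \<alpha> s L' = lamE F \<alpha> s L"
proof -
  have "energyE F \<alpha> s (scale_lat c L') = energyE F \<alpha> s (scale_lat c L)" for c
    unfolding energyE_def using lat_energy_isometric[OF isometric_scale[OF assms]] by metis
  thus ?thesis by (simp add: lamE_def)
qed

text \<open>Every lattice is a multiple of one of unit density, so minimizing over the scale first
  leaves an increasing function of \<open>e_star\<close>. In the equality case the scale must itself
  be optimal; isometries pass in both directions because the covolume determines the scale.\<close>

lemma unique_min_e_star_iff:
  assumes D: "(D :: (real^'n) set) \<in> lattices1"
  shows "unique_min_lat lattices1 (e_star \<alpha> s) D \<longleftrightarrow>
    unique_min_lat lattices (energyE F \<alpha> s) (scale_lat (lamE F \<alpha> s D) D)" (is "?l \<longleftrightarrow> ?r")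
proof
  note sub = subsetD[OF lattices1_subset]
  let ?E = "energyE F \<alpha> s" and ?m = "lamE F \<alpha> s"
  have mpos: "?m L > 0" if "L \<in> lattices1" for L :: "(real^'n) set"
    using unique_min_lamE[OF sub[OF that]] by (simp add: unique_min_pos_def)
  {
    assume l: ?l
    have le: "?E (scale_lat (?m D) D) \<le> ?E (scale_lat (?m L) L)" if "L \<in> lattices1" for L :: "(real^'n) set"
      using l energyE_lamE_le_iff[OF sub[OF D] sub[OF that]] that by (simp add: unique_min_lat_def)
    show ?r unfolding unique_min_lat_def
    proof (intro conjI ballI impI)
      show "scale_lat (?m D) D \<in> lattices" by (rule scale_lat_in_lattices[OF sub[OF D] mpos[OF D]])
      fix L' :: "(real^'n) set" assume "L' \<in> lattices"
      then obtain c L where c: "c > 0" and L: "L \<in> lattices1" and L': "L' = scale_lat c L" by (rule lattice_eq_scale)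
      note um = unique_min_lamE[OF sub[OF L]]
      have le2: "?E (scale_lat (?m L) L) \<le> ?E L'" unfolding L' using unique_min_posD(2)[OF um c] .
      show "?E (scale_lat (?m D) D) \<le> ?E L'" using le[OF L] le2 by linarith
      assume eq: "?E L' = ?E (scale_lat (?m D) D)"
      have "?E (scale_lat c L) \<le> ?E (scale_lat (?m L) L)" using eq le[OF L] unfolding L' by linarith
      hence cm: "c = ?m L" using unique_min_posD(3)[OF um c] by simp
      hence "?E (scale_lat (?m L) L) \<le> ?E (scale_lat (?m D) D)" using eq L' by simp
      hence "e_star \<alpha> s L \<le> e_star \<alpha> s D" using energyE_lamE_le_iff[OF sub[OF L] sub[OF D]] by simp
      hence "isometric_lat D L" using l L by (auto simp: unique_min_lat_def)
      thus "isometric_lat (scale_lat (?m D) D) L'"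
        unfolding L' cm using lamE_isometric isometric_scale by metis
    qed
  }
  {
    assume r: ?r
    show ?l unfolding unique_min_lat_def
    proof (intro conjI ballI impI)
      show "D \<in> lattices1" by (rule D)
      fix L :: "(real^'n) set" assume L: "L \<in> lattices1"
      have in_lat: "scale_lat (?m L) L \<in> lattices" by (rule scale_lat_in_lattices[OF sub[OF L] mpos[OF L]])
      show "e_star \<alpha> s D \<le> e_star \<alpha> s L"
        using r in_lat energyE_lamE_le_iff[OF sub[OF D] sub[OF L]] by (auto simp: unique_min_lat_def)
      assume "e_star \<alpha> s L = e_star \<alpha> s D"
      hence "?E (scale_lat (?m L) L) = ?E (scale_lat (?m D) D)"
        using energyE_lamE_le_iff[OF sub[OF D] sub[OF L]] energyE_lamE_le_iff[OF sub[OF L] sub[OF D]] by auto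
      hence "isometric_lat (scale_lat (?m D) D) (scale_lat (?m L) L)"
        using r in_lat by (auto simp: unique_min_lat_def)
      thus "isometric_lat D L" by (rule isometric_scale_cancel(2)[OF D L mpos[OF D] mpos[OF L]])
    qed
  }
qed

text \<open>In \<open>lamE\<close> = (zeta(s) / \<open>rmin\<close>)^(1/s) the numerator is least at
  \<open>D\<close> by the first assumption, and \<open>rmin\<close> is greatest at \<open>D\<close>
  by the second. Equality forces equal numerators, where uniqueness is known.\<close>

lemma unique_min_lamE_of_unique_min_epstein:
  assumes D: "unique_min_lat lattices1 (\<lambda>L. epstein L s) (D :: (real^'n) set)"
    and e: "\<And>L :: (real^'n) set. L \<in> lattices1 \<Longrightarrow> e_star \<alpha> s D \<le> e_star \<alpha> s L"
  shows "unique_min_lat lattices1 (lamE F \<alpha> s) D"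
proof -
  note sub = subsetD[OF lattices1_subset]
  have D1: "D \<in> lattices1" using D by (simp add: unique_min_lat_def)
  note Dl = sub[OF D1]
  have *: "epstein D s \<le> epstein L s" "epstein D s / rmin D \<le> epstein L s / rmin D"
     "epstein L s / rmin D \<le> epstein L s / rmin L" "0 < epstein D s / rmin D" "0 < rmin D"
    if L: "L \<in> lattices1" for L
  proof -
    note Ll = sub[OF L]
    show "epstein D s \<le> epstein L s" using D L by (simp add: unique_min_lat_def)
    have pos: "rmin D > 0" "rmin L > 0" "epstein L s > 0" "epstein D s > 0"
      using rmin[OF Dl] rmin[OF Ll] epstein_pos[OF Ll s] epstein_pos[OF Dl s] by (auto simp: unique_min_pos_def)
    have "coeff \<alpha> s D \<le> coeff \<alpha> s L" using e[OF L] e_star_le_iff[OF Dl Ll] by simp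
    from embedding_argmin_antimono[OF E coeff_pos[OF Dl] this p_pos rmin[OF Dl] rmin[OF Ll]]
    have "rmin L \<le> rmin D" .
    thus "epstein L s / rmin D \<le> epstein L s / rmin L" using pos by (intro divide_left_mono) auto
    show "epstein D s / rmin D \<le> epstein L s / rmin D" "0 < epstein D s / rmin D" "0 < rmin D"
      using \<open>epstein D s \<le> epstein L s\<close> pos by (auto simp: divide_right_mono)
  qed
  show ?thesis unfolding unique_min_lat_def
  proof (intro conjI ballI impI)
    show "D \<in> lattices1" by (rule D1)
    fix L :: "(real^'n) set" assume L: "L \<in> lattices1"
    show "lamE F \<alpha> s D \<le> lamE F \<alpha> s L"
      unfolding lamE_eq[OF Dl] lamE_eq[OF sub[OF L]]
      using *[OF L] s_pos by (intro powr_mono2) auto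
    assume "lamE F \<alpha> s L = lamE F \<alpha> s D"
    hence "((epstein L s / rmin L) powr (1 / s)) powr s = ((epstein D s / rmin D) powr (1 / s)) powr s"
      unfolding lamE_eq[OF Dl] lamE_eq[OF sub[OF L]] by (rule arg_cong[where f = "\<lambda>x. x powr s"])
    hence "epstein L s / rmin L = epstein D s / rmin D"
      using *[OF L] s_pos by (simp add: powr_powr)
    hence "epstein L s / rmin D = epstein D s / rmin D" using *[OF L] by linarith
    hence "epstein L s = epstein D s" using *[OF L] by simp
    thus "isometric_lat D L" using D L by (auto simp: unique_min_lat_def)
  qed
qed

end

section \<open>The special case F(r) = -r\<close>

lemma embedding_uminus:
  assumes "p > 1"
  shows "embedding p uminus (\<lambda>_. -1)"
  unfolding embedding_def
proof (intro conjI allI impI)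
  show "(uminus has_real_derivative -1) (at r)" for r :: real
    by (auto intro!: derivative_eq_intros)
  show "strict_mono_on {r::real. 0 < r \<and> (-1::real) < 0} (\<lambda>r. r powr (1 - p) * -1)"
    using assms by (auto simp: strict_mono_on_def intro!: powr_less_mono2_neg)
  show "(\<lambda>r. r powr (1 - p) * -1) ` {r::real. 0 < r \<and> (-1::real) < 0} = {..<0}"
  proof (intro equalityI subsetI)
    fix y :: real assume "y \<in> {..<0}"
    thus "y \<in> (\<lambda>r. r powr (1 - p) * -1) ` {r. 0 < r \<and> (-1::real) < 0}"
      using assms by (intro image_eqI[of _ _ "(-y) powr (1 / (1 - p))"]) (auto simp: powr_powr)
  qed auto
qed auto

lemma lat_energy_phibar:
  assumes "(L :: (real^'n) set) \<in> lattices" "s > real CARD('n)" "\<alpha> > s"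
  shows "lat_energy (phibar \<alpha> s) L = energyE uminus \<alpha> s L"
  unfolding lat_energy_def phibar_def energyE_def
  using infsum_add[OF summable_on_lattice[OF assms(1), of \<alpha>]
      iffD2[OF summable_on_uminus summable_on_lattice[OF assms(1,2)]]] assms
  by (simp add: infsum_uminus)

text \<open>For F(r) = -r the stationarity condition reads r^(1 - p) = K p and can be solved in
  closed form.\<close>

lemma lam_bar_eq_lamE:
  assumes L: "(L :: (real^'n) set) \<in> lattices" and s: "s > real CARD('n)" and as: "\<alpha> > s"
  shows "lam_bar \<alpha> s L = lamE uminus \<alpha> s L"
proof -
  have s0: "s > 0" using s by (smt (verit) of_nat_0_le_iff)
  have p: "\<alpha> / s > 1" using s0 as by simp
  note E = embedding_uminus[OF p]
  let ?a = "epstein L \<alpha>" and ?b = "epstein L s" and ?p = "\<alpha> / s"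
  have pos: "?a > 0" "?b > 0" using epstein_pos[OF L] s as by auto
  obtain r where r: "unique_min_pos (\<lambda>r. - r + coeff \<alpha> s L * r powr ?p) r"
      "r powr (1 - ?p) * -1 = - (coeff \<alpha> s L * ?p)"
    using embedding_min[OF E coeff_pos[OF E s as L]] p by auto
  have r0: "r > 0" using r by (simp add: unique_min_pos_def)
  have rp: "r powr (1 - ?p) = ?a / ?b powr ?p * ?p" using r(2) by (simp add: coeff_def)
  have "(?b / r) powr (?p - 1) = ?b powr (?p - 1) * r powr (1 - ?p)"
    using pos r0 powr_minus[of r "?p - 1"] by (subst powr_divide) (auto simp: divide_inverse)
  also have "\<dots> = \<alpha> * ?a / (s * ?b)"
    unfolding rp using pos s0 by (simp add: powr_diff[of _ "\<alpha> / s" 1] mult.commute)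
  finally have *: "(?b / r) powr (?p - 1) = \<alpha> * ?a / (s * ?b)" .
  have "lamE uminus \<alpha> s L = (?b / r) powr (1 / s)"
    unfolding lamE_def using argmin_pos_eq[OF unique_min_pos_scale[OF E s as L r(1)]] .
  also have "\<dots> = ((?b / r) powr (?p - 1)) powr (1 / (\<alpha> - s))"
    using as s0 by (simp add: powr_powr field_simps)
  also have "\<dots> = lam_bar \<alpha> s L" unfolding * lam_bar_def ..
  finally show ?thesis ..
qed

lemma unique_min_pos_phibar:
  assumes L: "(L :: (real^'n) set) \<in> lattices" and s: "s > real CARD('n)" and as: "\<alpha> > s"
  shows "unique_min_pos (\<lambda>c. lat_energy (phibar \<alpha> s) (scale_lat c L)) (lam_bar \<alpha> s L)"
proof -
  have s0: "s > 0" using s by (smt (verit) of_nat_0_le_iff)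
  hence "\<alpha> / s > 1" using as by simp
  hence "unique_min_pos (\<lambda>c. energyE uminus \<alpha> s (scale_lat c L)) (lam_bar \<alpha> s L)"
    unfolding lam_bar_eq_lamE[OF L s as] by (intro unique_min_lamE[OF embedding_uminus] L s as)
  moreover have "energyE uminus \<alpha> s (scale_lat c L) = lat_energy (phibar \<alpha> s) (scale_lat c L)" if "c > 0" for c
    by (intro lat_energy_phibar[symmetric] scale_lat_in_lattices L s as that)
  ultimately show ?thesis by (auto simp: unique_min_pos_def)
qed

lemma unique_min_lat_cong:
  assumes "\<And>L. L \<in> S \<Longrightarrow> f L = g L"
  shows "unique_min_lat S f D \<longleftrightarrow> unique_min_lat S g D"
  using assms unfolding unique_min_lat_def by (metis (no_types, lifting))

lemma unique_min_e_star_iff_phibar: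
  assumes D: "(D :: (real^'n) set) \<in> lattices1" and s: "s > real CARD('n)" and as: "\<alpha> > s"
  shows "unique_min_lat lattices1 (e_star \<alpha> s) D \<longleftrightarrow>
    unique_min_lat lattices (lat_energy (phibar \<alpha> s)) (scale_lat (lam_bar \<alpha> s D) D)"
proof -
  have s0: "s > 0" using s by (smt (verit) of_nat_0_le_iff)
  hence "\<alpha> / s > 1" using as by simp
  hence "unique_min_lat lattices1 (e_star \<alpha> s) D \<longleftrightarrow>
    unique_min_lat lattices (energyE uminus \<alpha> s) (scale_lat (lamE uminus \<alpha> s D) D)"
    by (intro unique_min_e_star_iff[OF embedding_uminus] D s as)
  also have "lamE uminus \<alpha> s D = lam_bar \<alpha> s D"
    using lam_bar_eq_lamE[OF subsetD[OF lattices1_subset D] s as] by simp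
  also have "unique_min_lat lattices (energyE uminus \<alpha> s) (scale_lat (lam_bar \<alpha> s D) D) \<longleftrightarrow>
    unique_min_lat lattices (lat_energy (phibar \<alpha> s)) (scale_lat (lam_bar \<alpha> s D) D)"
    by (rule unique_min_lat_cong) (simp add: lat_energy_phibar[OF _ s as])
  finally show ?thesis .
qed

section \<open>Poisson summation for Gaussians\<close>

text \<open>Bridge between real-valued \<open>infsum\<close> and integrals over a counting measure,
  so that sums and integrals of nonnegative terms can be exchanged by Tonelli's theorem.\<close>

lemma nn_integral_count_space_infsum:
  fixes f :: "'a \<Rightarrow> real"
  assumes "f summable_on A" "\<And>x. x \<in> A \<Longrightarrow> f x \<ge> 0"
  shows "(\<integral>\<^sup>+x. ennreal (f x) \<partial>count_space A) = ennreal (infsum f A)"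
proof -
  have "(\<lambda>x. norm (f x)) summable_on A"
    using assms by (simp cong: summable_on_cong)
  note * = this[unfolded abs_summable_equivalent]
  show ?thesis using nn_integral_conv_infsetsum[OF * assms(2)] infsetsum_infsum[OF *] by simp
qed

lemma summable_on_int_exp_abs:
  assumes "c > (0::real)"
  shows "(\<lambda>k::int. exp (- c * \<bar>real_of_int k\<bar>)) summable_on UNIV"
proof -
  have "summable (\<lambda>n. exp (-c) ^ n)" using assms by (intro summable_geometric) auto
  hence S: "(\<lambda>n::nat. exp (- c * real n)) summable_on UNIV"
    by (intro summable_nonneg_imp_summable_on) (auto simp: exp_of_nat_mult[symmetric] mult.commute)
  have "(\<lambda>k::int. exp (- c * \<bar>real_of_int k\<bar>)) summable_on (range int)"
    using S by (subst summable_on_reindex) (auto simp: o_def)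
  moreover have "(\<lambda>k::int. exp (- c * \<bar>real_of_int k\<bar>)) summable_on (range (\<lambda>n. - int n))"
    using S by (subst summable_on_reindex) (auto simp: o_def inj_def)
  ultimately have "(\<lambda>k::int. exp (- c * \<bar>real_of_int k\<bar>)) summable_on (range int \<union> range (\<lambda>n. - int n))"
    by (rule summable_on_union)
  also have "range int \<union> range (\<lambda>n. - int n) = UNIV"
    by (metis (no_types, lifting) UNIV_eq_I UnI1 UnI2 int_cases2 range_eqI)
  finally show ?thesis .
qed

lemma abs_le_square_int: "\<bar>real_of_int k\<bar> \<le> (real_of_int k)\<^sup>2"
proof -
  have "\<bar>k\<bar> \<le> k\<^sup>2"
    using mult_left_mono[of 1 "\<bar>k\<bar>" "\<bar>k\<bar>"] by (cases "k = 0") (auto simp: power2_eq_square)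
  hence "real_of_int \<bar>k\<bar> \<le> real_of_int (k\<^sup>2)" by (rule of_int_le_iff[THEN iffD2])
  thus ?thesis by simp
qed

lemma summable_on_int_gauss:
  assumes "c > (0::real)"
  shows "(\<lambda>k::int. exp (- c * (real_of_int k)\<^sup>2)) summable_on UNIV"
  by (rule summable_on_comparison_test[OF summable_on_int_exp_abs[OF assms]])
    (use assms abs_le_square_int in auto)

text \<open>The real part of the characteristic function of the standard normal
  distribution.\<close>

lemma has_bochner_integral_std_normal_cos:
  "has_bochner_integral lborel (\<lambda>x. std_normal_density x * cos (u * x)) (exp (- u\<^sup>2 / 2))"
proof -
  interpret real_distribution std_normal_distribution by (rule real_dist_normal_dist)
  have int: "integrable std_normal_distribution (\<lambda>x. iexp (u * x))"
    by (rule integrable_const_bound[where B = 1]) auto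
  have "has_bochner_integral std_normal_distribution (\<lambda>x. iexp (u * x)) (complex_of_real (exp (- u\<^sup>2 / 2)))"
    using has_bochner_integral_integrable[OF int] char_std_normal_distribution
    by (simp add: char_def fun_eq_iff)
  hence "has_bochner_integral std_normal_distribution (\<lambda>x. Re (iexp (u * x))) (exp (- u\<^sup>2 / 2))"
    using has_bochner_integral_bounded_linear[OF bounded_linear_Re] by force
  hence "has_bochner_integral std_normal_distribution (\<lambda>x. cos (u * x)) (exp (- u\<^sup>2 / 2))"
    by (simp add: Re_exp)
  thus ?thesis by (simp add: has_bochner_integral_iff integrable_density integral_density)
qed

lemma has_bochner_integral_gauss_cos:
  assumes t: "t > 0"
  shows "has_bochner_integral lborel (\<lambda>x. exp (- pi * t * x\<^sup>2) * cos (2 * pi * v * x)) (exp (- pi * v\<^sup>2 / t) / sqrt t)"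
proof -
  define c where "c = sqrt (2 * pi * t)"
  have c: "c > 0" "c\<^sup>2 = 2 * pi * t" using t by (auto simp: c_def)
  define u where "u = 2 * pi * v / c"
  have "has_bochner_integral lborel (\<lambda>x. std_normal_density (0 + c * x) * cos (u * (0 + c * x))) (exp (- u\<^sup>2 / 2) /\<^sub>R \<bar>c\<bar>)"
    by (rule lborel_has_bochner_integral_real_affine_iff[THEN iffD1, OF _ has_bochner_integral_std_normal_cos])
      (use c in simp)
  hence "has_bochner_integral lborel (\<lambda>x. sqrt (2 * pi) * (std_normal_density (0 + c * x) * cos (u * (0 + c * x))))
     (sqrt (2 * pi) * (exp (- u\<^sup>2 / 2) /\<^sub>R \<bar>c\<bar>))"
    by (rule has_bochner_integral_mult_right)
  moreover have "sqrt (2 * pi) * (std_normal_density (0 + c * x) * cos (u * (0 + c * x)))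
      = exp (- pi * t * x\<^sup>2) * cos (2 * pi * v * x)" for x
    using c by (simp add: std_normal_density_def power_mult_distrib u_def mult.assoc)
  moreover have "sqrt (2 * pi) * (exp (- u\<^sup>2 / 2) /\<^sub>R \<bar>c\<bar>) = exp (- pi * v\<^sup>2 / t) / sqrt t"
  proof -
    have "- u\<^sup>2 / 2 = - pi * v\<^sup>2 / t"
      unfolding u_def power_divide c(2) using t by (simp add: power_mult_distrib) (simp add: power2_eq_square field_simps)
    thus ?thesis using t by (simp add: c_def real_sqrt_mult field_simps)
  qed
  ultimately show ?thesis by simp
qed

text \<open>Adding 1 to the cosine keeps the integrand nonnegative, so Fourier coefficients can be
  computed with \<open>nn_integral\<close> and no integrability has to be shown beforehand.\<close>

lemma nn_integral_gauss_cos: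
  assumes t: "t > 0"
  shows "(\<integral>\<^sup>+x. ennreal (exp (- pi * t * x\<^sup>2) * (1 + cos (2 * pi * v * x))) \<partial>lborel)
    = ennreal ((1 + exp (- pi * v\<^sup>2 / t)) / sqrt t)"
proof -
  have "has_bochner_integral lborel (\<lambda>x. exp (- pi * t * x\<^sup>2) * cos (2 * pi * 0 * x) + exp (- pi * t * x\<^sup>2) * cos (2 * pi * v * x))
      (exp (- pi * 0\<^sup>2 / t) / sqrt t + exp (- pi * v\<^sup>2 / t) / sqrt t)"
    by (intro has_bochner_integral_add has_bochner_integral_gauss_cos t)
  hence *: "has_bochner_integral lborel (\<lambda>x. exp (- pi * t * x\<^sup>2) * (1 + cos (2 * pi * v * x))) ((1 + exp (- pi * v\<^sup>2 / t)) / sqrt t)"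
    by (simp add: distrib_left add_divide_distrib)
  show ?thesis
    by (subst nn_integral_eq_integral)
      (use * has_bochner_integral_integral_eq[OF *] in \<open>auto simp: has_bochner_integral_iff intro!: AE_I2 mult_nonneg_nonneg\<close>,
       smt (verit) cos_ge_minus_one)
qed

lemma cos_int_shift: "cos (2 * pi * real_of_int k * (x + real_of_int n)) = cos (2 * pi * real_of_int k * x)"
proof -
  have "2 * pi * real_of_int k * (x + real_of_int n) = 2 * pi * real_of_int k * x + 2 * pi * real_of_int (k * n)"
    by (simp add: algebra_simps)
  thus ?thesis by (metis cos_add cos_int_2pin sin_int_2pin diff_zero mult.right_neutral mult_zero_right)
qed

text \<open>Each real lies in exactly one integer translate of [0, 1). Tonelli's theorem and
  translation invariance do the rest.\<close>

lemma periodization_nn_integral: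
  fixes \<phi> :: "real \<Rightarrow> ennreal"
  assumes [measurable]: "\<phi> \<in> borel_measurable borel"
  shows "(\<integral>\<^sup>+x. (\<integral>\<^sup>+n. \<phi> (x + real_of_int n) \<partial>count_space UNIV) * indicator {0..<1} x \<partial>lborel) = (\<integral>\<^sup>+x. \<phi> x \<partial>lborel)"
proof -
  have "(\<integral>\<^sup>+x. (\<integral>\<^sup>+n. \<phi> (x + real_of_int n) \<partial>count_space UNIV) * indicator {0..<1} x \<partial>lborel)
     = (\<integral>\<^sup>+x. (\<integral>\<^sup>+n. \<phi> (x + real_of_int n) * indicator {0..<1} x \<partial>count_space UNIV) \<partial>lborel)"
    by (simp add: nn_integral_multc)
  also have "\<dots> = (\<integral>\<^sup>+n. (\<integral>\<^sup>+x. \<phi> (x + real_of_int n) * indicator {0..<1} x \<partial>lborel) \<partial>count_space UNIV)"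
    by (rule nn_integral_count_space_nn_integral) auto
  also have "\<dots> = (\<integral>\<^sup>+n. (\<integral>\<^sup>+x. \<phi> x * indicator {0..<1} (x - real_of_int n) \<partial>lborel) \<partial>count_space UNIV)"
  proof (rule nn_integral_cong)
    fix n :: int
    show "(\<integral>\<^sup>+x. \<phi> (x + real_of_int n) * indicator {0..<1} x \<partial>lborel) = (\<integral>\<^sup>+x. \<phi> x * indicator {0..<1} (x - real_of_int n) \<partial>lborel)"
      by (subst (2) nn_integral_real_affine[where c = 1 and t = "real_of_int n"]) (auto simp: add.commute)
  qed
  also have "\<dots> = (\<integral>\<^sup>+x. (\<integral>\<^sup>+n. \<phi> x * indicator {0..<1} (x - real_of_int n) \<partial>count_space UNIV) \<partial>lborel)"
    by (rule nn_integral_count_space_nn_integral[symmetric]) auto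
  also have "\<dots> = (\<integral>\<^sup>+x. \<phi> x \<partial>lborel)"
  proof (rule nn_integral_cong)
    fix x :: real
    have ind: "indicator {0..<1} (x - real_of_int n) = (indicator {\<lfloor>x\<rfloor>} n :: ennreal)" for n
    proof -
      have "x - real_of_int n \<in> {0..<1} \<longleftrightarrow> n = \<lfloor>x\<rfloor>" by (simp, linarith)
      thus ?thesis by (simp add: indicator_def)
    qed
    show "(\<integral>\<^sup>+n. \<phi> x * indicator {0..<1} (x - real_of_int n) \<partial>count_space UNIV) = \<phi> x"
      unfolding ind by (simp add: nn_integral_cmult)
  qed
  finally show ?thesis .
qed

text \<open>The symmetry makes D a continuous function G of cos(2 pi x). By the product formula for
  cosines, D is orthogonal to all powers of cos(2 pi x), hence to all polynomials in it.
  Approximating G by such polynomials shows that the integral of D^2 is 0.\<close>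

lemma even_periodic_eq_0_of_cos_coeffs_eq_0:
  fixes D :: "real \<Rightarrow> real"
  assumes cont: "continuous_on {0..1} D" and sym: "\<And>x. x \<in> {0..1} \<Longrightarrow> D (1 - x) = D x"
    and coeffs: "\<And>k::int. integral {0..1} (\<lambda>x. D x * cos (2 * pi * real_of_int k * x)) = 0"
    and x: "x \<in> {0..1}"
  shows "D x = 0"
proof -
  have int: "f integrable_on {0..1}" if "continuous_on {0..1} f" for f :: "real \<Rightarrow> real"
    using integrable_continuous_real that by blast
  have pow: "integral {0..1} (\<lambda>x. D x * cos (2 * pi * x) ^ i * cos (2 * pi * real_of_int k * x)) = 0" for i and k :: int
  proof (induction i arbitrary: k)
    case 0
    then show ?case using coeffs by simp
  next
    case (Suc i)
    have eq: "D x * cos (2 * pi * x) ^ Suc i * cos (2 * pi * real_of_int k * x) =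
       (D x * cos (2 * pi * x) ^ i * cos (2 * pi * real_of_int (k + 1) * x)
       + D x * cos (2 * pi * x) ^ i * cos (2 * pi * real_of_int (k - 1) * x)) / 2" for x
    proof -
      have "2 * pi * real_of_int (k + 1) * x = 2 * pi * real_of_int k * x + 2 * pi * x"
           "2 * pi * real_of_int (k - 1) * x = 2 * pi * real_of_int k * x - 2 * pi * x"
        by (auto simp: algebra_simps)
      thus ?thesis by (simp only: cos_add cos_diff) (simp add: algebra_simps)
    qed
    have "integral {0..1} (\<lambda>x. D x * cos (2 * pi * x) ^ Suc i * cos (2 * pi * real_of_int k * x)) =
       integral {0..1} (\<lambda>x. (D x * cos (2 * pi * x) ^ i * cos (2 * pi * real_of_int (k + 1) * x)
       + D x * cos (2 * pi * x) ^ i * cos (2 * pi * real_of_int (k - 1) * x)) / 2)" by (intro integral_cong eq)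
    also have "\<dots> = 0"
      by (subst integral_divide, subst integral_add)
        (use Suc.IH[of "k + 1"] Suc.IH[of "k - 1"] in \<open>auto intro!: int continuous_intros cont\<close>)
    finally show ?case .
  qed
  define G where "G = (\<lambda>y. D (arccos y / (2 * pi)))"
  have ran: "arccos y / (2 * pi) \<in> {0..1}" if "y \<in> {-1..1}" for y
    using that arccos_lbound[of y] arccos_ubound[of y] pi_gt_zero by (auto simp: field_simps)
  have contG: "continuous_on {-1..1} G" unfolding G_def
    by (rule continuous_on_compose2[OF cont]) (use ran in \<open>auto intro!: continuous_intros\<close>)
  have DG: "D x = G (cos (2 * pi * x))" if "x \<in> {0..1}" for x
  proof (cases "x \<le> 1 / 2")
    case True
    hence "arccos (cos (2 * pi * x)) = 2 * pi * x" using that by (intro arccos_cos) auto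
    thus ?thesis by (simp add: G_def)
  next
    case False
    have "cos (2 * pi * x) = cos (2 * pi * (1 - x))" by (simp add: algebra_simps cos_diff)
    moreover have "arccos (cos (2 * pi * (1 - x))) = 2 * pi * (1 - x)"
      using that False by (intro arccos_cos) auto
    ultimately show ?thesis using sym[OF that] by (simp add: G_def)
  qed
  obtain M where "\<forall>y\<in>D ` {0..1}. norm y \<le> M"
    using compact_imp_bounded[OF compact_continuous_image[OF cont compact_Icc]]
    unfolding bounded_iff by blast
  hence M: "\<bar>D x\<bar> \<le> M" if "x \<in> {0..1}" for x using that by auto
  have M0: "M \<ge> 0" using M[of 0] by simp
  have sq: "integral {0..1} (\<lambda>x. D x * D x) \<le> M * e" if e: "e > 0" for e
  proof -
    obtain g where g: "real_polynomial_function g" "\<And>y. y \<in> {-1..1} \<Longrightarrow> \<bar>G y - g y\<bar> < e"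
      using Stone_Weierstrass_real_polynomial_function[OF compact_Icc contG e] by metis
    then obtain a n where gn: "g = (\<lambda>y. \<Sum>i\<le>n. a i * y ^ i)" using real_polynomial_function_iff_sum by auto
    have "integral {0..1} (\<lambda>x. D x * g (cos (2 * pi * x))) = integral {0..1} (\<lambda>x. \<Sum>i\<le>n. a i * (D x * cos (2 * pi * x) ^ i))"
      by (simp add: gn sum_distrib_left algebra_simps)
    also have "\<dots> = (\<Sum>i\<le>n. a i * integral {0..1} (\<lambda>x. D x * cos (2 * pi * x) ^ i))"
      by (subst integral_sum) (auto intro!: int continuous_intros cont)
    also have "\<dots> = 0" using pow[of _ 0] by simp
    finally have 0: "integral {0..1} (\<lambda>x. D x * g (cos (2 * pi * x))) = 0" .
    have contg: "continuous_on {0..1} (\<lambda>x. g (cos (2 * pi * x)))"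
      unfolding gn by (intro continuous_intros)
    have "integral {0..1} (\<lambda>x. D x * D x) = integral {0..1} (\<lambda>x. D x * (D x - g (cos (2 * pi * x))) + D x * g (cos (2 * pi * x)))"
      by (simp add: right_diff_distrib)
    also have "\<dots> = integral {0..1} (\<lambda>x. D x * (D x - g (cos (2 * pi * x)))) + integral {0..1} (\<lambda>x. D x * g (cos (2 * pi * x)))"
      by (intro integral_add int continuous_intros cont contg)
    also have "\<dots> = integral {0..1} (\<lambda>x. D x * (D x - g (cos (2 * pi * x))))" using 0 by simp
    also have "\<dots> \<le> integral {0..1} (\<lambda>x::real. M * e)"
    proof (rule integral_le)
      show "(\<lambda>x. D x * (D x - g (cos (2 * pi * x)))) integrable_on {0..1}"
        by (intro int continuous_intros cont contg)
      show "D x * (D x - g (cos (2 * pi * x))) \<le> M * e" if x: "x \<in> {0..1}" for x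
      proof -
        have "\<bar>D x - g (cos (2 * pi * x))\<bar> \<le> e" using g(2)[of "cos (2 * pi * x)"] DG[OF x] by fastforce
        hence "\<bar>D x\<bar> * \<bar>D x - g (cos (2 * pi * x))\<bar> \<le> M * e" by (intro mult_mono M x M0) auto
        thus ?thesis by (metis abs_ge_self abs_mult order_trans)
      qed
    qed auto
    finally show ?thesis by simp
  qed
  have "integral {0..1} (\<lambda>x. D x * D x) \<le> 0"
  proof (rule field_le_epsilon)
    fix e :: real assume e: "e > 0"
    have "integral {0..1} (\<lambda>x. D x * D x) \<le> M * (e / (M + 1))" using e M0 by (intro sq) auto
    also have "\<dots> \<le> 0 + e" using e M0 by (simp add: field_simps)
    finally show "integral {0..1} (\<lambda>x. D x * D x) \<le> 0 + e" .
  qed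
  moreover have "integral {0..1} (\<lambda>x. D x * D x) \<ge> 0"
    by (intro integral_nonneg int continuous_intros cont) auto
  ultimately have "integral {0..1} (\<lambda>x. D x * D x) = 0" by simp
  hence "\<forall>x\<in>{0..1}. D x * D x = 0"
    by (subst (asm) integral_eq_0_iff) (auto intro!: continuous_intros cont)
  thus ?thesis using x by simp
qed

lemma integral_cos_cos:
  "integral {0..1} (\<lambda>x. cos (2 * pi * real_of_int j * x) * cos (2 * pi * real_of_int k * x)) =
    ((if j = k then 1 else 0) + (if j = - k then 1 else 0)) / 2"
proof -
  have 1: "integral {0..1} (\<lambda>x. cos (2 * pi * real_of_int m * x)) = (if m = 0 then 1 else 0)" for m
  proof (cases "m = 0")
    case False
    have "((\<lambda>x. cos (2 * pi * real_of_int m * x)) has_integral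
        (sin (2 * pi * real_of_int m * 1) / (2 * pi * real_of_int m) - sin (2 * pi * real_of_int m * 0) / (2 * pi * real_of_int m))) {0..1}"
      by (rule fundamental_theorem_of_calculus)
        (use False in \<open>auto intro!: derivative_eq_intros simp: has_real_derivative_iff_has_vector_derivative[symmetric]\<close>)
    thus ?thesis using False sin_int_2pin[of m] by (simp add: integral_unique)
  qed simp
  have eq: "cos (2 * pi * real_of_int j * x) * cos (2 * pi * real_of_int k * x) =
     (cos (2 * pi * real_of_int (j - k) * x) + cos (2 * pi * real_of_int (j + k) * x)) / 2" for x
  proof -
    have "2 * pi * real_of_int (j - k) * x = 2 * pi * real_of_int j * x - 2 * pi * real_of_int k * x"
         "2 * pi * real_of_int (j + k) * x = 2 * pi * real_of_int j * x + 2 * pi * real_of_int k * x"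
      by (auto simp: algebra_simps)
    thus ?thesis by (simp only: cos_add cos_diff) (simp add: algebra_simps)
  qed
  have "integral {0..1} (\<lambda>x. cos (2 * pi * real_of_int j * x) * cos (2 * pi * real_of_int k * x)) =
     integral {0..1} (\<lambda>x. (cos (2 * pi * real_of_int (j - k) * x) + cos (2 * pi * real_of_int (j + k) * x)) / 2)" by (intro integral_cong eq)
  also have "\<dots> = (integral {0..1} (\<lambda>x. cos (2 * pi * real_of_int (j - k) * x)) + integral {0..1} (\<lambda>x. cos (2 * pi * real_of_int (j + k) * x))) / 2"
    by (subst integral_divide, subst integral_add) (auto intro!: integrable_continuous_real continuous_intros)
  finally show ?thesis unfolding 1 by (simp add: add_eq_0_iff)
qed

text \<open>From (x + n)^2 \<ge> n^2/2 - x^2; for |x| \<le> 1 the majorant no longer depends on x,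
  as the Weierstrass test requires.\<close>

lemma summable_on_int_shifted_gauss:
  assumes t: "t > 0"
  shows "(\<lambda>n::int. exp (- pi * t * (x + real_of_int n)\<^sup>2)) summable_on UNIV"
    and "\<bar>x\<bar> \<le> 1 \<Longrightarrow> exp (- pi * t * (x + real_of_int n)\<^sup>2) \<le> exp (pi * t) * exp (- (pi * t / 2) * (real_of_int n)\<^sup>2)"
proof -
  have le: "exp (- pi * t * (x + real_of_int n)\<^sup>2) \<le> exp (pi * t * x\<^sup>2) * exp (- (pi * t / 2) * (real_of_int n)\<^sup>2)" for n
  proof -
    have "0 \<le> (2 * x + real_of_int n)\<^sup>2" by simp
    hence "(real_of_int n)\<^sup>2 / 2 - x\<^sup>2 \<le> (x + real_of_int n)\<^sup>2" by (simp add: power2_eq_square algebra_simps)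
    hence "pi * t * ((real_of_int n)\<^sup>2 / 2 - x\<^sup>2) \<le> pi * t * (x + real_of_int n)\<^sup>2"
      using t by (intro mult_left_mono) auto
    thus ?thesis by (simp add: algebra_simps flip: exp_add)
  qed
  have "(\<lambda>n::int. exp (pi * t * x\<^sup>2) * exp (- (pi * t / 2) * (real_of_int n)\<^sup>2)) summable_on UNIV"
    using t by (intro summable_on_cmult_right summable_on_int_gauss) auto
  thus "(\<lambda>n::int. exp (- pi * t * (x + real_of_int n)\<^sup>2)) summable_on UNIV"
    by (rule summable_on_comparison_test) (use le in auto)
  assume "\<bar>x\<bar> \<le> 1"
  hence "x\<^sup>2 \<le> 1" by (simp add: abs_square_le_1)
  hence "pi * t * x\<^sup>2 \<le> pi * t * 1" using t by (intro mult_left_mono) auto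
  hence "exp (pi * t * x\<^sup>2) * exp (- (pi * t / 2) * (real_of_int n)\<^sup>2) \<le> exp (pi * t) * exp (- (pi * t / 2) * (real_of_int n)\<^sup>2)"
    by (intro mult_right_mono) auto
  with le[of n] show "exp (- pi * t * (x + real_of_int n)\<^sup>2) \<le> exp (pi * t) * exp (- (pi * t / 2) * (real_of_int n)\<^sup>2)"
    by linarith
qed

text \<open>\<open>f\<close> is the periodized Gaussian and \<open>h / sqrt t\<close> its expected
  Fourier series. Both are continuous, of period 1 and even, and they have the same cosine
  coefficients.\<close>

lemma poisson_summation_gauss:
  assumes t: "t > 0"
  shows "infsum (\<lambda>n::int. exp (- pi * t * (x + real_of_int n)\<^sup>2)) UNIV =
     infsum (\<lambda>k::int. exp (- pi * (real_of_int k)\<^sup>2 / t) * cos (2 * pi * real_of_int k * x)) UNIV / sqrt t"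
proof -
  define f where "f = (\<lambda>x. infsum (\<lambda>n::int. exp (- pi * t * (x + real_of_int n)\<^sup>2)) UNIV)"
  define e where "e = (\<lambda>k::int. exp (- pi * (real_of_int k)\<^sup>2 / t))"
  define h where "h = (\<lambda>x. infsum (\<lambda>k::int. e k * cos (2 * pi * real_of_int k * x)) UNIV)"
  have e_sum: "e summable_on UNIV"
    using summable_on_int_gauss[of "pi / t"] t by (simp add: e_def)
  have e_nn: "e k \<ge> 0" for k by (simp add: e_def)
  have "uniform_limit {0..1} (\<lambda>X y. \<Sum>n\<in>X. exp (- pi * t * (y + real_of_int n)\<^sup>2)) f (finite_subsets_at_top UNIV)"
    unfolding f_def
  proof (rule Weierstrass_m_test_general)
    show "(\<lambda>n::int. exp (pi * t) * exp (- (pi * t / 2) * (real_of_int n)\<^sup>2)) summable_on UNIV"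
      using t by (intro summable_on_cmult_right summable_on_int_gauss) auto
  qed (use summable_on_int_shifted_gauss(2)[OF t] in auto)
  hence contf: "continuous_on {0..1} f"
    by (rule uniform_limit_theorem[rotated]) (auto intro!: always_eventually continuous_intros)
  have ul_h: "uniform_limit {0..1} (\<lambda>X y. \<Sum>k\<in>X. e k * cos (2 * pi * real_of_int k * y)) h (finite_subsets_at_top UNIV)"
    unfolding h_def
    by (rule Weierstrass_m_test_general[OF _ e_sum]) (auto simp: abs_mult e_nn intro!: mult_left_le)
  hence conth: "continuous_on {0..1} h"
    by (rule uniform_limit_theorem[rotated]) (auto intro!: always_eventually continuous_intros)
  have f_shift: "f (x + real_of_int m) = f x" for x m
    unfolding f_def
    by (rule infsum_reindex_bij_witness[of _ "\<lambda>n. n - m" "\<lambda>n. n + m"]) (auto simp: add_ac)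
  have h_shift: "h (x + real_of_int m) = h x" for x m
    by (simp add: h_def cos_int_shift)
  have f_sym: "f (1 - x) = f x" for x
    unfolding f_def
  proof (rule infsum_reindex_bij_witness[of _ "\<lambda>n. - 1 - n" "\<lambda>n. - 1 - n"])
    fix n :: int
    have "x + real_of_int (- 1 - n) = - (1 - x + real_of_int n)" by simp
    thus "exp (- pi * t * (x + real_of_int (- 1 - n))\<^sup>2) = exp (- pi * t * (1 - x + real_of_int n)\<^sup>2)"
      by (simp only: power2_minus)
  qed auto
  have h_sym: "h (1 - x) = h x" for x
  proof -
    have "cos (2 * pi * real_of_int k * (1 - x)) = cos (2 * pi * real_of_int k * x)" for k
      using cos_int_shift[of k "- x" 1] by simp
    thus ?thesis by (simp add: h_def)
  qed
  \<comment> \<open>Coefficients of \<open>f\<close> against 1 + cos, a nonnegative weight, by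
    unfolding the periodization.\<close>
  have f_coeff2: "((\<lambda>x. f x * (1 + cos (2 * pi * real_of_int k * x))) has_integral (1 + e k) / sqrt t) {0..1}" for k
  proof -
    let ?c = "\<lambda>x. 1 + cos (2 * pi * real_of_int k * x)"
    let ?\<phi> = "\<lambda>x. ennreal (exp (- pi * t * x\<^sup>2) * ?c x)"
    have c0: "?c x \<ge> 0" for x using cos_ge_minus_one[of "2 * pi * real_of_int k * x"] by linarith
    have f0: "f x \<ge> 0" for x unfolding f_def by (intro infsum_nonneg) auto
    have inner: "(\<integral>\<^sup>+n. ?\<phi> (x + real_of_int n) \<partial>count_space UNIV) = ennreal (f x * ?c x)" for x
    proof -
      have "(\<integral>\<^sup>+n. ?\<phi> (x + real_of_int n) \<partial>count_space UNIV) =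
          (\<integral>\<^sup>+n. ennreal (exp (- pi * t * (x + real_of_int n)\<^sup>2) * ?c x) \<partial>count_space UNIV)"
        by (simp only: cos_int_shift)
      also have "\<dots> = ennreal (infsum (\<lambda>n::int. exp (- pi * t * (x + real_of_int n)\<^sup>2) * ?c x) UNIV)"
        by (rule nn_integral_count_space_infsum)
          (use c0 summable_on_int_shifted_gauss(1)[OF t] in \<open>auto intro!: summable_on_cmult_left mult_nonneg_nonneg\<close>)
      finally show ?thesis by (simp add: infsum_cmult_left' f_def)
    qed
    have "(\<integral>\<^sup>+x. ennreal (f x * ?c x) * indicator {0..<1} x \<partial>lborel) = ennreal ((1 + e k) / sqrt t)"
      using periodization_nn_integral[of ?\<phi>] nn_integral_gauss_cos[OF t, of "real_of_int k"]
      unfolding inner by (simp add: e_def)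
    hence *: "(\<integral>\<^sup>+x. ennreal (indicator {0..<1} x *\<^sub>R (f x * ?c x)) \<partial>lborel) = ennreal ((1 + e k) / sqrt t)"
      by (simp add: ennreal_mult' mult.commute ennreal_indicator f0 c0 indicator_mult_ennreal)
    have "((\<lambda>x. indicator {0..<1} x *\<^sub>R (f x * ?c x)) has_integral (1 + e k) / sqrt t) UNIV"
    proof (rule nn_integral_has_integral[OF _ _ *])
      have "(\<lambda>x. indicator {0..<1} x *\<^sub>R (f x * ?c x)) \<in> borel_measurable borel"
        by (rule borel_measurable_continuous_on_indicator)
          (auto intro!: continuous_intros continuous_on_subset[OF contf])
      thus "(\<lambda>x. indicator {0..<1} x *\<^sub>R (f x * ?c x)) \<in> borel_measurable borel" by simp
      show "0 \<le> (1 + e k) / sqrt t" using e_nn[of k] t by auto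
    qed (use f0 c0 in auto)
    also have "(\<lambda>x. indicator {0..<1} x *\<^sub>R (f x * ?c x)) = (\<lambda>x. if x \<in> {0..<1} then f x * ?c x else 0)"
      by (auto simp: indicator_def)
    finally have *: "((\<lambda>x. f x * ?c x) has_integral (1 + e k) / sqrt t) {0..<1}"
      by (simp only: has_integral_restrict_UNIV)
    have "negligible {x \<in> {0..1} - {0..<1}. f x * ?c x \<noteq> 0}"
      by (rule negligible_subset[of "{1}"]) auto
    moreover have "negligible {x \<in> {0..<1} - {0..1}. f x * ?c x \<noteq> 0}"
      by (rule negligible_subset[of "{}"]) auto
    ultimately show ?thesis
      by (rule has_integral_spike_set_eq[THEN iffD2, OF _ _ *])
  qed
  have f_coeff: "((\<lambda>x. f x * cos (2 * pi * real_of_int k * x)) has_integral e k / sqrt t) {0..1}" for k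
  proof -
    \<comment> \<open>For frequency 0 the weight is the constant 2, so half of that integral removes
      the added 1.\<close>
    have "((\<lambda>x. f x * (1 + cos (2 * pi * real_of_int k * x)) - f x * (1 + cos (2 * pi * real_of_int 0 * x)) / 2)
        has_integral ((1 + e k) / sqrt t - (1 + e 0) / sqrt t / 2)) {0..1}"
      by (intro has_integral_diff has_integral_divide f_coeff2)
    moreover have "(1 + e k) / sqrt t - (1 + e 0) / sqrt t / 2 = e k / sqrt t"
      by (simp add: e_def add_divide_distrib)
    ultimately show ?thesis by (simp add: algebra_simps)
  qed
  have h_coeff: "((\<lambda>x. h x * cos (2 * pi * real_of_int j * x)) has_integral e j) {0..1}" for j
  proof -
    let ?g = "\<lambda>k x. e k * cos (2 * pi * real_of_int k * x) * cos (2 * pi * real_of_int j * x)"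
    have "uniform_limit {0..1} (\<lambda>X y. \<Sum>k\<in>X. ?g k y) (\<lambda>y. infsum (\<lambda>k. ?g k y) UNIV) (finite_subsets_at_top UNIV)"
      by (rule Weierstrass_m_test_general[OF _ e_sum])
        (auto simp: abs_mult e_nn mult.assoc intro!: mult_left_le mult_le_one)
    also have "(\<lambda>y. infsum (\<lambda>k. ?g k y) UNIV) = (\<lambda>y. h y * cos (2 * pi * real_of_int j * y))"
      by (simp add: h_def infsum_cmult_left')
    finally have "uniform_limit (cbox 0 1) (\<lambda>X y. \<Sum>k\<in>X. ?g k y) (\<lambda>y. h y * cos (2 * pi * real_of_int j * y)) (finite_subsets_at_top UNIV)"
      by simp
    then obtain I J where IJ: "\<And>X. ((\<lambda>y. \<Sum>k\<in>X. ?g k y) has_integral I X) (cbox 0 1)"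
        "((\<lambda>y. h y * cos (2 * pi * real_of_int j * y)) has_integral J) (cbox 0 1)"
        "(I \<longlongrightarrow> J) (finite_subsets_at_top UNIV)"
      by (rule uniform_limit_integral_cbox) (auto intro!: continuous_intros)
    let ?d = "\<lambda>k. e k * (((if k = j then 1 else 0) + (if k = - j then 1 else 0)) / 2)"
    have I: "I X = (\<Sum>k\<in>X. ?d k)" if "finite X" for X
    proof -
      have "I X = integral {0..1} (\<lambda>y. \<Sum>k\<in>X. ?g k y)" using IJ(1)[of X] by (simp add: integral_unique)
      also have "\<dots> = (\<Sum>k\<in>X. integral {0..1} (?g k))"
        by (rule integral_sum[OF that]) (auto intro!: integrable_continuous_real continuous_intros)
      also have "\<dots> = (\<Sum>k\<in>X. ?d k)"
      proof (rule sum.cong)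
        fix k assume "k \<in> X"
        have "integral {0..1} (?g k) = integral {0..1} (\<lambda>y. e k * (cos (2 * pi * real_of_int k * y) * cos (2 * pi * real_of_int j * y)))"
          by (simp only: mult.assoc[of "e k"])
        thus "integral {0..1} (?g k) = ?d k" by (simp only: integral_mult_right integral_cos_cos)
      qed auto
      finally show ?thesis .
    qed
    have "(?d has_sum J) UNIV"
    proof -
      have "\<forall>\<^sub>F X in finite_subsets_at_top UNIV. I X = sum ?d X"
        by (rule eventually_finite_subsets_at_top_weakI) (rule I)
      from tendsto_cong[OF this] IJ(3) show ?thesis unfolding has_sum_def by blast
    qed
    moreover have "(?d has_sum e j) UNIV"
    proof (rule has_sum_finite_neutralI[of "{j, - j}"])
      \<comment> \<open>The indices j and -j contribute half each; for j = 0 they coincide and both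
        indicators fire at once.\<close>
      show "e j = sum ?d {j, - j}" by (cases "j = 0") (auto simp: e_def)
    qed auto
    ultimately have "J = e j" by (rule has_sum_unique)
    thus ?thesis using IJ(2) by simp
  qed
  have D0: "f x - h x / sqrt t = 0" if "x \<in> {0..1}" for x
  proof (rule even_periodic_eq_0_of_cos_coeffs_eq_0[OF _ _ _ that])
    show "continuous_on {0..1} (\<lambda>x. f x - h x / sqrt t)"
      using t by (intro continuous_intros contf conth) auto
    show "f (1 - x) - h (1 - x) / sqrt t = f x - h x / sqrt t" for x by (simp add: f_sym h_sym)
    show "integral {0..1} (\<lambda>x. (f x - h x / sqrt t) * cos (2 * pi * real_of_int k * x)) = 0" for k
    proof (rule integral_unique)
      have "((\<lambda>x. f x * cos (2 * pi * real_of_int k * x) - h x * cos (2 * pi * real_of_int k * x) / sqrt t)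
        has_integral (e k / sqrt t - e k / sqrt t)) {0..1}"
        by (intro has_integral_diff has_integral_divide f_coeff h_coeff)
      thus "((\<lambda>x. (f x - h x / sqrt t) * cos (2 * pi * real_of_int k * x)) has_integral 0) {0..1}"
        by (simp add: algebra_simps)
    qed
  qed
  have "f x = f (frac x)" "h x = h (frac x)"
    using f_shift[of "frac x" "\<lfloor>x\<rfloor>"] h_shift[of "frac x" "\<lfloor>x\<rfloor>"] by (simp_all add: frac_def)
  moreover have "frac x \<in> {0..1}" using frac_ge_0[of x] frac_lt_1[of x] by auto
  ultimately have "f x = h x / sqrt t" using D0[of "frac x"] by simp
  thus ?thesis by (simp add: f_def h_def e_def)
qed

section \<open>Theta functions of binary quadratic forms\<close>

lemma exp_ge_taylor5: "1 + x + x\<^sup>2 / 2 + x ^ 3 / 6 + x ^ 4 / 24 + x ^ 5 / 120 \<le> exp (x::real)"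
proof -
  obtain t where "exp x = (\<Sum>m<6. x ^ m / fact m) + (exp t / fact 6) * x ^ 6"
    using Maclaurin_exp_le[of x 6] by blast
  \<comment> \<open>Stopping at an odd degree makes the remainder an even power, so the bound also
    holds for negative x.\<close>
  moreover have "(exp t / fact 6) * x ^ 6 \<ge> 0" by (intro mult_nonneg_nonneg) auto
  ultimately show ?thesis by (simp add: numeral_eq_Suc lessThan_Suc)
qed

lemma exp_le_taylor:
  assumes "0 \<le> v" "v \<le> (1::real)"
  shows "exp v \<le> 1 + v + v\<^sup>2 / 2 + v ^ 3 / 6 + v ^ 4 / 8"
proof -
  obtain t where t: "\<bar>t\<bar> \<le> \<bar>v\<bar>" "exp v = (\<Sum>m<4. v ^ m / fact m) + (exp t / fact 4) * v ^ 4"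
    using Maclaurin_exp_le[of v 4] by blast
  have "exp t \<le> exp 1" using t assms by simp
  also have "\<dots> \<le> 3" by (rule exp_le)
  finally have "exp t / fact 4 * v ^ 4 \<le> 3 / fact 4 * v ^ 4" by (intro mult_right_mono divide_right_mono) auto
  thus ?thesis using t by (simp add: numeral_eq_Suc lessThan_Suc)
qed

lemma minus_le_of_square_le_square:
  "x\<^sup>2 \<le> y\<^sup>2 \<Longrightarrow> 0 \<le> y \<Longrightarrow> - y \<le> (x::real)"
  using abs_le_square_iff[of x y] by linarith

text \<open>The case \<open>\<kappa> = 36/10\<close> of \<open>sum3_exp_ge\<close>, centered: \<open>v = \<kappa> (c - 1)\<close>, and \<open>756/1000\<close> comes from \<open>c \<le> 121/100\<close>.\<close>

lemma sum3_exp_ge_aux: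
  fixes x y z v :: real
  assumes "x + y + z = 0" and sq: "x\<^sup>2 + y\<^sup>2 + z\<^sup>2 = 3 / 2 * (v\<^sup>2 + 72 / 10 * v)"
    and v: "0 \<le> v" "v \<le> 756 / 1000"
  shows "3 * exp v \<le> exp x + exp y + exp z" and "v > 0 \<Longrightarrow> 3 * exp v < exp x + exp y + exp z"
proof -
  define P where "P = v\<^sup>2 + 72 / 10 * v"
  define e where "e = x * y * z"
  have z: "z = - x - y" using assms by simp
  have P: "x\<^sup>2 + x * y + y\<^sup>2 = 3 / 4 * P"
    using sq by (simp add: P_def z power2_eq_square algebra_simps)
  have P0: "P \<ge> 0" using v by (simp add: P_def)
  have Ple: "P \<le> 7956 / 1000 * v"
  proof -
    have "v * v \<le> 756 / 1000 * v" using v by (intro mult_right_mono) auto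
    thus ?thesis by (simp add: P_def power2_eq_square)
  qed
  have P6: "P \<le> 602 / 100" using Ple v by linarith
  have p3: "x ^ 3 + y ^ 3 + z ^ 3 = 3 * e" unfolding e_def z by algebra
  have p4: "x ^ 4 + y ^ 4 + z ^ 4 = 9 / 8 * P\<^sup>2"
  proof -
    have "x ^ 4 + y ^ 4 + z ^ 4 = 2 * (x\<^sup>2 + x * y + y\<^sup>2)\<^sup>2" unfolding z by algebra
    thus ?thesis unfolding P by (simp add: power2_eq_square)
  qed
  have p5: "x ^ 5 + y ^ 5 + z ^ 5 = 15 / 4 * P * e"
  proof -
    have "x ^ 5 + y ^ 5 + z ^ 5 = 5 * (x\<^sup>2 + x * y + y\<^sup>2) * e" unfolding z e_def by algebra
    thus ?thesis unfolding P by simp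
  qed
  \<comment> \<open>The discriminant of the cubic with roots \<open>x, y, z\<close> is nonnegative.\<close>
  have "4 * (x\<^sup>2 + x * y + y\<^sup>2) ^ 3 - 27 * e\<^sup>2 = ((x - y) * (y - z) * (z - x))\<^sup>2"
    unfolding e_def z by algebra
  hence "27 * e\<^sup>2 \<le> 4 * (3 / 4 * P) ^ 3" unfolding P by (metis diff_ge_0_iff_ge zero_le_power2)
  hence e2: "e\<^sup>2 \<le> P ^ 3 / 16" by (simp add: power_mult_distrib power_divide)
  \<comment> \<open>Replaces |e| \<le> P^(3/2)/4 by a polynomial bound: sqrt P \<le> (P + 4)/4 by
    the arithmetic-geometric mean inequality, with equality at P = 4.\<close>
  have "P ^ 3 / 16 = (P * (P + 4) / 16)\<^sup>2 - (P * (P - 4) / 16)\<^sup>2" by (simp add: power2_eq_square power3_eq_cube field_simps)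
  hence "e\<^sup>2 \<le> (P * (P + 4) / 16)\<^sup>2" using e2 zero_le_power2[of "P * (P - 4) / 16"] by linarith
  hence e: "- (P * (P + 4) / 16) \<le> e" using P0 by (intro minus_le_of_square_le_square) auto
  have "e * (1 / 2 + P / 32) \<ge> - (P * (P + 4) / 16) * (1 / 2 + P / 32)"
    using P0 by (intro mult_right_mono[OF e]) auto
  hence lower: "e / 2 + P * e / 32 \<ge> - (P * (P + 4) / 16) * (1 / 2 + P / 32)" by (simp add: algebra_simps)
  have taylor: "3 + 3 / 4 * P + (3 * e) / 6 + (9 / 8 * P\<^sup>2) / 24 + (15 / 4 * P * e) / 120 \<le> exp x + exp y + exp z"
    using exp_ge_taylor5[of x] exp_ge_taylor5[of y] exp_ge_taylor5[of z] p3 p4 p5 sq z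
    unfolding P_def[symmetric] by linarith
  have A: "3 + 5 / 8 * P + P\<^sup>2 / 128 - P ^ 3 / 512 \<le> exp x + exp y + exp z"
  proof -
    have "3 + 3 / 4 * P + (3 * e) / 6 + (9 / 8 * P\<^sup>2) / 24 + (15 / 4 * P * e) / 120 =
        3 + 3 / 4 * P + 3 / 64 * P\<^sup>2 + (e / 2 + P * e / 32)" by simp
    moreover have "- (P * (P + 4) / 16) * (1 / 2 + P / 32) = - P / 8 - 5 / 128 * P\<^sup>2 - P ^ 3 / 512"
      by (simp add: field_simps power2_eq_square power3_eq_cube)
    ultimately show ?thesis using lower taylor by linarith
  qed
  have "P\<^sup>2 * (P - 4) \<le> (7956 / 1000 * v)\<^sup>2 * (202 / 100)"
  \<comment> \<open>The higher terms of the lower bound are - P^2 (P - 4)/512, harmful only for P >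
    4; there P - 4 is at most 602/100 - 4.\<close>
  proof (cases "P \<ge> 4")
    case True
    have "P\<^sup>2 \<le> (7956 / 1000 * v)\<^sup>2" using Ple P0 by (intro power_mono) auto
    thus ?thesis using True P6 by (intro mult_mono) auto
  next
    case False
    hence "P\<^sup>2 * (P - 4) \<le> 0" by (intro mult_nonneg_nonpos) auto
    also have "0 \<le> (7956 / 1000 * v)\<^sup>2 * (202 / 100)" by simp
    finally show ?thesis .
  qed
  also have "\<dots> \<le> 133 * v\<^sup>2" by (simp add: power2_eq_square)
  finally have "P ^ 3 - 4 * P\<^sup>2 \<le> 133 * v\<^sup>2"
    by (simp add: algebra_simps power2_eq_square power3_eq_cube)
  moreover have "0 \<le> v\<^sup>2" by simp
  ultimately have "P\<^sup>2 / 128 - P ^ 3 / 512 \<ge> - (26 / 100 * v\<^sup>2)" by linarith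
  hence A: "3 + 5 / 8 * P - 26 / 100 * v\<^sup>2 \<le> exp x + exp y + exp z" using A by linarith
  have B: "exp v \<le> 1 + v + v\<^sup>2 / 2 + v ^ 3 / 6 + v ^ 4 / 8" using v by (intro exp_le_taylor) auto
  have v2: "v\<^sup>2 \<le> 756 / 1000 * v" using mult_right_mono[OF v(2) v(1)] by (simp add: power2_eq_square)
  have v3: "v ^ 3 \<le> 756 / 1000 * (756 / 1000 * v)" and v4: "v ^ 4 \<le> 756 / 1000 * (756 / 1000 * (756 / 1000 * v))"
  proof -
    have "v * v\<^sup>2 \<le> 756 / 1000 * (756 / 1000 * v)" using v v2 by (intro mult_mono) auto
    thus v3: "v ^ 3 \<le> 756 / 1000 * (756 / 1000 * v)" by (simp add: power2_eq_square power3_eq_cube)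
    have "v * v ^ 3 \<le> 756 / 1000 * (756 / 1000 * (756 / 1000 * v))" using v v3 by (intro mult_mono) auto
    thus "v ^ 4 \<le> 756 / 1000 * (756 / 1000 * (756 / 1000 * v))" by (simp add: power_numeral_reduce)
  qed
  \<comment> \<open>The linear terms decide: 5/8 * 72/10 = 4.5 against 3, enough to absorb all
    higher powers for v \<le> 756/1000. The slack v/100 provides strictness.\<close>
  have "3 * exp v + v / 100 \<le> 3 + 5 / 8 * P - 26 / 100 * v\<^sup>2"
    using B v2 v3 v4 v unfolding P_def by (simp add: field_simps)
  thus "3 * exp v \<le> exp x + exp y + exp z" "v > 0 \<Longrightarrow> 3 * exp v < exp x + exp y + exp z"
    using A v by linarith+
qed

text \<open>Convexity gives q exp b \<le> exp (q b) + (q - 1), and the assumption that the mean of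
  the exponentials is at least 1 absorbs the constants. This carries an inequality from one value of
  \<kappa> to all larger ones.\<close>

lemma exp_sum_power_mean:
  fixes b :: "'a \<Rightarrow> real"
  assumes "finite S" "q \<ge> 1" "real (card S) \<le> (\<Sum>i\<in>S. exp (b i))"
  shows "(\<Sum>i\<in>S. exp (b i)) \<le> (\<Sum>i\<in>S. exp (q * b i))"
proof -
  have "q * exp (b i) \<le> exp (q * b i) + (q - 1)" for i
  proof -
    have "exp (b i) \<le> (1 / q) * exp (q * b i) + (1 - 1 / q)"
      using convex_onD[OF exp_convex, of "1 / q" 0 "q * b i"] assms(2) by (simp add: algebra_simps)
    hence "q * exp (b i) \<le> q * ((1 / q) * exp (q * b i) + (1 - 1 / q))"
      using assms(2) by (intro mult_left_mono) auto
    thus ?thesis using assms(2) by (simp add: distrib_left right_diff_distrib)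
  qed
  hence "(\<Sum>i\<in>S. q * exp (b i)) \<le> (\<Sum>i\<in>S. exp (q * b i) + (q - 1))" by (rule sum_mono)
  hence "q * (\<Sum>i\<in>S. exp (b i)) \<le> (\<Sum>i\<in>S. exp (q * b i)) + (q - 1) * real (card S)"
    by (simp add: sum.distrib sum_distrib_left mult.commute)
  moreover have "(q - 1) * real (card S) \<le> (q - 1) * (\<Sum>i\<in>S. exp (b i))"
    using assms by (intro mult_left_mono) auto
  ultimately show ?thesis by (simp add: algebra_simps)
qed

text \<open>In the application \<open>r, s, t\<close> are \<open>c + sqrt (c\<^sup>2 - 1) cos \<omega>\<^sub>j\<close> for three angles \<open>\<omega>\<^sub>j\<close> at distance \<open>2\<pi>/3\<close>,
  and \<open>c\<close> is the hyperbolic cosine of the distance of \<open>z\<close> from \<open>exp(\<pi>i/3)\<close>.\<close>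

lemma sum3_exp_ge:
  fixes r s t c \<kappa> :: real
  assumes sum: "r + s + t = 3 * c" and sq: "r\<^sup>2 + s\<^sup>2 + t\<^sup>2 = 9 / 2 * c\<^sup>2 - 3 / 2"
    and c: "1 \<le> c" "c \<le> 121 / 100" and \<kappa>: "36 / 10 \<le> \<kappa>"
  shows "3 * exp (- \<kappa>) \<le> exp (- \<kappa> * r) + exp (- \<kappa> * s) + exp (- \<kappa> * t)"
    and "c > 1 \<Longrightarrow> 3 * exp (- \<kappa>) < exp (- \<kappa> * r) + exp (- \<kappa> * s) + exp (- \<kappa> * t)"
proof -
  define k :: real where "k = 36 / 10"
  define v where "v = k * (c - 1)"
  define f where "f = (\<lambda>j::nat. if j = 0 then r else if j = 1 then s else t)"
  have 1: "- k * (r - c) + - k * (s - c) + - k * (t - c) = 0" proof -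
    have "- k * (r - c) + - k * (s - c) + - k * (t - c) = - k * (r + s + t - 3 * c)" by algebra
    thus ?thesis using sum by simp
  qed
  have 2: "(- k * (r - c))\<^sup>2 + (- k * (s - c))\<^sup>2 + (- k * (t - c))\<^sup>2 = 3 / 2 * (v\<^sup>2 + 72 / 10 * v)"
  proof -
    have "(- k * (r - c))\<^sup>2 + (- k * (s - c))\<^sup>2 + (- k * (t - c))\<^sup>2 =
       k\<^sup>2 * ((r\<^sup>2 + s\<^sup>2 + t\<^sup>2) - 2 * c * (r + s + t) + 3 * c\<^sup>2)" by algebra
    also have "\<dots> = k\<^sup>2 * (3 / 2 * c\<^sup>2 - 3 / 2)" unfolding sum sq by (simp add: power2_eq_square algebra_simps)
    also have "\<dots> = 3 / 2 * (v\<^sup>2 + 72 / 10 * v)" by (simp add: v_def k_def power2_eq_square field_simps)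
    finally show ?thesis .
  qed
  have v: "0 \<le> v" "v \<le> 756 / 1000" using c by (auto simp: v_def k_def)
  define q where "q = \<kappa> / k"
  have q: "q \<ge> 1" using \<kappa> by (simp add: q_def k_def)
  \<comment> \<open>Dividing by exp(-k) normalizes the claim to a sum of three exponentials that is
    at least 3, the form required by the power mean argument.\<close>
  define b where "b = (\<lambda>j. k * (1 - f j))"
  have eb: "exp (b j) = exp (- k * (f j - c)) / exp v" for j
    by (simp add: b_def v_def algebra_simps flip: exp_diff)
  have sb: "(\<Sum>j<3. exp (b j)) = (exp (- k * (r - c)) + exp (- k * (s - c)) + exp (- k * (t - c))) / exp v"
    by (simp only: eb) (simp add: f_def numeral_eq_Suc lessThan_Suc add_divide_distrib)
  have s3: "3 \<le> (\<Sum>j<3. exp (b j))" "v > 0 \<Longrightarrow> 3 < (\<Sum>j<3. exp (b j))"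
    using sum3_exp_ge_aux[OF 1 2 v] unfolding sb by (auto simp: field_simps)
  have pm: "(\<Sum>j<3. exp (b j)) \<le> (\<Sum>j<3. exp (q * b j))"
    using q s3 by (intro exp_sum_power_mean) auto
  have "q * k = \<kappa>" by (simp add: q_def k_def)
  hence "q * b j = \<kappa> - \<kappa> * f j" for j
    unfolding b_def mult.assoc[symmetric] by (simp add: right_diff_distrib)
  hence eq: "exp (q * b j) = exp (- \<kappa> * f j) / exp (- \<kappa>)" for j by (simp flip: exp_diff)
  have "(\<Sum>j<3. exp (q * b j)) = (exp (- \<kappa> * r) + exp (- \<kappa> * s) + exp (- \<kappa> * t)) / exp (- \<kappa>)"
    by (simp only: eq) (simp add: f_def numeral_eq_Suc lessThan_Suc add_divide_distrib)
  with pm s3 have 3: "3 \<le> (exp (- \<kappa> * r) + exp (- \<kappa> * s) + exp (- \<kappa> * t)) / exp (- \<kappa>)"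
    "v > 0 \<Longrightarrow> 3 < (exp (- \<kappa> * r) + exp (- \<kappa> * s) + exp (- \<kappa> * t)) / exp (- \<kappa>)" by linarith+
  show "3 * exp (- \<kappa>) \<le> exp (- \<kappa> * r) + exp (- \<kappa> * s) + exp (- \<kappa> * t)"
    using 3(1) by (subst (asm) pos_le_divide_eq) auto
  show "3 * exp (- \<kappa>) < exp (- \<kappa> * r) + exp (- \<kappa> * s) + exp (- \<kappa> * t)" if "c > 1"
  proof -
    have "v > 0" using that by (simp add: v_def k_def)
    thus ?thesis using 3(2) pos_less_divide_eq[of "exp (- \<kappa>)" 3] by simp
  qed
qed

text \<open>\<open>qform x y (m, n) = |m z + n|\<^sup>2 / y\<close> with \<open>z = x + iy\<close>: the form of a lattice of unit density.\<close>

definition qform :: "real \<Rightarrow> real \<Rightarrow> int \<times> int \<Rightarrow> real" where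
  "qform x y k = ((real_of_int (snd k) + real_of_int (fst k) * x)\<^sup>2 + (real_of_int (fst k) * y)\<^sup>2) / y"

abbreviation hexform :: "int \<times> int \<Rightarrow> real" where
  "hexform \<equiv> qform (1 / 2) (sqrt 3 / 2)"

text \<open>The norm form of the Eisenstein integers, in the basis exp(pi i/3), 1.\<close>

definition hexnorm :: "int \<times> int \<Rightarrow> int" where
  "hexnorm k = (fst k)\<^sup>2 + fst k * snd k + (snd k)\<^sup>2"

text \<open>Multiplication by exp(2 pi i/3) in the same basis; it has order three and preserves
  \<open>hexnorm\<close>.\<close>

definition rot3 :: "int \<times> int \<Rightarrow> int \<times> int" where
  "rot3 k = (snd k, - fst k - snd k)"

lemma hexform_eq: "hexform k = 2 / sqrt 3 * real_of_int (hexnorm k)"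
proof -
  have "(real_of_int (snd k) + real_of_int (fst k) * (1 / 2))\<^sup>2 + (real_of_int (fst k) * (sqrt 3 / 2))\<^sup>2 = real_of_int (hexnorm k)"
    by (simp add: hexnorm_def power_mult_distrib power_divide) (simp add: power2_eq_square field_simps)
  thus ?thesis by (simp add: qform_def)
qed

lemma hexnorm_ge_half: "real_of_int (hexnorm k) \<ge> ((real_of_int (fst k))\<^sup>2 + (real_of_int (snd k))\<^sup>2) / 2"
proof -
  have "0 \<le> (real_of_int (fst k) + real_of_int (snd k))\<^sup>2" by simp
  thus ?thesis by (simp add: hexnorm_def power2_eq_square algebra_simps)
qed

lemma hexnorm_pos:
  assumes "k \<noteq> 0"
  shows "hexnorm k \<ge> 1"
proof -
  have "fst k \<noteq> 0 \<or> snd k \<noteq> 0" using assms by (auto simp: prod_eq_iff)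
  hence "(real_of_int (fst k))\<^sup>2 + (real_of_int (snd k))\<^sup>2 > 0"
    by (auto simp: add_pos_nonneg add_nonneg_pos)
  hence "real_of_int (hexnorm k) > 0" by (rule less_le_trans[OF half_gt_zero hexnorm_ge_half])
  thus ?thesis by simp
qed

lemma rot3_cube: "rot3 (rot3 (rot3 k)) = k"
  by (simp add: rot3_def)

lemma rot3_0_iff [simp]: "rot3 k = 0 \<longleftrightarrow> k = 0"
  by (auto simp: rot3_def zero_prod_def prod_eq_iff)

lemma bij_rot3: "bij_betw rot3 (UNIV - {0}) (UNIV - {0})"
  by (rule bij_betw_byWitness[where f' = "\<lambda>k. rot3 (rot3 k)"]) (auto simp: rot3_cube)

lemma qform_pos:
  assumes "y > 0" "k \<noteq> 0"
  shows "qform x y k > 0"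
proof -
  have "(real_of_int (snd k) + real_of_int (fst k) * x)\<^sup>2 + (real_of_int (fst k) * y)\<^sup>2 > 0"
  proof (cases "fst k = 0")
    case True
    hence "snd k \<noteq> 0" using assms by (auto simp: prod_eq_iff)
    thus ?thesis using True by simp
  next
    case False
    thus ?thesis using assms by (intro add_nonneg_pos) auto
  qed
  thus ?thesis using assms by (simp add: qform_def)
qed

text \<open>\<tau> is the ratio of the two forms. It equals c plus a part that turns with the
  rotation: the turning part averages to zero over an orbit, and its squared amplitude c^2 - 1 is
  fixed by the unit discriminant. Thus neither moment depends on k.\<close>

lemma rot3_orbit_sums:
  fixes x y :: real
  assumes y: "y > 0" and k: "k \<noteq> 0"
  defines "c \<equiv> (x\<^sup>2 + y\<^sup>2 + 1 - x) / (sqrt 3 * y)"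
  defines "\<tau> \<equiv> \<lambda>k'. sqrt 3 * qform x y k' / (2 * real_of_int (hexnorm k))"
  shows "\<tau> k + \<tau> (rot3 k) + \<tau> (rot3 (rot3 k)) = 3 * c"
    and "(\<tau> k)\<^sup>2 + (\<tau> (rot3 k))\<^sup>2 + (\<tau> (rot3 (rot3 k)))\<^sup>2 = 9 / 2 * c\<^sup>2 - 3 / 2"
proof -
  obtain m n where mn: "k = (m, n)" by (cases k)
  define M N where "M = real_of_int m" and "N = real_of_int n"
  define A where "A = (x\<^sup>2 + y\<^sup>2) / y"
  define B where "B = 2 * x / y"
  define C where "C = 1 / y"
  have disc: "4 * A * C - B\<^sup>2 = 4" using y by (simp add: A_def B_def C_def power2_eq_square field_simps)
  define h where "h = M\<^sup>2 + M * N + N\<^sup>2"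
  have h: "real_of_int (hexnorm k) = h" by (simp add: h_def hexnorm_def mn M_def N_def)
  have h0: "h > 0" using hexnorm_pos[OF k] h by linarith
  have q1: "qform x y k = A * M\<^sup>2 + B * M * N + C * N\<^sup>2"
    using y by (simp add: qform_def mn M_def N_def A_def B_def C_def power2_eq_square field_simps)
  have q2: "qform x y (rot3 k) = A * N\<^sup>2 + B * N * (- M - N) + C * (- M - N)\<^sup>2"
    using y by (simp add: qform_def rot3_def mn M_def N_def A_def B_def C_def power2_eq_square field_simps)
  have q3: "qform x y (rot3 (rot3 k)) = A * (- M - N)\<^sup>2 + B * (- M - N) * M + C * M\<^sup>2"
    using y by (simp add: qform_def rot3_def mn M_def N_def A_def B_def C_def power2_eq_square field_simps)
  have s3: "sqrt 3 * sqrt 3 = (3::real)" by simp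
  have "c = (x\<^sup>2 + y\<^sup>2 + 1 - x) / y * (1 / sqrt 3)" by (simp add: c_def)
  also have "1 / sqrt 3 = sqrt 3 / 3" by (simp add: field_simps)
  also have "(x\<^sup>2 + y\<^sup>2 + 1 - x) / y = A + C - B / 2" using y by (simp add: A_def B_def C_def field_simps)
  finally have c: "c = (2 * A + 2 * C - B) * sqrt 3 / 6" by (simp add: field_simps)
  have S1: "qform x y k + qform x y (rot3 k) + qform x y (rot3 (rot3 k)) = h * (2 * A + 2 * C - B)"
    unfolding q1 q2 q3 h_def by algebra
  have "(qform x y k)\<^sup>2 + (qform x y (rot3 k))\<^sup>2 + (qform x y (rot3 (rot3 k)))\<^sup>2 =
     h\<^sup>2 * ((2 * A + 2 * C - B)\<^sup>2 - (4 * A * C - B\<^sup>2)) / 2"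
    unfolding q1 q2 q3 h_def by algebra
  hence S2: "(qform x y k)\<^sup>2 + (qform x y (rot3 k))\<^sup>2 + (qform x y (rot3 (rot3 k)))\<^sup>2 =
     h\<^sup>2 * ((2 * A + 2 * C - B)\<^sup>2 - 4) / 2" unfolding disc .
  have "\<tau> k + \<tau> (rot3 k) + \<tau> (rot3 (rot3 k)) =
     sqrt 3 * (qform x y k + qform x y (rot3 k) + qform x y (rot3 (rot3 k))) / (2 * h)"
    by (simp add: \<tau>_def h add_divide_distrib distrib_left)
  also have "\<dots> = 3 * c" unfolding S1 c using h0 by (simp add: field_simps)
  finally show "\<tau> k + \<tau> (rot3 k) + \<tau> (rot3 (rot3 k)) = 3 * c" .
  have "(\<tau> k)\<^sup>2 + (\<tau> (rot3 k))\<^sup>2 + (\<tau> (rot3 (rot3 k)))\<^sup>2 =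
     3 * ((qform x y k)\<^sup>2 + (qform x y (rot3 k))\<^sup>2 + (qform x y (rot3 (rot3 k)))\<^sup>2) / (4 * h\<^sup>2)"
    by (simp add: \<tau>_def h add_divide_distrib distrib_left power_mult_distrib power_divide)
  also have "\<dots> = 3 / 8 * ((2 * A + 2 * C - B)\<^sup>2 - 4)" unfolding S2 using h0 by simp
  also have "\<dots> = 9 / 2 * c\<^sup>2 - 3 / 2" unfolding c by (simp add: power_mult_distrib power_divide)
  finally show "(\<tau> k)\<^sup>2 + (\<tau> (rot3 k))\<^sup>2 + (\<tau> (rot3 (rot3 k)))\<^sup>2 = 9 / 2 * c\<^sup>2 - 3 / 2" .
qed

lemma exp_rot3_orbit_ge:
  assumes y: "y > 0" and k: "k \<noteq> 0" and u: "u \<ge> 1"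
    and le: "x\<^sup>2 + y\<^sup>2 + 1 - x \<le> 121 / 100 * (sqrt 3 * y)"
  shows "3 * exp (- pi * u * hexform k) \<le>
      exp (- pi * u * qform x y k) + exp (- pi * u * qform x y (rot3 k)) + exp (- pi * u * qform x y (rot3 (rot3 k)))"
    and "(x, y) \<noteq> (1 / 2, sqrt 3 / 2) \<Longrightarrow> 3 * exp (- pi * u * hexform k) <
      exp (- pi * u * qform x y k) + exp (- pi * u * qform x y (rot3 k)) + exp (- pi * u * qform x y (rot3 (rot3 k)))"
proof -
  define c where "c = (x\<^sup>2 + y\<^sup>2 + 1 - x) / (sqrt 3 * y)"
  define \<tau> where "\<tau> = (\<lambda>k'. sqrt 3 * qform x y k' / (2 * real_of_int (hexnorm k)))"
  define \<kappa> where "\<kappa> = pi * u * (2 / sqrt 3) * real_of_int (hexnorm k)"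
  have sums: "\<tau> k + \<tau> (rot3 k) + \<tau> (rot3 (rot3 k)) = 3 * c"
    "(\<tau> k)\<^sup>2 + (\<tau> (rot3 k))\<^sup>2 + (\<tau> (rot3 (rot3 k)))\<^sup>2 = 9 / 2 * c\<^sup>2 - 3 / 2"
    unfolding \<tau>_def c_def by (rule rot3_orbit_sums[OF y k])+
  have h: "real_of_int (hexnorm k) \<ge> 1" using hexnorm_pos[OF k] by simp
  have eq: "x\<^sup>2 + y\<^sup>2 + 1 - x - sqrt 3 * y = (x - 1 / 2)\<^sup>2 + (y - sqrt 3 / 2)\<^sup>2"
    by (simp add: power2_eq_square algebra_simps)
  have c1: "c \<ge> 1"
  proof -
    have "x\<^sup>2 + y\<^sup>2 + 1 - x - sqrt 3 * y \<ge> 0" unfolding eq by simp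
    thus ?thesis using y by (simp add: c_def)
  qed
  have c2: "c \<le> 121 / 100" using le y by (simp add: c_def field_simps)
  \<comment> \<open>2 pi / sqrt 3 is about 3.627; this is where u \<ge> 1 and \<open>hexnorm\<close>
    \<ge> 1 enter.\<close>
  have \<kappa>: "36 / 10 \<le> \<kappa>"
  proof -
    have "sqrt 3 \<le> (1733 / 1000 :: real)" by (rule real_le_lsqrt) (auto simp: power2_eq_square)
    moreover have "314 / 100 \<le> pi" using pi_approx(1) by simp
    ultimately have "36 / 10 * sqrt 3 \<le> 2 * pi" by linarith
    hence "36 / 10 \<le> pi * (2 / sqrt 3)" by (simp add: field_simps)
    also have "\<dots> \<le> pi * (2 / sqrt 3) * (u * real_of_int (hexnorm k))"
      using mult_mono[of 1 u 1 "real_of_int (hexnorm k)"] u h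
        mult_left_mono[of 1 "u * real_of_int (hexnorm k)" "pi * (2 / sqrt 3)"] by simp
    finally show ?thesis by (simp add: \<kappa>_def mult_ac)
  qed
  have \<kappa>\<tau>: "- \<kappa> * \<tau> k' = - pi * u * qform x y k'" for k'
    using h by (simp add: \<kappa>_def \<tau>_def)
  have \<kappa>h: "- \<kappa> = - pi * u * hexform k" by (simp add: \<kappa>_def hexform_eq)
  show "3 * exp (- pi * u * hexform k) \<le>
      exp (- pi * u * qform x y k) + exp (- pi * u * qform x y (rot3 k)) + exp (- pi * u * qform x y (rot3 (rot3 k)))"
    by (rule sum3_exp_ge(1)[OF sums c1 c2 \<kappa>, unfolded \<kappa>\<tau>, unfolded \<kappa>h])
  assume ne: "(x, y) \<noteq> (1 / 2, sqrt 3 / 2)"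
  have "(x - 1 / 2)\<^sup>2 + (y - sqrt 3 / 2)\<^sup>2 > 0" using ne by (auto simp: sum_power2_gt_zero_iff)
  hence "c > 1" unfolding eq[symmetric] using y by (simp add: c_def)
  thus "3 * exp (- pi * u * hexform k) <
      exp (- pi * u * qform x y k) + exp (- pi * u * qform x y (rot3 k)) + exp (- pi * u * qform x y (rot3 (rot3 k)))"
    by (rule sum3_exp_ge(2)[OF sums c1 c2 \<kappa>, unfolded \<kappa>\<tau>, unfolded \<kappa>h])
qed

lemma summable_on_prod_mult:
  fixes f g :: "_ \<Rightarrow> real"
  assumes f: "f summable_on A" "\<And>x. x \<in> A \<Longrightarrow> f x \<ge> 0" and g: "g summable_on B" "\<And>y. y \<in> B \<Longrightarrow> g y \<ge> 0"
  shows "(\<lambda>k. f (fst k) * g (snd k)) summable_on (A \<times> B)"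
proof (rule summable_on_SigmaI[where g = "\<lambda>x. f x * infsum g B"])
  show "((\<lambda>y. f (fst (x, y)) * g (snd (x, y))) has_sum f x * infsum g B) B" for x
    using has_sum_cmult_right[OF has_sum_infsum[OF g(1)], of "f x"] by simp
  show "(\<lambda>x. f x * infsum g B) summable_on A" by (rule summable_on_cmult_left[OF f(1)])
qed (use f g in auto)

lemma infsum_prod_mult:
  fixes f g :: "_ \<Rightarrow> real"
  assumes f: "f summable_on A" "\<And>x. x \<in> A \<Longrightarrow> f x \<ge> 0" and g: "g summable_on B" "\<And>y. y \<in> B \<Longrightarrow> g y \<ge> 0"
  shows "infsum (\<lambda>k. f (fst k) * g (snd k)) (A \<times> B) = infsum f A * infsum g B"
proof -
  have "infsum (\<lambda>k. f (fst k) * g (snd k)) (A \<times> B) = infsum (\<lambda>x. infsum (\<lambda>y. f x * g y) B) A"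
    using infsum_Sigma'_banach[of "\<lambda>x y. f x * g y" A "\<lambda>_. B"] summable_on_prod_mult[OF assms]
    by (simp add: case_prod_unfold)
  thus ?thesis by (simp add: infsum_cmult_left' infsum_cmult_right')
qed

lemma qform_lower_bound:
  assumes y: "y > 0"
  obtains c where "c > 0" "\<And>k. c * ((real_of_int (fst k))\<^sup>2 + (real_of_int (snd k))\<^sup>2) \<le> qform x y k"
proof
  \<comment> \<open>Chosen so that M \<ge> 2 and M y^2 \<ge> 2 x^2 + 1, the two coefficients left
    after bounding n^2 by 2 (n + m x)^2 + 2 x^2 m^2.\<close>
  define M where "M = 2 + (2 * x\<^sup>2 + 1) / y\<^sup>2"
  have M: "M > 0" "M \<ge> 2" using y by (auto simp: M_def intro!: add_pos_nonneg)
  show "1 / (M * y) > 0" using M y by simp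
  fix k :: "int \<times> int"
  define m n where "m = real_of_int (fst k)" and "n = real_of_int (snd k)"
  have My: "M * y\<^sup>2 \<ge> 2 * x\<^sup>2 + 1" using y by (simp add: M_def field_simps)
  have "0 \<le> (n + 2 * (m * x))\<^sup>2" by simp
  hence "n\<^sup>2 \<le> 2 * (n + m * x)\<^sup>2 + 2 * x\<^sup>2 * m\<^sup>2" by (simp add: power2_eq_square algebra_simps)
  hence "m\<^sup>2 + n\<^sup>2 \<le> 2 * (n + m * x)\<^sup>2 + (2 * x\<^sup>2 + 1) * m\<^sup>2" by (simp add: algebra_simps)
  also have "\<dots> \<le> M * (n + m * x)\<^sup>2 + (M * y\<^sup>2) * m\<^sup>2"
    using M My by (intro add_mono mult_right_mono) auto
  also have "\<dots> = M * (y * qform x y k)"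
  proof -
    have "y * qform x y k = (n + m * x)\<^sup>2 + m\<^sup>2 * y\<^sup>2"
      using y by (simp add: qform_def m_def n_def power_mult_distrib)
    thus ?thesis by (simp add: algebra_simps)
  qed
  finally have "m\<^sup>2 + n\<^sup>2 \<le> M * (y * qform x y k)" .
  thus "1 / (M * y) * (m\<^sup>2 + n\<^sup>2) \<le> qform x y k" using M y by (simp add: field_simps)
qed

lemma summable_on_exp_qform:
  assumes y: "y > 0" and u: "u > 0"
  shows "(\<lambda>k. exp (- pi * u * qform x y k)) summable_on A"
proof -
  obtain c where c: "c > 0" "\<And>k. c * ((real_of_int (fst k))\<^sup>2 + (real_of_int (snd k))\<^sup>2) \<le> qform x y k"
    using qform_lower_bound[OF y] by blast
  let ?g = "\<lambda>m::int. exp (- (pi * u * c) * (real_of_int m)\<^sup>2)"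
  have "(\<lambda>k. ?g (fst k) * ?g (snd k)) summable_on (UNIV \<times> UNIV)"
    using u c by (intro summable_on_prod_mult summable_on_int_gauss) auto
  hence "(\<lambda>k. ?g (fst k) * ?g (snd k)) summable_on UNIV" by simp
  hence "(\<lambda>k. exp (- pi * u * qform x y k)) summable_on UNIV"
  proof (rule summable_on_comparison_test)
    fix k :: "int \<times> int"
    have "(pi * u) * (c * ((real_of_int (fst k))\<^sup>2 + (real_of_int (snd k))\<^sup>2)) \<le> (pi * u) * qform x y k"
      using u by (intro mult_left_mono c) auto
    thus "exp (- pi * u * qform x y k) \<le> ?g (fst k) * ?g (snd k)"
      by (simp add: algebra_simps flip: exp_add)
  qed auto
  thus ?thesis by (rule summable_on_subset) auto
qed

definition theta0 :: "real \<Rightarrow> real \<Rightarrow> real \<Rightarrow> real" where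
  "theta0 x y u = infsum (\<lambda>k. exp (- pi * u * qform x y k)) (UNIV - {0})"

abbreviation theta_hex :: "real \<Rightarrow> real" where
  "theta_hex \<equiv> theta0 (1 / 2) (sqrt 3 / 2)"

text \<open>Adding three reindexed copies of the series avoids a choice of orbit representatives;
  every orbit is counted three times, whence the factor 3.\<close>

lemma theta0_eq_orbit_sum:
  assumes y: "y > 0" and u: "u > 0"
  shows "((\<lambda>k. exp (- pi * u * qform x y k) + exp (- pi * u * qform x y (rot3 k)) + exp (- pi * u * qform x y (rot3 (rot3 k))))
     has_sum 3 * theta0 x y u) (UNIV - {0})"
proof -
  let ?f = "\<lambda>k. exp (- pi * u * qform x y k)"
  have 1: "(?f has_sum theta0 x y u) (UNIV - {0})"
    unfolding theta0_def by (rule has_sum_infsum[OF summable_on_exp_qform[OF y u]])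
  have 2: "((\<lambda>k. ?f (rot3 k)) has_sum theta0 x y u) (UNIV - {0})"
    using has_sum_reindex_bij_betw[OF bij_rot3, of ?f] 1 by simp
  have 3: "((\<lambda>k. ?f (rot3 (rot3 k))) has_sum theta0 x y u) (UNIV - {0})"
    using has_sum_reindex_bij_betw[OF bij_rot3, of "\<lambda>k. ?f (rot3 k)"] 2 by simp
  have "((\<lambda>k. ?f k + ?f (rot3 k) + ?f (rot3 (rot3 k))) has_sum (theta0 x y u + theta0 x y u + theta0 x y u)) (UNIV - {0})"
    by (intro has_sum_add 1 2 3)
  thus ?thesis by simp
qed

lemma theta_hex_le_near:
  assumes y: "y > 0" and u: "u \<ge> 1" and le: "x\<^sup>2 + y\<^sup>2 + 1 - x \<le> 121 / 100 * (sqrt 3 * y)"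
  shows "theta_hex u \<le> theta0 x y u" "(x, y) \<noteq> (1 / 2, sqrt 3 / 2) \<Longrightarrow> theta_hex u < theta0 x y u"
proof -
  have u0: "u > 0" using u by simp
  have 1: "((\<lambda>k. 3 * exp (- pi * u * hexform k)) has_sum 3 * theta_hex u) (UNIV - {0})"
    unfolding theta0_def by (intro has_sum_cmult_right has_sum_infsum summable_on_exp_qform) (use u0 in auto)
  note 2 = theta0_eq_orbit_sum[OF y u0, of x]
  have "3 * theta_hex u \<le> 3 * theta0 x y u"
    by (rule has_sum_mono[OF 1 2]) (use exp_rot3_orbit_ge(1)[OF y _ u le] in auto)
  thus "theta_hex u \<le> theta0 x y u" by simp
  assume ne: "(x, y) \<noteq> (1 / 2, sqrt 3 / 2)"
  have "3 * theta_hex u < 3 * theta0 x y u"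
    by (rule has_sum_strict_mono[OF 1 2, of "(0, 1)"])
      (use exp_rot3_orbit_ge[OF y _ u le] ne in \<open>auto simp: zero_prod_def\<close>)
  thus "theta_hex u < theta0 x y u" by simp
qed

section \<open>Lattices with a very short vector\<close>

lemma has_sum_int_power_abs:
  assumes "0 < q" "q < (1::real)"
  shows "((\<lambda>k::int. q ^ nat \<bar>k\<bar>) has_sum (1 + q) / (1 - q)) UNIV"
proof -
  have g: "((\<lambda>n::nat. q ^ n) has_sum (1 / (1 - q))) UNIV"
    using assms by (intro sums_nonneg_imp_has_sum geometric_sums) auto
  have 1: "((\<lambda>k::int. q ^ nat \<bar>k\<bar>) has_sum (1 / (1 - q))) (range int)"
    using g by (subst has_sum_reindex) (auto simp: o_def)
  have "nat \<bar>- int n - 1\<bar> = Suc n" for n by simp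
  hence 2: "((\<lambda>k::int. q ^ nat \<bar>k\<bar>) has_sum (q * (1 / (1 - q)))) (range (\<lambda>n. - int n - 1))"
    using has_sum_cmult_right[OF g, of q] by (subst has_sum_reindex) (auto simp: o_def inj_def)
  have "((\<lambda>k::int. q ^ nat \<bar>k\<bar>) has_sum (1 / (1 - q) + q * (1 / (1 - q)))) (range int \<union> range (\<lambda>n. - int n - 1))"
    by (rule has_sum_Un_disjoint[OF 1 2]) auto
  moreover have "range int \<union> range (\<lambda>n. - int n - 1) = UNIV"
  proof -
    have "k \<in> range int \<union> range (\<lambda>n. - int n - 1)" for k
      by (cases "k \<ge> 0") (auto intro: image_eqI[of _ _ "nat k"] image_eqI[of _ _ "nat (- k - 1)"])
    thus ?thesis by blast
  qed
  moreover have "1 / (1 - q) + q * (1 / (1 - q)) = (1 + q) / (1 - q)" by (simp add: add_divide_distrib)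
  ultimately show ?thesis by simp
qed

text \<open>The squares in the exponent are replaced by 2 |m|, which gives a geometric series. The
  bound is kept linear in r so that its square stays a manageable quadratic.\<close>

lemma infsum_int_gauss_le:
  fixes r :: real
  assumes r: "0 < r" "r \<le> 3017 / 10000"
  defines "g \<equiv> \<lambda>m::int. r ^ nat (m\<^sup>2)"
  shows "g summable_on UNIV" "infsum g UNIV \<le> 2 * r + 10183 / 10000"
proof -
  have r1: "r < 1" using r by simp
  \<comment> \<open>The second term corrects m = 1 and m = -1, the only integers with m^2 < 2
    |m|.\<close>
  let ?h = "\<lambda>m::int. (r\<^sup>2) ^ nat \<bar>m\<bar> + (if m \<in> {1, -1} then r - r\<^sup>2 else 0)"
  have "((\<lambda>m::int. if m \<in> {1, -1} then r - r\<^sup>2 else 0) has_sum (\<Sum>m\<in>{1, -1::int}. r - r\<^sup>2)) UNIV"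
    by (rule has_sum_finite_neutralI[of "{1, -1}"]) auto
  hence h: "(?h has_sum ((1 + r\<^sup>2) / (1 - r\<^sup>2) + (\<Sum>m\<in>{1, -1::int}. r - r\<^sup>2))) UNIV"
    using r r1 by (intro has_sum_add has_sum_int_power_abs) (auto simp: power_less_one_iff)
  have le: "g m \<le> ?h m" for m
  proof (cases "m \<in> {1, -1}")
    case False
    have "2 * \<bar>m\<bar> \<le> m\<^sup>2"
    proof (cases "m = 0")
      case nz: False
      hence "2 \<le> \<bar>m\<bar>" using False by auto
      hence "2 * \<bar>m\<bar> \<le> \<bar>m\<bar> * \<bar>m\<bar>" by (intro mult_right_mono) auto
      thus ?thesis by (simp add: power2_eq_square)
    qed auto
    hence "2 * nat \<bar>m\<bar> \<le> nat (m\<^sup>2)" by linarith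
    hence "r ^ nat (m\<^sup>2) \<le> r ^ (2 * nat \<bar>m\<bar>)" using r r1 by (intro power_decreasing) auto
    thus ?thesis using False by (simp add: g_def power_mult)
  qed (auto simp: g_def)
  have nn: "g m \<ge> 0" for m using r by (simp add: g_def)
  show s: "g summable_on UNIV"
    by (rule summable_on_comparison_test[OF has_sum_imp_summable[OF h]]) (use le nn in auto)
  have "infsum g UNIV \<le> (1 + r\<^sup>2) / (1 - r\<^sup>2) + (\<Sum>m\<in>{1, -1::int}. r - r\<^sup>2)"
    by (rule has_sum_mono[OF has_sum_infsum[OF s] h]) (use le in auto)
  also have "\<dots> \<le> 2 * r + 10183 / 10000"
  proof -
    have r2: "r\<^sup>2 \<le> 911 / 10000"
      using power_mono[OF r(2), of 2] r(1) by (simp add: power2_eq_square)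
    have "(r\<^sup>2) * (r\<^sup>2) \<le> 911 / 10000 * (911 / 10000)" by (intro mult_mono r2) auto
    moreover have "(10183 / 10000 + 2 * r\<^sup>2) * (1 - r\<^sup>2) = 10183 / 10000 + 9817 / 10000 * r\<^sup>2 - 2 * (r\<^sup>2 * r\<^sup>2)"
      by (simp add: field_simps)
    ultimately have "1 + r\<^sup>2 \<le> (10183 / 10000 + 2 * r\<^sup>2) * (1 - r\<^sup>2)" using r2 by linarith
    hence "(1 + r\<^sup>2) / (1 - r\<^sup>2) \<le> 10183 / 10000 + 2 * r\<^sup>2" using r2 by (simp add: pos_divide_le_eq)
    moreover have "(\<Sum>m\<in>{1, -1::int}. r - r\<^sup>2) = 2 * r - 2 * r\<^sup>2" by simp
    ultimately show ?thesis by linarith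
  qed
  finally show "infsum g UNIV \<le> 2 * r + 10183 / 10000" .
qed

text \<open>The six minimal vectors of the triangular lattice.\<close>

definition hexagon :: "(int \<times> int) set" where
  "hexagon = {(1, 0), (-1, 0), (0, 1), (0, -1), (1, -1), (-1, 1)}"

text \<open>The value 2 is not represented. Since m^2 + n^2 \<le> 2 \<open>hexnorm\<close>, only
  coordinates of absolute value at most 2 need checking.\<close>

lemma hexnorm_ge_3:
  assumes "k \<noteq> 0" "k \<notin> hexagon"
  shows "hexnorm k \<ge> 3"
proof (rule ccontr)
  assume "\<not> hexnorm k \<ge> 3"
  hence h: "hexnorm k \<le> 2" by simp
  obtain m n where k: "k = (m, n)" by (cases k)
  have "0 \<le> (m + n)\<^sup>2" by simp
  hence "m\<^sup>2 + n\<^sup>2 \<le> 2 * hexnorm k" by (simp add: k hexnorm_def power2_eq_square algebra_simps)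
  hence mn: "m\<^sup>2 + n\<^sup>2 \<le> 4" using h by linarith
  have small: "i \<in> {-2, -1, 0, 1, 2}" if "i\<^sup>2 \<le> 4" for i :: int
  proof -
    have "\<bar>i\<bar> \<le> 2" using that abs_le_square_iff[of i 2] by simp
    thus ?thesis by auto
  qed
  have "m\<^sup>2 \<le> 4" "n\<^sup>2 \<le> 4" using mn zero_le_power2[of m] zero_le_power2[of n] by linarith+
  hence "m \<in> {-2, -1, 0, 1, 2}" "n \<in> {-2, -1, 0, 1, 2}" using small by auto
  thus False
    by (elim insertE emptyE) (use assms h in \<open>simp_all add: k hexagon_def hexnorm_def zero_prod_def\<close>)
qed

lemma exp_minus_12_le: "exp (- (12 / 10)) \<le> (3017 / 10000 :: real)"
proof -
  have "(3315 / 1000 :: real) \<le> 1 + 12 / 10 + (12 / 10)\<^sup>2 / 2 + (12 / 10) ^ 3 / 6 + (12 / 10) ^ 4 / 24 + (12 / 10) ^ 5 / 120"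
    by (simp add: power_numeral_reduce)
  also have "\<dots> \<le> exp (12 / 10)" by (rule exp_ge_taylor5)
  finally have "1 / exp (12 / 10) \<le> 1 / (3315 / 1000 :: real)" by (intro divide_left_mono) auto
  thus ?thesis proof -
    have "exp (- (12 / 10)) = 1 / exp (12 / 10 :: real)" by (simp only: exp_minus inverse_eq_divide)
    also have "\<dots> \<le> 1 / (3315 / 1000)" by fact
    also have "\<dots> \<le> 3017 / 10000" by simp
    finally show ?thesis .
  qed
qed

text \<open>Off the hexagon \<open>hexnorm\<close> h is at least 3, so h - 1 \<ge> 2h/3 and 36/10 (h
  - 1) \<ge> 12/10 * 2h \<ge> 12/10 (m^2 + n^2). The sum is thereby dominated by a product of two
  one-dimensional ones with base r = exp(-12/10).\<close>

lemma sum_exp_hexnorm_le: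
  "((\<lambda>k. exp (- (36 / 10) * (real_of_int (hexnorm k) - 1))) summable_on (UNIV - {0}))"
  "infsum (\<lambda>k. exp (- (36 / 10) * (real_of_int (hexnorm k) - 1))) (UNIV - {0}) \<le> 71 / 10"
proof -
  define r :: real where "r = exp (- (12 / 10))"
  have r: "0 < r" "r \<le> 3017 / 10000" using exp_minus_12_le by (auto simp: r_def)
  have r1: "r \<le> 1" using r by simp
  define g where "g = (\<lambda>m::int. r ^ nat (m\<^sup>2))"
  note G = infsum_int_gauss_le[OF r, folded g_def]
  have gnn: "g m \<ge> 0" for m using r by (simp add: g_def)
  let ?G = "infsum g UNIV"
  let ?p = "\<lambda>k. g (fst k) * g (snd k)"
  let ?f = "\<lambda>k. exp (- (36 / 10) * (real_of_int (hexnorm k) - 1))"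
  \<comment> \<open>On the hexagon the true term is 1 while the product is at least r^2, so 1 - r^2
    makes up the difference.\<close>
  let ?h = "\<lambda>k. (if k \<in> hexagon then 1 - r\<^sup>2 else 0) + ?p k"
  have pU: "?p summable_on UNIV"
    using summable_on_prod_mult[of g UNIV g UNIV] G gnn by simp
  hence p0: "?p summable_on (UNIV - {0})" by (rule summable_on_subset) auto
  have "infsum ?p UNIV = ?G * ?G"
    using infsum_prod_mult[of g UNIV g UNIV] G gnn by simp
  moreover have "infsum ?p (insert 0 (UNIV - {0})) = ?p 0 + infsum ?p (UNIV - {0})"
    by (rule infsum_insert[OF p0]) auto
  ultimately have "infsum ?p (UNIV - {0}) = ?G * ?G - 1"
    by (simp add: insert_absorb g_def)
  hence ps: "(?p has_sum (?G * ?G - 1)) (UNIV - {0})" using has_sum_infsum[OF p0] by simp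
  have "((\<lambda>k. if k \<in> hexagon then 1 - r\<^sup>2 else 0) has_sum (\<Sum>k\<in>hexagon. 1 - r\<^sup>2)) (UNIV - {0})"
    by (rule has_sum_finite_neutralI[of hexagon]) (auto simp: hexagon_def zero_prod_def)
  also have "(\<Sum>k\<in>hexagon. 1 - r\<^sup>2) = 6 * (1 - r\<^sup>2)" by (simp add: hexagon_def)
  finally have hs: "(?h has_sum (6 * (1 - r\<^sup>2) + (?G * ?G - 1))) (UNIV - {0})"
    by (intro has_sum_add ps)
  have le: "?f k \<le> ?h k" if k: "k \<noteq> 0" for k
  proof -
    have pk: "?p k = r ^ nat ((fst k)\<^sup>2 + (snd k)\<^sup>2)"
      by (simp add: g_def nat_add_distrib power_add)
    show ?thesis
    proof (cases "k \<in> hexagon")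
      case True
      hence "hexnorm k = 1" by (auto simp: hexagon_def hexnorm_def)
      moreover have "r ^ 2 \<le> ?p k" unfolding pk
        by (rule power_decreasing) (use True r r1 in \<open>auto simp: hexagon_def\<close>)
      ultimately show ?thesis using True by simp
    next
      case False
      have h3: "hexnorm k \<ge> 3" by (rule hexnorm_ge_3[OF k False])
      have le2: "(fst k)\<^sup>2 + (snd k)\<^sup>2 \<le> 2 * hexnorm k"
      proof -
        have "0 \<le> (fst k + snd k)\<^sup>2" by simp
        thus ?thesis by (simp add: hexnorm_def power2_eq_square algebra_simps)
      qed
      have "?f k \<le> exp (- (12 / 10) * (2 * real_of_int (hexnorm k)))"
        using h3 by simp
      also have "\<dots> = r ^ nat (2 * hexnorm k)"
        using h3 by (simp add: r_def mult.commute flip: exp_of_nat_mult)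
      also have "\<dots> \<le> ?p k" unfolding pk
        by (rule power_decreasing) (use le2 r r1 in auto)
      finally show ?thesis using False by simp
    qed
  qed
  show s: "?f summable_on (UNIV - {0})"
    by (rule summable_on_comparison_test[OF has_sum_imp_summable[OF hs]]) (use le in auto)
  have "infsum ?f (UNIV - {0}) \<le> 6 * (1 - r\<^sup>2) + (?G * ?G - 1)"
    by (rule has_sum_mono[OF has_sum_infsum[OF s] hs]) (use le in auto)
  also have "\<dots> \<le> 6 * (1 - r\<^sup>2) + ((2 * r + 10183 / 10000) * (2 * r + 10183 / 10000) - 1)"
    using G gnn by (intro add_left_mono diff_right_mono mult_mono infsum_nonneg) (auto intro: order_trans[OF infsum_nonneg])
  also have "\<dots> \<le> 71 / 10"
  proof -
    \<comment> \<open>A quadratic that increases up to 3017/10000 is bounded by its value there; the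
      factor 34/10 leaves only the small remainder 698/10000 r.\<close>
    have "0 \<le> (3017 / 10000 - r) * (34 / 10 - 2 * r)" using r by (intro mult_nonneg_nonneg) auto
    also have "\<dots> = 3017 / 10000 * (34 / 10) - 40034 / 10000 * r + 2 * r\<^sup>2"
      by (simp add: power2_eq_square field_simps)
    finally have "40034 / 10000 * r - 2 * r\<^sup>2 \<le> 3017 / 10000 * (34 / 10)" by linarith
    moreover have "6 * (1 - r\<^sup>2) + ((2 * r + 10183 / 10000) * (2 * r + 10183 / 10000) - 1) =
        5 + 10183 / 10000 * (10183 / 10000) + 698 / 10000 * r + (40034 / 10000 * r - 2 * r\<^sup>2)"
      by (simp add: power2_eq_square field_simps)
    ultimately show ?thesis using r by simp
  qed
  finally show "infsum ?f (UNIV - {0}) \<le> 71 / 10" .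
qed

text \<open>At unit density 1/y is the squared length of the vector with index (0, 1). That vector
  and its negative contribute 2 exp(-pi u/y), while the whole triangular sum is at most 71/10
  exp(-\<kappa> u).\<close>

lemma theta_hex_less_far:
  assumes y: "y \<ge> 135 / 100" and u: "u \<ge> 1"
  shows "theta_hex u < theta0 x y u"
proof -
  define \<kappa> where "\<kappa> = pi * (2 / sqrt 3)"
  have pi: "314 / 100 \<le> pi" using pi_approx(1) by simp
  have s3: "sqrt 3 \<le> (17321 / 10000 :: real)" by (rule real_le_lsqrt) (auto simp: power2_eq_square)
  have s3': "1 / sqrt 3 \<ge> (5773 / 10000 :: real)"
    using s3 by (simp add: pos_le_divide_eq)
  have \<kappa>: "36 / 10 \<le> \<kappa>"
  proof -
    have "314 / 100 * (2 * (5773 / 10000)) \<le> pi * (2 * (1 / sqrt 3))" by (intro mult_mono pi s3' mult_left_mono) auto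
    thus ?thesis by (simp add: \<kappa>_def)
  qed
  have \<kappa>2: "129 / 100 \<le> \<kappa> - pi / (135 / 100)"
  proof -
    have "314 / 100 * (2 * (5773 / 10000) - 1 / (135 / 100)) \<le> pi * (2 * (1 / sqrt 3) - 1 / (135 / 100))"
      using s3' by (intro mult_mono pi) auto
    thus ?thesis by (simp add: \<kappa>_def right_diff_distrib)
  qed
  have u0: "u > 0" and y0: "y > 0" using u y by auto
  let ?f = "\<lambda>k. exp (- (36 / 10) * (real_of_int (hexnorm k) - 1))"
  have "theta_hex u \<le> infsum (\<lambda>k. exp (- \<kappa> * u) * ?f k) (UNIV - {0})"
    unfolding theta0_def
  proof (rule infsum_mono)
    show "(\<lambda>k. exp (- pi * u * hexform k)) summable_on (UNIV - {0})"
      by (rule summable_on_exp_qform) (use u0 in auto)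
    show "(\<lambda>k. exp (- \<kappa> * u) * ?f k) summable_on (UNIV - {0})"
      by (rule summable_on_cmult_right[OF sum_exp_hexnorm_le(1)])
    fix k :: "int \<times> int" assume "k \<in> UNIV - {0}"
    hence h: "real_of_int (hexnorm k) - 1 \<ge> 0" using hexnorm_pos[of k] by simp
    have "36 / 10 * 1 \<le> \<kappa> * u" using \<kappa> u by (intro mult_mono) auto
    hence "36 / 10 * (real_of_int (hexnorm k) - 1) \<le> \<kappa> * u * (real_of_int (hexnorm k) - 1)"
      using h by (intro mult_right_mono) auto
    moreover have "pi * u * hexform k = \<kappa> * u * real_of_int (hexnorm k)" by (simp add: \<kappa>_def hexform_eq)
    hence "pi * u * hexform k = \<kappa> * u * (real_of_int (hexnorm k) - 1) + \<kappa> * u" by (simp add: right_diff_distrib)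
    ultimately show "exp (- pi * u * hexform k) \<le> exp (- \<kappa> * u) * ?f k"
      by (simp flip: exp_add)
  qed
  also have "\<dots> = exp (- \<kappa> * u) * infsum ?f (UNIV - {0})" by (rule infsum_cmult_right')
  also have "\<dots> \<le> exp (- \<kappa> * u) * (71 / 10)"
    by (intro mult_left_mono sum_exp_hexnorm_le) auto
  also have "\<dots> < exp (- \<kappa> * u) * (2 * exp (\<kappa> * u - pi / (135 / 100) * u))"
  proof -
    \<comment> \<open>With \<open>\<kappa>2\<close> the ratio of the two bounds is at least 2
      exp(129/100) \<ge> 72/10, just above 71/10; this is what y \<ge> 135/100 buys.\<close>
    have "(36 / 10 :: real) \<le> 1 + 129 / 100 + (129 / 100)\<^sup>2 / 2 + (129 / 100) ^ 3 / 6 + (129 / 100) ^ 4 / 24 + (129 / 100) ^ 5 / 120"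
      by (simp add: power_numeral_reduce)
    also have "\<dots> \<le> exp (129 / 100)" by (rule exp_ge_taylor5)
    also have "129 / 100 * 1 \<le> (\<kappa> - pi / (135 / 100)) * u" by (rule mult_mono[OF \<kappa>2 u]) (use \<kappa>2 in auto)
    hence "exp (129 / 100) \<le> exp (\<kappa> * u - pi / (135 / 100) * u)" by (simp add: algebra_simps)
    finally show ?thesis by simp
  qed
  also have "\<dots> = 2 * exp (- pi * u * (1 / (135 / 100)))"
    by (simp add: algebra_simps flip: exp_add)
  also have "\<dots> \<le> 2 * exp (- pi * u * (1 / y))"
  proof -
    have "1 / y \<le> 1 / (135 / 100)" using y by (intro divide_left_mono) auto
    hence "pi * u * (1 / y) \<le> pi * u * (1 / (135 / 100))" using u0 by (intro mult_left_mono) auto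
    thus ?thesis by simp
  qed
  also have "\<dots> = (\<Sum>k\<in>{(0, 1), (0, -1)}. exp (- pi * u * qform x y k))"
    by (simp add: qform_def)
  also have "\<dots> \<le> theta0 x y u"
    unfolding theta0_def
    by (rule finite_sum_le_infsum[OF summable_on_exp_qform[OF y0 u0]]) (auto simp: zero_prod_def)
  finally show ?thesis .
qed

text \<open>The two regimes overlap: for y < 135/100 in this domain c stays below 121/100, the
  extreme corner x = 0, y = 135/100 giving about 1.207.\<close>

lemma theta_hex_minimal:
  assumes y: "y > 0" and x: "0 \<le> x" "x \<le> 1 / 2" and xy: "1 \<le> x\<^sup>2 + y\<^sup>2" and u: "u \<ge> 1"
  shows "theta_hex u \<le> theta0 x y u" "(x, y) \<noteq> (1 / 2, sqrt 3 / 2) \<Longrightarrow> theta_hex u < theta0 x y u"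
proof -
  have *: "x\<^sup>2 + y\<^sup>2 + 1 - x \<le> 121 / 100 * (sqrt 3 * y)" if far: "y < 135 / 100"
  proof -
    have "x * x \<le> 1 * x" using x by (intro mult_right_mono) auto
    hence x2: "x\<^sup>2 \<le> x" by (simp add: power2_eq_square)
    have "x * x \<le> 1 / 2 * (1 / 2)" using x by (intro mult_mono) auto
    hence "y\<^sup>2 \<ge> (86 / 100)\<^sup>2" using xy by (simp add: power2_eq_square)
    hence ylo: "y \<ge> 86 / 100" using y by (rule_tac power2_le_imp_le) auto
    \<comment> \<open>Bounds y^2 by its chord over [86/100, 135/100], making the claim linear in
      y.\<close>
    have "0 \<le> (y - 86 / 100) * (135 / 100 - y)" using ylo far by (intro mult_nonneg_nonneg) auto
    hence y2: "y\<^sup>2 \<le> 221 / 100 * y - 1161 / 1000" by (simp add: power2_eq_square field_simps)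
    have "(1732 / 1000 :: real) \<le> sqrt 3" by (rule real_le_rsqrt) (auto simp: power2_eq_square)
    hence "121 / 100 * (1732 / 1000 * y) \<le> 121 / 100 * (sqrt 3 * y)" using y by (intro mult_left_mono mult_right_mono) auto
    thus ?thesis using x2 y2 far by linarith
  qed
  show "theta_hex u \<le> theta0 x y u" 
    using theta_hex_le_near(1)[OF y u *] theta_hex_less_far[of y u x] u by fastforce
  show "theta_hex u < theta0 x y u" if "(x, y) \<noteq> (1 / 2, sqrt 3 / 2)"
    using theta_hex_le_near(2)[OF y u * that] theta_hex_less_far[of y u x] u by fastforce
qed

section \<open>The functional equation of the theta function\<close>

lemma theta0_inversion:
  assumes y: "y > 0" and u: "u > 0"
  shows "1 + theta0 x y (1 / u) = u * (1 + theta0 x y u)"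
proof -
  have full: "infsum (\<lambda>k. exp (- pi * v * qform x y k)) UNIV = 1 + theta0 x y v" if "v > 0" for v
  proof -
    have "infsum (\<lambda>k. exp (- pi * v * qform x y k)) (insert 0 (UNIV - {0})) = exp (- pi * v * qform x y 0) + theta0 x y v"
      unfolding theta0_def by (rule infsum_insert[OF summable_on_exp_qform[OF y that]]) auto
    thus ?thesis by (simp add: insert_absorb qform_def)
  qed
  \<comment> \<open>Poisson summation in the second variable makes the theta series symmetric in both variables.\<close>
  let ?w = "\<lambda>v m k. exp (- pi * (v * y) * (real_of_int m)\<^sup>2) * exp (- pi * (y / v) * (real_of_int k)\<^sup>2) * cos (2 * pi * real_of_int k * (real_of_int m * x))"
  have S: "(\<lambda>(m, k). ?w v m k) summable_on (UNIV \<times> UNIV)" if v: "v > 0" for v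
  proof -
    let ?g = "\<lambda>c m. exp (- (pi * c) * (real_of_int m)\<^sup>2)"
    have "(\<lambda>k. ?g (v * y) (fst k) * ?g (y / v) (snd k)) summable_on (UNIV \<times> UNIV)"
      using v y by (intro summable_on_prod_mult summable_on_int_gauss) auto
    hence "(\<lambda>p. norm ((\<lambda>(m, k). ?w v m k) p)) summable_on (UNIV \<times> UNIV)"
      by (rule summable_on_comparison_test) (auto simp: abs_mult mult_left_le split: prod.splits)
    thus ?thesis by (rule abs_summable_summable)
  qed
  have row: "1 + theta0 x y v = sqrt (y / v) * infsum (\<lambda>m. infsum (\<lambda>k. ?w v m k) UNIV) UNIV" if v: "v > 0" for v
  proof -
    have "1 + theta0 x y v = infsum (\<lambda>(m, n). exp (- pi * v * qform x y (m, n))) (UNIV \<times> UNIV)"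
      unfolding full[OF v, symmetric] by (simp add: case_prod_unfold)
    also have "\<dots> = infsum (\<lambda>m. infsum (\<lambda>n. exp (- pi * v * qform x y (m, n))) UNIV) UNIV"
      using summable_on_exp_qform[OF y v, of x "UNIV \<times> UNIV"] by (intro infsum_Sigma'_banach[symmetric]) (simp add: case_prod_unfold)
    also have "\<dots> = infsum (\<lambda>m. sqrt (y / v) * infsum (\<lambda>k. ?w v m k) UNIV) UNIV"
    proof (rule infsum_cong)
      fix m :: int
      let ?M = "real_of_int m"
      have "exp (- pi * v * qform x y (m, n)) = exp (- pi * (v * y) * ?M\<^sup>2) * exp (- pi * (v / y) * (?M * x + real_of_int n)\<^sup>2)" for n
        using y by (simp add: qform_def power_mult_distrib add_divide_distrib power2_eq_square algebra_simps flip: exp_add)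
      hence "infsum (\<lambda>n. exp (- pi * v * qform x y (m, n))) UNIV =
         exp (- pi * (v * y) * ?M\<^sup>2) * infsum (\<lambda>n. exp (- pi * (v / y) * (?M * x + real_of_int n)\<^sup>2)) UNIV"
        by (simp add: infsum_cmult_right')
      also have "infsum (\<lambda>n::int. exp (- pi * (v / y) * (?M * x + real_of_int n)\<^sup>2)) UNIV =
         infsum (\<lambda>k::int. exp (- pi * (real_of_int k)\<^sup>2 / (v / y)) * cos (2 * pi * real_of_int k * (?M * x))) UNIV / sqrt (v / y)"
        by (rule poisson_summation_gauss) (use v y in auto)
      also have "exp (- pi * (v * y) * ?M\<^sup>2) * \<dots> = sqrt (y / v) * (exp (- pi * (v * y) * ?M\<^sup>2) *
         infsum (\<lambda>k::int. exp (- pi * (y / v) * (real_of_int k)\<^sup>2) * cos (2 * pi * real_of_int k * (?M * x))) UNIV)"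
        using v y by (simp add: real_sqrt_divide mult_ac)
      also have "exp (- pi * (v * y) * ?M\<^sup>2) *
         infsum (\<lambda>k::int. exp (- pi * (y / v) * (real_of_int k)\<^sup>2) * cos (2 * pi * real_of_int k * (?M * x))) UNIV = infsum (\<lambda>k. ?w v m k) UNIV"
        by (subst infsum_cmult_right'[symmetric]) (simp add: mult.assoc)
      finally show "infsum (\<lambda>n. exp (- pi * v * qform x y (m, n))) UNIV = sqrt (y / v) * infsum (\<lambda>k. ?w v m k) UNIV" .
    qed
    also have "\<dots> = sqrt (y / v) * infsum (\<lambda>m. infsum (\<lambda>k. ?w v m k) UNIV) UNIV" by (rule infsum_cmult_right')
    finally show ?thesis .
  qed
  have u': "1 / u > 0" using u by simp
  \<comment> \<open>Passing from u to 1/u exchanges m and k in \<open>?w\<close>, so exchanging the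
    two summations is the whole functional equation.\<close>
  have "infsum (\<lambda>m. infsum (\<lambda>k. ?w (1 / u) m k) UNIV) UNIV = infsum (\<lambda>k. infsum (\<lambda>m. ?w (1 / u) m k) UNIV) UNIV"
    by (rule infsum_swap_banach[OF S[OF u']])
  also have "\<dots> = infsum (\<lambda>m. infsum (\<lambda>k. ?w u m k) UNIV) UNIV"
    by (simp add: mult_ac)
  finally have sw: "infsum (\<lambda>m. infsum (\<lambda>k. ?w (1 / u) m k) UNIV) UNIV = infsum (\<lambda>m. infsum (\<lambda>k. ?w u m k) UNIV) UNIV" .
  have "sqrt (y / (1 / u)) = u * sqrt (y / u)"
  proof -
    have "y / (1 / u) = u\<^sup>2 * (y / u)" using u by (simp add: power2_eq_square)
    thus ?thesis using u by (simp only: real_sqrt_mult real_sqrt_abs)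
  qed
  thus ?thesis unfolding row[OF u] row[OF u'] sw by simp
qed

section \<open>Mellin transforms\<close>

text \<open>The substitution exp w puts the Gamma integral on the whole line. Scaling by c becomes
  translation by ln c, and inverting the variable will become the reflection w -> -w.\<close>

lemma nn_integral_exp_exp:
  assumes \<sigma>: "\<sigma> > 0" and c: "c > 0"
  shows "(\<integral>\<^sup>+w. ennreal (exp (- c * exp w) * exp (\<sigma> * w)) \<partial>lborel) = ennreal (Gamma \<sigma> * c powr (- \<sigma>))"
proof -
  let ?g = "\<lambda>t::real. t powr (\<sigma> - 1) / exp t"
  have "(?g has_integral Gamma \<sigma>) {0..}" by (rule Gamma_integral_real[OF \<sigma>])
  hence I: "(?g has_integral Gamma \<sigma>) {0<..}"
  proof (rule has_integral_spike_set_eq[THEN iffD1, rotated 2])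
    show "negligible {x \<in> {0..} - {0<..}. ?g x \<noteq> 0}" by (rule negligible_subset[of "{0}"]) auto
    show "negligible {x \<in> {0<..} - {0..}. ?g x \<noteq> 0}" by (rule negligible_subset[of "{}"]) auto
  qed
  have ac: "?g absolutely_integrable_on {0<..}"
    by (rule nonnegative_absolutely_integrable_1) (use I in auto)
  have "?g absolutely_integrable_on (range exp) \<and> integral (range exp) ?g = Gamma \<sigma>"
  proof -
    have "z \<in> range exp" if "z > 0" for z :: real
      using that by (intro image_eqI[of _ _ "ln z"]) auto
    hence "range exp = {0 :: real <..}" by auto
    thus ?thesis using integral_unique[OF I] ac by simp
  qed
  note range_exp = this
  let ?h = "\<lambda>w. \<bar>exp w\<bar> * ?g (exp w)"
  have "(?h absolutely_integrable_on UNIV \<and> integral UNIV ?h = Gamma \<sigma>) \<longleftrightarrow>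
      (?g absolutely_integrable_on (range exp) \<and> integral (range exp) ?g = Gamma \<sigma>)"
    by (rule has_absolute_integral_change_of_variables_1') (auto intro: DERIV_exp simp: inj_def)
  hence h: "?h absolutely_integrable_on UNIV" "integral UNIV ?h = Gamma \<sigma>" using range_exp by blast+
  have "?h integrable_on UNIV" by (rule set_lebesgue_integral_eq_integral(1)[OF h(1)])
  hence "(?h has_integral Gamma \<sigma>) UNIV" using h(2) by (simp only: has_integral_iff)
  moreover have "?h = (\<lambda>w. exp (- exp w) * exp (\<sigma> * w))"
    by (rule ext) (simp add: powr_def exp_minus divide_inverse algebra_simps flip: exp_add)
  ultimately have "((\<lambda>w. exp (- exp w) * exp (\<sigma> * w)) has_integral Gamma \<sigma>) UNIV" by simp
  hence 1: "(\<integral>\<^sup>+w. ennreal (exp (- exp w) * exp (\<sigma> * w)) \<partial>lborel) = ennreal (Gamma \<sigma>)"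
    by (intro nn_integral_has_integral_lborel) auto
  have "(\<integral>\<^sup>+w. ennreal (exp (- c * exp w) * exp (\<sigma> * w)) \<partial>lborel) =
      (\<integral>\<^sup>+w. ennreal (exp (- c * exp (- ln c + 1 * w)) * exp (\<sigma> * (- ln c + 1 * w))) \<partial>lborel)"
    by (subst nn_integral_real_affine[where c = 1 and t = "- ln c"]) auto
  also have "\<dots> = (\<integral>\<^sup>+w. ennreal (c powr (- \<sigma>)) * ennreal (exp (- exp w) * exp (\<sigma> * w)) \<partial>lborel)"
  proof (rule nn_integral_cong)
    fix w :: real
    have "c * exp (- ln c + 1 * w) = exp w" using c by (simp add: exp_diff)
    moreover have "exp (\<sigma> * (- ln c + 1 * w)) = c powr (- \<sigma>) * exp (\<sigma> * w)"
      using c by (simp add: powr_def algebra_simps flip: exp_add)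
    ultimately show "ennreal (exp (- c * exp (- ln c + 1 * w)) * exp (\<sigma> * (- ln c + 1 * w))) =
       ennreal (c powr (- \<sigma>)) * ennreal (exp (- exp w) * exp (\<sigma> * w))"
      by (simp add: ennreal_mult'[symmetric] mult_ac)
  qed
  also have "\<dots> = ennreal (c powr (- \<sigma>)) * ennreal (Gamma \<sigma>)"
    by (subst nn_integral_cmult) (auto simp: 1)
  also have "\<dots> = ennreal (Gamma \<sigma> * c powr (- \<sigma>))"
    using \<sigma> by (simp add: ennreal_mult'[symmetric] mult.commute)
  finally show ?thesis .
qed

text \<open>The Gamma factor that completes the Epstein zeta function.\<close>

definition gfactor :: "real \<Rightarrow> real" where
  "gfactor t = pi powr (- t / 2) * Gamma (t / 2)"

lemma gfactor_pos: "t > 0 \<Longrightarrow> gfactor t > 0"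
  by (simp add: gfactor_def Gamma_real_pos)

lemma H_fun_eq: "H_fun t = t * gfactor t / 2"
  by (simp add: H_fun_def gfactor_def)

text \<open>The planar Epstein zeta function in the coordinates (x, y). The exponent is halved
  because \<open>qform\<close> is a squared length.\<close>

definition zsum :: "real \<Rightarrow> real \<Rightarrow> real \<Rightarrow> real" where
  "zsum x y t = infsum (\<lambda>k. qform x y k powr (- t / 2)) (UNIV - {0})"

abbreviation zsum_hex :: "real \<Rightarrow> real" where
  "zsum_hex \<equiv> zsum (1 / 2) (sqrt 3 / 2)"

definition pair_of :: "int^2 \<Rightarrow> int \<times> int" where
  "pair_of k = (k $ 1, k $ 2)"

lemma bij_pair_of: "bij_betw pair_of (UNIV - {0}) (UNIV - {0})"
  by (rule bij_betw_byWitness[where f' = "\<lambda>p. vector [fst p, snd p]"])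
    (auto simp: pair_of_def vec_eq_iff forall_2 vector_2 zero_prod_def)

lemma summable_on_qform_powr:
  assumes y: "y > 0" and t: "t > 2"
  shows "(\<lambda>k. qform x y k powr (- t / 2)) summable_on (UNIV - {0})"
proof -
  obtain c where c: "c > 0" "\<And>k. c * ((real_of_int (fst k))\<^sup>2 + (real_of_int (snd k))\<^sup>2) \<le> qform x y k"
    using qform_lower_bound[OF y] by blast
  have "(\<lambda>k :: int^2. norm (mat 1 *v rvec k) powr (- t)) summable_on (UNIV - {0})"
    by (rule summable_on_lattice_gen) (use t in \<open>auto simp: invertible_det_nz\<close>)
  hence "(\<lambda>k :: int^2. c powr (- t / 2) * norm (rvec k) powr (- t)) summable_on (UNIV - {0})"
    by (intro summable_on_cmult_right) simp
  hence "(\<lambda>k :: int^2. qform x y (pair_of k) powr (- t / 2)) summable_on (UNIV - {0})"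
  proof (rule summable_on_comparison_test)
    fix k :: "int^2" assume k: "k \<in> UNIV - {0}"
    have n: "(norm (rvec k))\<^sup>2 = (real_of_int (k $ 1))\<^sup>2 + (real_of_int (k $ 2))\<^sup>2"
      by (simp add: norm_vec_def L2_set_def sum_2 rvec_def)
    have n0: "norm (rvec k) > 0" using k by simp
    have "qform x y (pair_of k) powr (- t / 2) \<le> (c * (norm (rvec k))\<^sup>2) powr (- t / 2)"
      using c(1) c(2)[of "pair_of k"] n0 t by (intro powr_mono2') (auto simp: n[symmetric] pair_of_def)
    also have "\<dots> = c powr (- t / 2) * norm (rvec k) powr (- t)"
      using c n0 by (simp add: powr_mult powr_powr flip: powr_numeral)
    finally show "qform x y (pair_of k) powr (- t / 2) \<le> c powr (- t / 2) * norm (rvec k) powr (- t)" .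
  qed auto
  thus ?thesis by (rule summable_on_reindex_bij_betw[OF bij_pair_of, THEN iffD1])
qed

lemma theta0_nonneg: "theta0 x y u \<ge> 0"
  unfolding theta0_def by (rule infsum_nonneg) auto

text \<open>Every term decreases in w, and monotone functions are Borel measurable.\<close>

lemma borel_measurable_theta0_exp [measurable]:
  assumes y: "y > 0"
  shows "(\<lambda>w. theta0 x y (exp w)) \<in> borel_measurable borel"
proof -
  have "mono (\<lambda>w. - theta0 x y (exp w))"
  proof (rule monoI)
    fix v w :: real assume vw: "v \<le> w"
    have "theta0 x y (exp w) \<le> theta0 x y (exp v)" unfolding theta0_def
    proof (rule infsum_mono)
      fix k :: "int \<times> int" assume "k \<in> UNIV - {0}"
      hence "qform x y k > 0" using qform_pos[OF y] by auto
      hence "pi * exp v * qform x y k \<le> pi * exp w * qform x y k" using vw by simp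
      thus "exp (- pi * exp w * qform x y k) \<le> exp (- pi * exp v * qform x y k)" by simp
    qed (rule summable_on_exp_qform[OF y], simp)+
    thus "- theta0 x y (exp v) \<le> - theta0 x y (exp w)" by simp
  qed
  hence "(\<lambda>w. - theta0 x y (exp w)) \<in> borel_measurable borel" by (rule borel_measurable_mono)
  thus ?thesis by simp
qed

text \<open>All terms are nonnegative, so Tonelli's theorem yields the value and the integrability
  together; t > 2 makes the zeta sum finite.\<close>

lemma theta0_mellin:
  assumes y: "y > 0" and t: "t > 2"
  shows "has_bochner_integral lborel (\<lambda>w. theta0 x y (exp w) * exp (t / 2 * w)) (gfactor t * zsum x y t)"
proof -
  have t2: "t / 2 > 0" and t0: "t > 0" using t by simp_all
  note S = summable_on_qform_powr[OF y t, of x]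
  have "(\<integral>\<^sup>+w. ennreal (theta0 x y (exp w) * exp (t / 2 * w)) \<partial>lborel) =
     (\<integral>\<^sup>+w. \<integral>\<^sup>+k. ennreal (exp (- (pi * qform x y k) * exp w) * exp (t / 2 * w)) \<partial>count_space (UNIV - {0}) \<partial>lborel)"
  proof (rule nn_integral_cong)
    fix w :: real
    have "theta0 x y (exp w) * exp (t / 2 * w) = infsum (\<lambda>k. exp (- (pi * qform x y k) * exp w) * exp (t / 2 * w)) (UNIV - {0})"
      unfolding theta0_def by (subst infsum_cmult_left'[symmetric]) (simp add: mult_ac)
    moreover have "(\<lambda>k. exp (- (pi * qform x y k) * exp w) * exp (t / 2 * w)) summable_on (UNIV - {0})"
      using summable_on_exp_qform[OF y, of "exp w" x "UNIV - {0}"]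
      by (intro summable_on_cmult_left) (simp add: mult_ac)
    ultimately show "ennreal (theta0 x y (exp w) * exp (t / 2 * w)) =
      (\<integral>\<^sup>+k. ennreal (exp (- (pi * qform x y k) * exp w) * exp (t / 2 * w)) \<partial>count_space (UNIV - {0}))"
      by (subst nn_integral_count_space_infsum) auto
  qed
  also have "\<dots> = (\<integral>\<^sup>+k. \<integral>\<^sup>+w. ennreal (exp (- (pi * qform x y k) * exp w) * exp (t / 2 * w)) \<partial>lborel \<partial>count_space (UNIV - {0}))"
    by (rule nn_integral_count_space_nn_integral) auto
  also have "\<dots> = (\<integral>\<^sup>+k. ennreal (gfactor t * qform x y k powr (- t / 2)) \<partial>count_space (UNIV - {0}))"
  proof (rule nn_integral_cong)
    fix k :: "int \<times> int" assume "k \<in> space (count_space (UNIV - {0}))"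
    hence q: "qform x y k > 0" using qform_pos[OF y] by auto
    have "(\<integral>\<^sup>+w. ennreal (exp (- (pi * qform x y k) * exp w) * exp (t / 2 * w)) \<partial>lborel) =
      ennreal (Gamma (t / 2) * (pi * qform x y k) powr (- (t / 2)))"
      by (rule nn_integral_exp_exp[OF t2]) (use q in auto)
    also have "Gamma (t / 2) * (pi * qform x y k) powr (- (t / 2)) = gfactor t * qform x y k powr (- t / 2)"
      using q by (simp add: gfactor_def powr_mult)
    finally show "(\<integral>\<^sup>+w. ennreal (exp (- (pi * qform x y k) * exp w) * exp (t / 2 * w)) \<partial>lborel) =
      ennreal (gfactor t * qform x y k powr (- t / 2))" .
  qed
  also have "\<dots> = ennreal (gfactor t * zsum x y t)"
    unfolding zsum_def
    by (subst nn_integral_count_space_infsum)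
      (use S gfactor_pos[OF t0] in \<open>auto intro!: summable_on_cmult_right simp: infsum_cmult_right'\<close>)
  finally have nn: "(\<integral>\<^sup>+w. ennreal (theta0 x y (exp w) * exp (t / 2 * w)) \<partial>lborel) = ennreal (gfactor t * zsum x y t)" .
  have z: "zsum x y t \<ge> 0" unfolding zsum_def by (rule infsum_nonneg) auto
  show ?thesis
    by (rule has_bochner_integral_nn_integral[OF _ _ _ nn])
      (use z gfactor_pos[OF t0] y theta0_nonneg in auto)
qed

section \<open>Comparison of zeta values with the triangular lattice\<close>

context
  fixes x y :: real
  assumes y: "y > 0" and x: "0 \<le> x" "x \<le> 1 / 2" and xy: "1 \<le> x\<^sup>2 + y\<^sup>2"
begin

private definition \<Psi> :: "real \<Rightarrow> real" where
  "\<Psi> w = (theta0 x y (exp w) - theta_hex (exp w)) * exp (w / 2)"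

private lemma Psi_even: "\<Psi> (- w) = \<Psi> w"
proof -
  have 1: "1 + theta0 x y (exp (- w)) = exp w * (1 + theta0 x y (exp w))"
    using theta0_inversion[OF y, of "exp w" x] by (simp add: exp_minus inverse_eq_divide)
  have 2: "1 + theta_hex (exp (- w)) = exp w * (1 + theta_hex (exp w))"
    using theta0_inversion[of "sqrt 3 / 2" "exp w" "1 / 2"] by (simp add: exp_minus inverse_eq_divide)
  have "theta0 x y (exp (- w)) - theta_hex (exp (- w)) = exp w * (theta0 x y (exp w) - theta_hex (exp w))"
    using 1 2 by (simp add: right_diff_distrib distrib_left)
  hence "\<Psi> (- w) = (theta0 x y (exp w) - theta_hex (exp w)) * (exp w * exp (- w / 2))"
    by (simp add: \<Psi>_def)
  also have "exp w * exp (- w / 2) = exp (w / 2)" by (simp flip: exp_add)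
  finally show ?thesis by (simp add: \<Psi>_def)
qed

private lemma Psi_nonneg: "\<Psi> w \<ge> 0"
proof -
  have *: "\<Psi> v \<ge> 0" if "v \<ge> 0" for v
    using theta_hex_minimal(1)[OF y x xy, of "exp v"] that by (simp add: \<Psi>_def)
  show ?thesis using *[of w] *[of "- w"] Psi_even[of w] by (cases "w \<ge> 0") auto
qed

private lemma Psi_pos: "(x, y) \<noteq> (1 / 2, sqrt 3 / 2) \<Longrightarrow> \<Psi> w > 0"
proof -
  assume ne: "(x, y) \<noteq> (1 / 2, sqrt 3 / 2)"
  have *: "\<Psi> v > 0" if "v \<ge> 0" for v
    using theta_hex_minimal(2)[OF y x xy _ ne, of "exp v"] that by (simp add: \<Psi>_def)
  show ?thesis using *[of w] *[of "- w"] Psi_even[of w] by (cases "w \<ge> 0") auto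
qed

text \<open>For t > 2 both Mellin integrals converge separately, so no polar terms need to be split
  off. Averaging with the reflected integral, possible because \<Psi> is even, turns the exponential
  into a hyperbolic cosine.\<close>

private lemma zsum_diff_integral:
  assumes t: "t > 2"
  shows "has_bochner_integral lborel (\<lambda>w. \<Psi> w * cosh ((t - 1) / 2 * w)) (gfactor t * (zsum x y t - zsum_hex t))"
proof -
  have "has_bochner_integral lborel (\<lambda>w. theta0 x y (exp w) * exp (t / 2 * w) - theta_hex (exp w) * exp (t / 2 * w))
     (gfactor t * zsum x y t - gfactor t * zsum_hex t)"
    by (intro has_bochner_integral_diff theta0_mellin) (use t y in auto)
  moreover have "theta0 x y (exp w) * exp (t / 2 * w) - theta_hex (exp w) * exp (t / 2 * w) = \<Psi> w * exp ((t - 1) / 2 * w)" for w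
  proof -
    have "exp (t / 2 * w) = exp (w / 2) * exp ((t - 1) / 2 * w)" by (simp add: field_simps flip: exp_add)
    thus ?thesis by (simp add: \<Psi>_def algebra_simps)
  qed
  ultimately have 1: "has_bochner_integral lborel (\<lambda>w. \<Psi> w * exp ((t - 1) / 2 * w)) (gfactor t * (zsum x y t - zsum_hex t))"
    by (simp add: right_diff_distrib)
  have "has_bochner_integral lborel (\<lambda>w. \<Psi> (0 + -1 * w) * exp ((t - 1) / 2 * (0 + -1 * w))) ((gfactor t * (zsum x y t - zsum_hex t)) /\<^sub>R \<bar>-1\<bar>)"
    by (rule lborel_has_bochner_integral_real_affine_iff[THEN iffD1, OF _ 1]) simp
  hence 2: "has_bochner_integral lborel (\<lambda>w. \<Psi> w * exp (- ((t - 1) / 2 * w))) (gfactor t * (zsum x y t - zsum_hex t))"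
    by (simp add: Psi_even)
  have "has_bochner_integral lborel (\<lambda>w. (\<Psi> w * exp ((t - 1) / 2 * w) + \<Psi> w * exp (- ((t - 1) / 2 * w))) * (1 / 2))
    ((gfactor t * (zsum x y t - zsum_hex t) + gfactor t * (zsum x y t - zsum_hex t)) * (1 / 2))"
    by (intro has_bochner_integral_mult_left has_bochner_integral_add 1 2)
  thus ?thesis by (simp add: cosh_def algebra_simps)
qed

lemma zsum_diff_mono:
  assumes "s > 2" "t > 2" "s \<le> t"
  shows "gfactor s * (zsum x y s - zsum_hex s) \<le> gfactor t * (zsum x y t - zsum_hex t)"
proof -
  note I = zsum_diff_integral[OF assms(1)] and J = zsum_diff_integral[OF assms(2)]
  have "\<Psi> w * cosh ((s - 1) / 2 * w) \<le> \<Psi> w * cosh ((t - 1) / 2 * w)" for w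
  proof -
    have "cosh \<bar>(s - 1) / 2 * w\<bar> \<le> cosh \<bar>(t - 1) / 2 * w\<bar>"
      using assms by (subst cosh_real_nonneg_le_iff) (auto simp: abs_mult intro!: mult_right_mono)
    hence "cosh ((s - 1) / 2 * w) \<le> cosh ((t - 1) / 2 * w)" by (simp only: cosh_real_abs)
    thus ?thesis by (rule mult_left_mono[OF _ Psi_nonneg])
  qed
  thus ?thesis
    using integral_mono[of lborel "\<lambda>w. \<Psi> w * cosh ((s - 1) / 2 * w)" "\<lambda>w. \<Psi> w * cosh ((t - 1) / 2 * w)"] I J
    by (auto simp: has_bochner_integral_iff)
qed

lemma zsum_hex_le:
  assumes t: "t > 2"
  shows "zsum_hex t \<le> zsum x y t"
proof -
  have "0 \<le> gfactor t * (zsum x y t - zsum_hex t)"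
    unfolding has_bochner_integral_integral_eq[OF zsum_diff_integral[OF t], symmetric]
    by (intro Bochner_Integration.integral_nonneg mult_nonneg_nonneg Psi_nonneg) auto
  thus ?thesis using gfactor_pos[of t] t by (simp add: zero_le_mult_iff)
qed

lemma zsum_hex_less:
  assumes t: "t > 2" and ne: "(x, y) \<noteq> (1 / 2, sqrt 3 / 2)"
  shows "zsum_hex t < zsum x y t"
proof (rule ccontr)
  assume "\<not> zsum_hex t < zsum x y t"
  hence "zsum x y t = zsum_hex t" using zsum_hex_le[OF assms(1)] by simp
  note I = zsum_diff_integral[OF assms(1), unfolded this]
  have pos: "\<Psi> w * cosh ((t - 1) / 2 * w) > 0" for w
    using Psi_pos[OF ne, of w] by (simp add: cosh_real_pos)
  have "AE w in lborel. \<Psi> w * cosh ((t - 1) / 2 * w) = 0"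
    using I pos integral_nonneg_eq_0_iff_AE[of lborel "\<lambda>w. \<Psi> w * cosh ((t - 1) / 2 * w)"]
    by (auto simp: has_bochner_integral_iff less_imp_le)
  hence "AE w in (lborel :: real measure). False"
    by (rule AE_mp) (use pos in \<open>auto simp: less_le\<close>)
  hence "ae_filter (lborel :: real measure) = bot" by (simp only: eventually_False)
  thus False by (simp add: ae_filter_eq_bot_iff)
qed

end

section \<open>Planar lattices\<close>

definition planar_lattice :: "real^2 \<Rightarrow> real^2 \<Rightarrow> (real^2) set" where
  "planar_lattice u v = {real_of_int m *\<^sub>R u + real_of_int n *\<^sub>R v | m n. True}"

text \<open>The squared covolume, written in inner products alone so that it is visibly invariant
  under isometries.\<close>

definition gram :: "real^2 \<Rightarrow> real^2 \<Rightarrow> real" where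
  "gram u v = (u \<bullet> u) * (v \<bullet> v) - (u \<bullet> v)\<^sup>2"

definition cols :: "real^2 \<Rightarrow> real^2 \<Rightarrow> real^2^2" where
  "cols u v = (\<chi> i j. if j = 1 then u $ i else v $ i)"

lemma cols_mult: "cols u v *v w = (w $ 1) *\<^sub>R u + (w $ 2) *\<^sub>R v"
  by (simp add: vec_eq_iff matrix_vector_mult_def cols_def sum_2 forall_2 mult.commute)

lemma cols_columns: "B = cols (column 1 B) (column 2 B)"
  by (simp add: vec_eq_iff cols_def column_def forall_2)

lemma lattice_gen_cols: "lattice_gen (cols u v) = planar_lattice u v"
proof -
  have "cols u v *v rvec k = real_of_int (k $ 1) *\<^sub>R u + real_of_int (k $ 2) *\<^sub>R v" for k
    by (simp add: cols_mult rvec_def)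
  moreover have "real_of_int m *\<^sub>R u + real_of_int n *\<^sub>R v = cols u v *v rvec (vector [m, n])" for m n
    by (simp add: cols_mult rvec_def vector_2)
  ultimately show ?thesis unfolding planar_lattice_def lattice_gen_eq by blast
qed

lemma gram_eq_det: "gram u v = (det (cols u v))\<^sup>2"
  by (simp add: gram_def cols_def det_2 inner_vec_def sum_2 power2_eq_square algebra_simps)

lemma planar_lattice_in_lattices: "gram u v > 0 \<Longrightarrow> planar_lattice u v \<in> lattices"
  unfolding lattices_def lattice_gen_cols[symmetric] gram_eq_det
  by (auto simp: invertible_det_nz)

lemma planar_lattice_in_lattices1: "gram u v = 1 \<Longrightarrow> planar_lattice u v \<in> lattices1"
  unfolding lattices1_def lattice_gen_cols[symmetric] gram_eq_det
  by (auto simp: invertible_det_nz power2_eq_1_iff intro!: exI[of _ "cols u v"])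

lemma lattices_planar:
  assumes "L \<in> lattices"
  obtains u v where "L = planar_lattice u v" "gram u v > 0"
proof -
  obtain B :: "real^2^2" where B: "invertible B" "L = lattice_gen B" using assms by (auto simp: lattices_def)
  have "gram (column 1 B) (column 2 B) = (det B)\<^sup>2" unfolding gram_eq_det cols_columns[symmetric] ..
  thus ?thesis using B lattice_gen_cols[of "column 1 B" "column 2 B"]
    by (intro that[of "column 1 B" "column 2 B"]) (auto simp: cols_columns[symmetric] invertible_det_nz)
qed

section \<open>Changes of basis and reduced bases\<close>

lemma planar_lattice_add:
  "planar_lattice (u + real_of_int j *\<^sub>R v) v = planar_lattice u v"
proof (intro equalityI subsetI)
  fix q assume "q \<in> planar_lattice (u + real_of_int j *\<^sub>R v) v"
  then obtain m n where "q = real_of_int m *\<^sub>R (u + real_of_int j *\<^sub>R v) + real_of_int n *\<^sub>R v"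
    by (auto simp: planar_lattice_def)
  hence "q = real_of_int m *\<^sub>R u + real_of_int (m * j + n) *\<^sub>R v" by (simp add: algebra_simps)
  thus "q \<in> planar_lattice u v" unfolding planar_lattice_def by blast
next
  fix q assume "q \<in> planar_lattice u v"
  then obtain m n where "q = real_of_int m *\<^sub>R u + real_of_int n *\<^sub>R v"
    by (auto simp: planar_lattice_def)
  hence "q = real_of_int m *\<^sub>R (u + real_of_int j *\<^sub>R v) + real_of_int (n - m * j) *\<^sub>R v" by (simp add: algebra_simps)
  thus "q \<in> planar_lattice (u + real_of_int j *\<^sub>R v) v" unfolding planar_lattice_def by blast
qed

lemma planar_lattice_swap: "planar_lattice v u = planar_lattice u v"
  unfolding planar_lattice_def by (metis (no_types, opaque_lifting) add.commute)

lemma planar_lattice_minus: "planar_lattice (- u) v = planar_lattice u v"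
proof -
  have "\<exists>m' n'. real_of_int m *\<^sub>R u + real_of_int n *\<^sub>R v = real_of_int m' *\<^sub>R (- u) + real_of_int n' *\<^sub>R v" for m n
    by (rule exI[of _ "- m"], rule exI[of _ n]) simp
  moreover have "\<exists>m' n'. real_of_int m *\<^sub>R (- u) + real_of_int n *\<^sub>R v = real_of_int m' *\<^sub>R u + real_of_int n' *\<^sub>R v" for m n
    by (rule exI[of _ "- m"], rule exI[of _ n]) simp
  ultimately show ?thesis unfolding planar_lattice_def by blast
qed

lemma gram_add: "gram (u + c *\<^sub>R v) v = gram u v"
  by (simp add: gram_def inner_add_left inner_add_right power2_eq_square inner_commute algebra_simps)

lemma gram_swap: "gram v u = gram u v"
  by (simp add: gram_def inner_commute mult.commute)

lemma gram_minus: "gram (- u) v = gram u v"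
  by (simp add: gram_def)

text \<open>A by-product of convergence: in a ball the terms norm^(-t) are bounded below by a
  positive constant, which is not summable over an infinite set.\<close>

lemma finite_lattice_ball:
  assumes "(L :: (real^'n) set) \<in> lattices"
  shows "finite {q \<in> L. norm q \<le> r}"
proof (cases "r > 0")
  case True
  define t where "t = real CARD('n) + 1"
  define S where "S = {q \<in> L - {0}. norm q \<le> r}"
  have "(\<lambda>q. norm q powr (-t)) summable_on S"
    by (rule summable_on_subset[OF summable_on_lattice[OF assms, of t]]) (auto simp: t_def S_def)
  hence "(\<lambda>q. r powr (-t)) summable_on S"
    by (rule summable_on_comparison_test) (auto simp: S_def t_def intro!: powr_mono2')
  hence "finite S" using infsum_diverge_constant[of S "r powr (-t)"] True by auto
  hence "finite (insert 0 S)" by simp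
  thus ?thesis by (rule finite_subset[rotated]) (auto simp: S_def)
next
  case False
  have "{q \<in> L. norm q \<le> r} \<subseteq> {0}" using False by (auto simp: not_less) (meson norm_le_zero_iff order_trans)
  thus ?thesis by (rule finite_subset) simp
qed

text \<open>Gauss reduction as a minimization of |u|^2 + |v|^2 over bases; bounding this quantity by
  its value at a given basis leaves finitely many candidates. At a minimum, adding or subtracting
  one vector from the other cannot help, so 2 |u . v| is at most either squared length. Order and
  sign are then adjusted.\<close>

lemma planar_lattice_reduced:
  assumes L: "L \<in> lattices"
  obtains u v where "L = planar_lattice u v" "gram u v > 0"
    "v \<bullet> v \<le> u \<bullet> u" "0 \<le> u \<bullet> v" "2 * (u \<bullet> v) \<le> v \<bullet> v"
proof -
  obtain u0 v0 where uv0: "L = planar_lattice u0 v0" "gram u0 v0 > 0" by (rule lattices_planar[OF L])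
  define w where "w = (\<lambda>(u::real^2, v::real^2). u \<bullet> u + v \<bullet> v)"
  define P where "P = {(u, v). L = planar_lattice u v \<and> gram u v > 0 \<and> w (u, v) \<le> w (u0, v0)}"
  have mem: "u \<in> L" "v \<in> L" if "L = planar_lattice u v" for u v
  proof -
    have "u = real_of_int 1 *\<^sub>R u + real_of_int 0 *\<^sub>R v" "v = real_of_int 0 *\<^sub>R u + real_of_int 1 *\<^sub>R v" by simp_all
    thus "u \<in> L" "v \<in> L" unfolding that planar_lattice_def by blast+
  qed
  let ?F = "{q \<in> L. norm q \<le> sqrt (w (u0, v0))}"
  have "P \<subseteq> ?F \<times> ?F"
  proof (rule subsetI)
    fix p assume "p \<in> P"
    then obtain u v where uv: "(u, v) \<in> P" and p: "p = (u, v)" by (cases p) auto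
    have "u \<bullet> u \<le> w (u0, v0)" "v \<bullet> v \<le> w (u0, v0)"
    proof -
      have "u \<bullet> u + v \<bullet> v \<le> w (u0, v0)" using uv by (simp add: P_def w_def)
      thus "u \<bullet> u \<le> w (u0, v0)" "v \<bullet> v \<le> w (u0, v0)"
        using inner_ge_zero[of u] inner_ge_zero[of v] by linarith+
    qed
    thus "p \<in> ?F \<times> ?F" unfolding p using uv mem[of u v] by (auto simp: P_def norm_eq_sqrt_inner)
  qed
  hence "finite P" by (rule finite_subset) (intro finite_cartesian_product finite_lattice_ball L)
  moreover have "P \<noteq> {}" using uv0 by (auto simp: P_def)
  ultimately obtain p where p: "p \<in> P" "\<And>q. q \<in> P \<Longrightarrow> w p \<le> w q"
    using ex_is_arg_min_if_finite[of P w] by (auto simp: is_arg_min_linorder)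
  obtain u v where uv: "p = (u, v)" by (cases p)
  have L1: "L = planar_lattice u v" and g1: "gram u v > 0" and w1: "w (u, v) \<le> w (u0, v0)"
    using p(1) by (auto simp: P_def uv)
  have minimal: "w (u, v) \<le> w (u', v')" if "L = planar_lattice u' v'" "gram u' v' > 0" for u' v'
    using p(2)[of "(u', v')"] that w1 by (cases "w (u', v') \<le> w (u0, v0)") (auto simp: P_def uv)
  have red: "2 * \<bar>u \<bullet> v\<bar> \<le> v \<bullet> v"
    using minimal[of "u + real_of_int 1 *\<^sub>R v" v] minimal[of "u + real_of_int (- 1) *\<^sub>R v" v] L1 g1
    unfolding planar_lattice_add gram_add by (auto simp: w_def inner_simps inner_commute)
  have red2: "2 * \<bar>u \<bullet> v\<bar> \<le> u \<bullet> u"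
    using minimal[of "v + real_of_int 1 *\<^sub>R u" u] minimal[of "v + real_of_int (- 1) *\<^sub>R u" u] L1 g1
    unfolding planar_lattice_add gram_add planar_lattice_swap[of v u] gram_swap[of v u]
    by (auto simp: w_def inner_simps inner_commute)
  have "\<exists>u v. L = planar_lattice u v \<and> gram u v > 0 \<and> v \<bullet> v \<le> u \<bullet> u \<and> 2 * \<bar>u \<bullet> v\<bar> \<le> v \<bullet> v"
  proof (cases "v \<bullet> v \<le> u \<bullet> u")
    case True
    thus ?thesis using L1 g1 red by blast
  next
    case False
    thus ?thesis using L1 g1 red2
      by (intro exI[of _ v] exI[of _ u]) (auto simp: planar_lattice_swap[of v u] gram_swap[of v u] inner_commute)
  qed
  then obtain u v where uv: "L = planar_lattice u v" "gram u v > 0" "v \<bullet> v \<le> u \<bullet> u" "2 * \<bar>u \<bullet> v\<bar> \<le> v \<bullet> v"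
    by blast
  show ?thesis
  proof (cases "u \<bullet> v \<ge> 0")
    case True
    thus ?thesis using uv by (intro that[of u v]) auto
  next
    case False
    thus ?thesis using uv by (intro that[of "- u" v]) (auto simp: planar_lattice_minus gram_minus)
  qed
qed

lemma norm_planar_sq:
  "(norm (m *\<^sub>R u + n *\<^sub>R v))\<^sup>2 = m\<^sup>2 * (u \<bullet> u) + 2 * m * n * (u \<bullet> v) + n\<^sup>2 * (v \<bullet> v)"
  unfolding power2_norm_eq_inner inner_add_left inner_add_right inner_scaleR_left inner_scaleR_right
  by (simp add: inner_commute[of v u] power2_eq_square algebra_simps)

text \<open>Up to orientation x + iy is the quotient u/v in the complex plane, and A is the
  covolume.\<close>

lemma norm_planar:
  assumes g: "gram u v > 0"
  defines "A \<equiv> sqrt (gram u v)"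
  defines "x \<equiv> (u \<bullet> v) / (v \<bullet> v)" and "y \<equiv> A / (v \<bullet> v)"
  shows "v \<bullet> v > 0" "y > 0"
    "norm (real_of_int (fst k) *\<^sub>R u + real_of_int (snd k) *\<^sub>R v) = sqrt (A * qform x y k)"
proof -
  have "v \<noteq> 0" using g by (auto simp: gram_def)
  thus vv: "v \<bullet> v > 0" by simp
  have A: "A > 0" "A\<^sup>2 = gram u v" using g by (auto simp: A_def)
  show y0: "y > 0" using A vv by (simp add: y_def)
  let ?m = "real_of_int (fst k)" and ?n = "real_of_int (snd k)"
  have uu: "(u \<bullet> u) * (v \<bullet> v) = A\<^sup>2 + (u \<bullet> v)\<^sup>2" by (simp add: A(2) gram_def)
  have "A * qform x y k = (v \<bullet> v) * ((?n + ?m * x)\<^sup>2 + (?m * y)\<^sup>2)"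
    using A vv by (simp add: qform_def y_def)
  also have "\<dots> = ((?n * (v \<bullet> v) + ?m * (u \<bullet> v))\<^sup>2 + ?m\<^sup>2 * A\<^sup>2) / (v \<bullet> v)"
    using vv by (simp add: x_def y_def power_mult_distrib power_divide) (simp add: field_simps power2_eq_square)
  also have "\<dots> = ((?n * (v \<bullet> v))\<^sup>2 + 2 * ?m * ?n * (u \<bullet> v) * (v \<bullet> v) + ?m\<^sup>2 * ((u \<bullet> u) * (v \<bullet> v))) / (v \<bullet> v)"
    unfolding uu by (simp add: power2_eq_square algebra_simps)
  also have "\<dots> = (norm (?m *\<^sub>R u + ?n *\<^sub>R v))\<^sup>2"
    unfolding norm_planar_sq using vv by (simp add: field_simps power2_eq_square)
  finally show "norm (?m *\<^sub>R u + ?n *\<^sub>R v) = sqrt (A * qform x y k)" by simp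
qed

lemma bij_betw_planar_lattice:
  assumes g: "gram u v > 0"
  shows "bij_betw (\<lambda>k. real_of_int (fst k) *\<^sub>R u + real_of_int (snd k) *\<^sub>R v) (UNIV - {0}) (planar_lattice u v - {0})"
proof -
  let ?h = "\<lambda>k. real_of_int (fst k) *\<^sub>R u + real_of_int (snd k) *\<^sub>R v"
  have ne: "?h k \<noteq> 0" if "k \<noteq> 0" for k
  proof -
    note np = norm_planar[OF g]
    have "sqrt (gram u v) * qform ((u \<bullet> v) / (v \<bullet> v)) (sqrt (gram u v) / (v \<bullet> v)) k > 0"
      using qform_pos[OF np(2) that] g by simp
    hence "norm (?h k) > 0" unfolding np(3) by simp
    thus ?thesis by simp
  qed
  have inj: "inj ?h"
  proof (rule injI)
    fix k l assume "?h k = ?h l"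
    hence "?h (fst k - fst l, snd k - snd l) = 0" by (simp add: algebra_simps)
    hence "(fst k - fst l, snd k - snd l) = 0" using ne by metis
    thus "k = l" by (simp add: prod_eq_iff zero_prod_def)
  qed
  have "planar_lattice u v = range ?h"
  proof -
    have "real_of_int m *\<^sub>R u + real_of_int n *\<^sub>R v = ?h (m, n)" for m n by simp
    thus ?thesis unfolding planar_lattice_def by blast
  qed
  hence "planar_lattice u v - {0} = ?h ` (UNIV - {0})" using ne by (auto simp: zero_prod_def)
  thus ?thesis using inj_on_subset[OF inj] by (simp add: bij_betw_def)
qed

lemma lat_energy_planar:
  assumes g: "gram u v > 0"
  shows "lat_energy f (planar_lattice u v) = infsum (\<lambda>k. f (norm (real_of_int (fst k) *\<^sub>R u + real_of_int (snd k) *\<^sub>R v))) (UNIV - {0})"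
  unfolding lat_energy_def
  using infsum_reindex_bij_betw[OF bij_betw_planar_lattice[OF g], of "\<lambda>q. f (norm q)"] by simp

text \<open>The linear map carrying one basis to the other preserves norms, since the norm of a
  combination depends only on the inner products of the basis.\<close>

lemma planar_lattice_isometric:
  assumes g: "gram u v > 0" and eq: "u' \<bullet> u' = u \<bullet> u" "u' \<bullet> v' = u \<bullet> v" "v' \<bullet> v' = v \<bullet> v"
  shows "isometric_lat (planar_lattice u v) (planar_lattice u' v')"
proof -
  define B where "B = cols u v"
  have inv: "invertible B" using g by (auto simp: B_def invertible_det_nz gram_eq_det)
  obtain Bi where Bi: "B ** Bi = mat 1" "Bi ** B = mat 1" using inv by (auto simp: invertible_def)
  define T where "T = (\<lambda>z. cols u' v' *v (Bi *v z))"
  have TB: "T (B *v w) = cols u' v' *v w" for w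
    unfolding T_def by (simp add: matrix_vector_mul_assoc[of Bi] Bi)
  have surj: "z = B *v (Bi *v z)" for z
    by (simp add: matrix_vector_mul_assoc Bi)
  have nrm: "norm (T z) = norm z" for z
  proof -
    let ?w = "Bi *v z"
    have "(norm (T z))\<^sup>2 = (norm (cols u' v' *v ?w))\<^sup>2" by (simp add: T_def)
    also have "\<dots> = (norm (B *v ?w))\<^sup>2" unfolding B_def cols_mult norm_planar_sq eq ..
    finally show ?thesis using surj[of z] by simp
  qed
  have lin: "linear T" unfolding T_def
    using linear_compose[OF matrix_vector_mul_linear matrix_vector_mul_linear] by (simp add: o_def)
  have T: "orthogonal_transformation T"
    using nrm lin by (simp add: orthogonal_transformation)
  have "T ` planar_lattice u v = planar_lattice u' v'"
    unfolding lattice_gen_cols[symmetric] lattice_gen_eq image_image B_def[symmetric] TB ..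
  thus ?thesis using T by (auto simp: isometric_lat_def)
qed

lemma epstein_planar:
  assumes g: "gram u v = 1"
  shows "epstein (planar_lattice u v) t = zsum ((u \<bullet> v) / (v \<bullet> v)) (1 / (v \<bullet> v)) t"
proof -
  have g0: "gram u v > 0" using g by simp
  note np = norm_planar(2,3)[OF g0, unfolded g real_sqrt_one]
  have "norm (real_of_int (fst k) *\<^sub>R u + real_of_int (snd k) *\<^sub>R v) powr (- t) =
      qform ((u \<bullet> v) / (v \<bullet> v)) (1 / (v \<bullet> v)) k powr (- t / 2)" if "k \<in> UNIV - {0}" for k
  proof -
    have "qform ((u \<bullet> v) / (v \<bullet> v)) (1 / (v \<bullet> v)) k > 0" using qform_pos np(1) that by auto
    thus ?thesis unfolding np(2) mult_1 by (simp add: powr_powr flip: powr_half_sqrt)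
  qed
  thus ?thesis
    unfolding epstein_def lat_energy_planar[OF g0] zsum_def by (rule infsum_cong)
qed

section \<open>The triangular lattice\<close>

definition A2_u :: "real^2" where
  "A2_u = sqrt (2 / sqrt 3) *\<^sub>R vector [1 / 2, sqrt 3 / 2]"

definition A2_v :: "real^2" where
  "A2_v = sqrt (2 / sqrt 3) *\<^sub>R vector [1, 0]"

lemma A2_planar: "A2 = planar_lattice A2_u A2_v"
proof -
  have "sqrt (2 / sqrt 3) *\<^sub>R (real_of_int a *\<^sub>R vector [1, 0] + real_of_int b *\<^sub>R vector [1 / 2, sqrt 3 / 2]) =
     real_of_int b *\<^sub>R A2_u + real_of_int a *\<^sub>R (A2_v :: real^2)" for a b
    by (simp add: A2_u_def A2_v_def algebra_simps)
  thus ?thesis unfolding A2_def planar_lattice_def scale_lat_def by (auto simp: image_iff) metis+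
qed

lemma A2_inner: "A2_u \<bullet> A2_u = 2 / sqrt 3" "A2_u \<bullet> A2_v = 1 / sqrt 3" "A2_v \<bullet> A2_v = 2 / sqrt 3"
  by (simp_all add: A2_u_def A2_v_def inner_vec_def sum_2 vector_2 power2_eq_square[symmetric] power_divide field_simps)

lemma A2_gram: "gram A2_u A2_v = 1"
  by (simp add: gram_def A2_inner power_divide)

lemma A2_in_lattices1: "A2 \<in> lattices1"
  unfolding A2_planar by (rule planar_lattice_in_lattices1[OF A2_gram])

lemma epstein_A2: "epstein A2 t = zsum_hex t"
proof -
  have "1 / (2 / sqrt 3) = sqrt 3 / 2" "(1 / sqrt 3) / (2 / sqrt 3) = (1 / 2 :: real)" by (simp_all add: field_simps)
  thus ?thesis using epstein_planar[OF A2_gram, of t] by (simp only: A2_planar[symmetric] A2_inner)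
qed

lemma gram_eq_1:
  assumes "planar_lattice u v \<in> lattices1" "gram u v > 0"
  shows "gram u v = 1"
proof -
  obtain B where B: "invertible B" "\<bar>det B\<bar> = 1" "planar_lattice u v = lattice_gen B"
    using assms by (auto simp: lattices1_def)
  have "invertible (cols u v)" using assms(2) by (auto simp: invertible_det_nz gram_eq_det)
  hence "\<bar>det (cols u v)\<bar> = \<bar>det B\<bar>"
    using B by (intro abs_det_eq_of_lattice_gen_eq) (auto simp: lattice_gen_cols)
  thus ?thesis unfolding gram_eq_det B(2) by (metis abs_1 power2_abs power_one)
qed

text \<open>For a reduced basis at unit density x^2 + y^2 = |u|^2/|v|^2, so (x, y) lies in the
  domain where the theta comparison holds. Equality pins (x, y), hence all inner products of the
  basis, hence the lattice up to isometry.\<close>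

lemma epstein_A2_compare:
  assumes L: "L \<in> lattices1" and s: "s > 2" "s \<le> t"
  shows "gfactor s * (epstein L s - epstein A2 s) \<le> gfactor t * (epstein L t - epstein A2 t)"
    and "epstein A2 s \<le> epstein L s"
    and "epstein L s = epstein A2 s \<Longrightarrow> isometric_lat A2 L"
proof -
  obtain u v where uv: "L = planar_lattice u v" "gram u v > 0" "v \<bullet> v \<le> u \<bullet> u" "0 \<le> u \<bullet> v" "2 * (u \<bullet> v) \<le> v \<bullet> v"
    using planar_lattice_reduced[of L] L lattices1_subset by blast
  have g: "gram u v = 1" using gram_eq_1 uv L by simp
  have vv: "v \<bullet> v > 0" using norm_planar(1)[OF uv(2)] .
  define x where "x = (u \<bullet> v) / (v \<bullet> v)"
  define y where "y = 1 / (v \<bullet> v)"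
  have y: "y > 0" using vv by (simp add: y_def)
  have x: "0 \<le> x" "x \<le> 1 / 2" using uv vv by (auto simp: x_def field_simps)
  have "x\<^sup>2 + y\<^sup>2 = (u \<bullet> u) / (v \<bullet> v)"
  proof -
    have "x\<^sup>2 + y\<^sup>2 = ((u \<bullet> v)\<^sup>2 + gram u v) / (v \<bullet> v)\<^sup>2" by (simp add: x_def y_def g power_divide add_divide_distrib)
    also have "\<dots> = (u \<bullet> u) / (v \<bullet> v)" using vv by (simp add: gram_def power2_eq_square)
    finally show ?thesis .
  qed
  hence xy: "1 \<le> x\<^sup>2 + y\<^sup>2" using uv vv by simp
  have z: "epstein L r = zsum x y r" for r unfolding uv(1) x_def y_def by (rule epstein_planar[OF g])
  show "gfactor s * (epstein L s - epstein A2 s) \<le> gfactor t * (epstein L t - epstein A2 t)"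
    unfolding z epstein_A2 using s by (intro zsum_diff_mono y x xy) auto
  show "epstein A2 s \<le> epstein L s"
    unfolding z epstein_A2 by (intro zsum_hex_le y x xy s)
  assume "epstein L s = epstein A2 s"
  hence "(x, y) = (1 / 2, sqrt 3 / 2)"
    using zsum_hex_less[OF y x xy s(1)] unfolding z epstein_A2 by fastforce
  hence xe: "x = 1 / 2" and ye: "y = sqrt 3 / 2" by auto
  have v1: "v \<bullet> v = 2 / sqrt 3" using ye vv by (simp add: y_def field_simps)
  have v2: "u \<bullet> v = 1 / sqrt 3" using xe vv v1 by (simp add: x_def field_simps)
  have "u \<bullet> u = (gram u v + (u \<bullet> v)\<^sup>2) / (v \<bullet> v)" using vv by (simp add: gram_def)
  also have "\<dots> = 2 / sqrt 3" unfolding g v1 v2 by (simp add: power_divide field_simps)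
  finally have "u \<bullet> u = 2 / sqrt 3" .
  thus "isometric_lat A2 L"
    unfolding A2_planar uv(1) by (intro planar_lattice_isometric) (simp_all add: A2_gram A2_inner v1 v2)
qed

section \<open>Minimality of the triangular lattice for \<open>phibar\<close>\<close>

lemma phibar_strict_mono:
  assumes s: "0 < s" "s < \<alpha>" and r: "(\<alpha> / s) powr (1 / (\<alpha> - s)) \<le> r" "r < r'"
  shows "phibar \<alpha> s r < phibar \<alpha> s r'"
proof -
  let ?r0 = "(\<alpha> / s) powr (1 / (\<alpha> - s))"
  have r0: "?r0 > 0" using s by simp
  have rpos: "r > 0" using r r0 by linarith
  show ?thesis
  proof (rule DERIV_pos_imp_increasing_open[OF r(2)])
    fix z assume z: "r < z" "z < r'"
    hence z0: "z > 0" using r r0 by linarith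
    have d: "(phibar \<alpha> s has_real_derivative (- \<alpha> * z powr (- \<alpha> - 1) - (- s * z powr (- s - 1)))) (at z)"
      unfolding phibar_def using z0 by (auto intro!: derivative_eq_intros)
    have "?r0 powr (\<alpha> - s) = \<alpha> / s" using s by (simp add: powr_powr)
    moreover have "?r0 powr (\<alpha> - s) < z powr (\<alpha> - s)" using r z r0 s by (intro powr_less_mono2) auto
    ultimately have "\<alpha> / s < z powr (\<alpha> - s)" by simp
    hence "\<alpha> < s * z powr (\<alpha> - s)" using s by (simp add: pos_divide_less_eq mult.commute)
    hence "\<alpha> * z powr (- \<alpha> - 1) < s * z powr (\<alpha> - s) * z powr (- \<alpha> - 1)" using z0 by simp
    also have "s * z powr (\<alpha> - s) * z powr (- \<alpha> - 1) = s * z powr (- s - 1)" by (simp flip: powr_add)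
    finally show "\<exists>D. (phibar \<alpha> s has_real_derivative D) (at z) \<and> D > 0" using d by (intro exI conjI) auto
  next
    show "continuous_on {r..r'} (phibar \<alpha> s)"
      unfolding phibar_def using r rpos by (intro continuous_intros) auto
  qed
qed

lemma summable_on_phibar_planar:
  assumes g: "gram u v > 0" and s: "2 < s" "s < \<alpha>"
  shows "(\<lambda>k. phibar \<alpha> s (norm (real_of_int (fst k) *\<^sub>R u + real_of_int (snd k) *\<^sub>R v))) summable_on (UNIV - {0})"
proof -
  have "(\<lambda>q. norm q powr (- t)) summable_on (planar_lattice u v - {0})" if "t > 2" for t
    by (rule summable_on_lattice[OF planar_lattice_in_lattices[OF g]]) (use that in simp)
  from summable_on_add[OF this[of \<alpha>] iffD2[OF summable_on_uminus this[of s]]]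
  have "(\<lambda>q. phibar \<alpha> s (norm q)) summable_on (planar_lattice u v - {0})"
    using s by (simp add: phibar_def)
  thus ?thesis by (rule summable_on_reindex_bij_betw[OF bij_betw_planar_lattice[OF g], THEN iffD2])
qed

lemma phibar_planar_strict_mono:
  assumes g: "gram u v > 0" "gram u' v' > 0" and s: "2 < s" "s < \<alpha>"
    and le: "\<And>m n. (m, n) \<noteq> 0 \<Longrightarrow>
      phibar \<alpha> s (norm (real_of_int m *\<^sub>R u' + real_of_int n *\<^sub>R v')) \<le> phibar \<alpha> s (norm (real_of_int m *\<^sub>R u + real_of_int n *\<^sub>R v))"
    and less: "phibar \<alpha> s (norm u') < phibar \<alpha> s (norm u)"
  shows "lat_energy (phibar \<alpha> s) (planar_lattice u' v') < lat_energy (phibar \<alpha> s) (planar_lattice u v)"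
  unfolding lat_energy_planar[OF g(1)] lat_energy_planar[OF g(2)]
proof (rule has_sum_strict_mono[OF has_sum_infsum[OF summable_on_phibar_planar[OF g(2) s]] has_sum_infsum[OF summable_on_phibar_planar[OF g(1) s]], of "(1, 0)"])
  fix k :: "int \<times> int" assume "k \<in> UNIV - {0}"
  thus "phibar \<alpha> s (norm (real_of_int (fst k) *\<^sub>R u' + real_of_int (snd k) *\<^sub>R v')) \<le>
      phibar \<alpha> s (norm (real_of_int (fst k) *\<^sub>R u + real_of_int (snd k) *\<^sub>R v))"
    using le[of "fst k" "snd k"] by simp
qed (use less in \<open>auto simp: zero_prod_def\<close>)

lemma scale_planar: "scale_lat c (planar_lattice u v) = planar_lattice (c *\<^sub>R u) (c *\<^sub>R v)"
proof -
  have "c *\<^sub>R (real_of_int m *\<^sub>R u + real_of_int n *\<^sub>R v) = real_of_int m *\<^sub>R c *\<^sub>R u + real_of_int n *\<^sub>R c *\<^sub>R v" for m n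
    by (simp add: algebra_simps)
  thus ?thesis unfolding scale_lat_def planar_lattice_def by (auto simp: image_iff) metis+
qed

lemma gram_scale: "gram (c *\<^sub>R u) (c *\<^sub>R v) = c ^ 4 * gram u v"
  by (simp add: gram_def power2_eq_square power_numeral_reduce algebra_simps)

text \<open>With \<open>da\<close> and \<open>ds\<close> the excesses over \<open>A2\<close>, the
  Mellin comparison gives gfactor(s) ds \<le> gfactor(\<alpha>) da, and the condition on
  \<open>H_fun\<close> says \<alpha> gfactor(\<alpha>) < s gfactor(s). Together (\<alpha>/s) ds
  \<le> da, strictly unless ds = 0, which is the isometric case.\<close>

lemma phibar_scale_A2_le:
  assumes L: "L \<in> lattices1" and s: "2 < s" "s < \<alpha>" and H: "H_fun \<alpha> < H_fun s"
    and c: "0 < c" "c powr (\<alpha> - s) \<le> \<alpha> / s"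
  shows "lat_energy (phibar \<alpha> s) (scale_lat c A2) \<le> lat_energy (phibar \<alpha> s) (scale_lat c L)"
    and "lat_energy (phibar \<alpha> s) (scale_lat c A2) = lat_energy (phibar \<alpha> s) (scale_lat c L) \<Longrightarrow> isometric_lat A2 L"
proof -
  have E: "lat_energy (phibar \<alpha> s) (scale_lat c M) = c powr (- \<alpha>) * (epstein M \<alpha> - c powr (\<alpha> - s) * epstein M s)"
    if M: "M \<in> lattices1" for M :: "(real^2) set"
  proof -
    have "scale_lat c M \<in> lattices" using scale_lat_in_lattices M lattices1_subset c by blast
    hence "lat_energy (phibar \<alpha> s) (scale_lat c M) = c powr (- \<alpha>) * epstein M \<alpha> - c powr (- s) * epstein M s"
      using s by (subst lat_energy_phibar) (auto simp: energyE_def lat_energy_powr_scale[OF c(1)])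
    also have "c powr (- s) = c powr (- \<alpha>) * c powr (\<alpha> - s)" by (simp flip: powr_add)
    finally show ?thesis by (simp add: algebra_simps)
  qed
  define da where "da = epstein L \<alpha> - epstein A2 \<alpha>"
  define ds where "ds = epstein L s - epstein A2 s"
  note cmp = epstein_A2_compare[OF L s(1)]
  have ds: "ds \<ge> 0" using cmp(2)[OF order_refl] by (simp add: ds_def)
  have "gfactor s * ds \<le> gfactor \<alpha> * da" using cmp(1)[of \<alpha>] s by (simp add: da_def ds_def)
  moreover have G: "gfactor \<alpha> > 0" "\<alpha> * gfactor \<alpha> < s * gfactor s"
    using H gfactor_pos[of \<alpha>] s by (simp_all add: H_fun_eq)
  moreover have "(\<alpha> / s * gfactor \<alpha>) * ds \<le> gfactor s * ds"
    using G ds s by (intro mult_right_mono) (auto simp: field_simps)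
  moreover have "ds > 0 \<Longrightarrow> (\<alpha> / s * gfactor \<alpha>) * ds < gfactor s * ds"
    using G s by (simp add: field_simps)
  ultimately have "gfactor \<alpha> * (\<alpha> / s * ds) \<le> gfactor \<alpha> * da" "ds > 0 \<Longrightarrow> gfactor \<alpha> * (\<alpha> / s * ds) < gfactor \<alpha> * da"
    by (simp_all add: mult_ac)
  hence "\<alpha> / s * ds \<le> da" "ds > 0 \<Longrightarrow> \<alpha> / s * ds < da"
    by (simp_all only: mult_le_cancel_left_pos[OF G(1)] mult_less_cancel_left_pos[OF G(1)])
  moreover have "c powr (\<alpha> - s) * ds \<le> \<alpha> / s * ds" using c ds by (intro mult_right_mono) auto
  ultimately have le: "c powr (\<alpha> - s) * ds \<le> da" and less: "ds > 0 \<Longrightarrow> c powr (\<alpha> - s) * ds < da" by linarith+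
  have diff: "lat_energy (phibar \<alpha> s) (scale_lat c L) - lat_energy (phibar \<alpha> s) (scale_lat c A2) = c powr (- \<alpha>) * (da - c powr (\<alpha> - s) * ds)"
    unfolding E[OF L] E[OF A2_in_lattices1] da_def ds_def by (simp add: algebra_simps)
  have "c powr (- \<alpha>) * (da - c powr (\<alpha> - s) * ds) \<ge> 0" using le by (intro mult_nonneg_nonneg) auto
  thus "lat_energy (phibar \<alpha> s) (scale_lat c A2) \<le> lat_energy (phibar \<alpha> s) (scale_lat c L)" using diff by linarith
  assume "lat_energy (phibar \<alpha> s) (scale_lat c A2) = lat_energy (phibar \<alpha> s) (scale_lat c L)"
  hence "da - c powr (\<alpha> - s) * ds = 0" using diff c by simp
  hence "ds = 0" using less ds by fastforce
  thus "isometric_lat A2 L" using cmp(3)[OF order_refl] by (simp add: ds_def)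
qed

context
  fixes \<alpha> s :: real
  assumes s: "2 < s" "s < \<alpha>" and H: "H_fun \<alpha> < H_fun s"
begin

private abbreviation "r0 \<equiv> (\<alpha> / s) powr (1 / (\<alpha> - s))"

private abbreviation "E \<equiv> lat_energy (phibar \<alpha> s) :: (real^2) set \<Rightarrow> real"

private abbreviation "A2_opt \<equiv> scale_lat (lam_bar \<alpha> s A2) A2"

private lemma r0_pos: "r0 > 0" using s by simp

lemma unique_min_pos_phibar_A2: "unique_min_pos (\<lambda>c. E (scale_lat c A2)) (lam_bar \<alpha> s A2)"
proof -
  have "A2 \<in> lattices" using A2_in_lattices1 lattices1_subset by blast
  thus ?thesis using s by (intro unique_min_pos_phibar) auto
qed

text \<open>The lattice is first compared with \<open>A2\<close> at the same covolume, where its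
  scale is at most r0, and then \<open>A2\<close> is moved to its optimal scale. Equality overall
  forces equality in both steps.\<close>

private lemma small_area:
  assumes g: "gram u v > 0" "gram u v \<le> r0 ^ 4"
  shows "E A2_opt \<le> E (planar_lattice u v)" "E (planar_lattice u v) = E A2_opt \<Longrightarrow> isometric_lat A2_opt (planar_lattice u v)"
proof -
  \<comment> \<open>\<open>gram\<close> is multiplied by the fourth power of the scale, so its
    fourth root normalizes the density.\<close>
  define c where "c = sqrt (sqrt (gram u v))"
  have c: "c > 0" "c ^ 4 = gram u v"
  proof -
    show "c > 0" using g by (simp add: c_def)
    have "c ^ 4 = (c\<^sup>2)\<^sup>2" by simp
    thus "c ^ 4 = gram u v" using g by (simp add: c_def)
  qed
  define L1 where "L1 = planar_lattice ((1 / c) *\<^sub>R u) ((1 / c) *\<^sub>R v)"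
  have L: "planar_lattice u v = scale_lat c L1" using c by (simp add: L1_def scale_planar)
  have "gram ((1 / c) *\<^sub>R u) ((1 / c) *\<^sub>R v) = 1" unfolding gram_scale using c g by (simp add: power_divide)
  hence L1: "L1 \<in> lattices1" unfolding L1_def by (rule planar_lattice_in_lattices1)
  have "c \<le> r0" using c g r0_pos by (intro power_le_imp_le_base[of c 3 r0]) auto
  hence "c powr (\<alpha> - s) \<le> r0 powr (\<alpha> - s)" using c s by (intro powr_mono2) auto
  also have "\<dots> = \<alpha> / s" using s by (simp add: powr_powr)
  finally have cs: "c powr (\<alpha> - s) \<le> \<alpha> / s" .
  note um = unique_min_posD[OF unique_min_pos_phibar_A2]
  note cmp = phibar_scale_A2_le[OF L1 s H c(1) cs]
  have 1: "E A2_opt \<le> E (scale_lat c A2)" using um(2)[OF c(1)] .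
  show "E A2_opt \<le> E (planar_lattice u v)" unfolding L using 1 cmp(1) by linarith
  assume eq: "E (planar_lattice u v) = E A2_opt"
  have "isometric_lat A2 L1" by (rule cmp(2)) (use eq 1 cmp(1) L in simp)
  moreover have "c = lam_bar \<alpha> s A2" by (rule um(3)[OF c(1)]) (use eq 1 cmp(1) L in simp)
  ultimately show "isometric_lat A2_opt (planar_lattice u v)" unfolding L by (simp add: isometric_scale)
qed

text \<open>Here \<open>w\<close> is the part of u orthogonal to v, so |w| is the distance between
  neighbouring rows parallel to v. If it exceeds r0, the rows are moved together without touching
  the row through the origin, until the covolume is at most r0^2.\<close>

private lemma short_vector:
  assumes g: "gram u v > 0" and v: "norm v \<le> r0"
  shows "E A2_opt \<le> E (planar_lattice u v)" "E (planar_lattice u v) = E A2_opt \<Longrightarrow> isometric_lat A2_opt (planar_lattice u v)"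
proof -
  define x where "x = (u \<bullet> v) / (v \<bullet> v)"
  define w where "w = u - x *\<^sub>R v"
  have vv: "v \<bullet> v > 0" using norm_planar(1)[OF g] .
  have vw: "v \<bullet> w = 0" using vv by (simp add: w_def x_def inner_simps inner_commute)
  have gram_w: "gram (x *\<^sub>R v + c *\<^sub>R w) v = c\<^sup>2 * ((norm w)\<^sup>2 * (norm v)\<^sup>2)" for c
    unfolding gram_def power2_norm_eq_inner using vw
    by (simp add: inner_add_left inner_add_right inner_commute[of w v] power2_eq_square algebra_simps)
  have u: "u = x *\<^sub>R v + 1 *\<^sub>R w" by (simp add: w_def)
  have gw: "gram u v = (norm w)\<^sup>2 * (norm v)\<^sup>2" using gram_w[of 1] by (simp add: w_def)
  have w0: "norm w > 0" using g gw by auto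
  have nrm: "(norm (real_of_int m *\<^sub>R (x *\<^sub>R v + c *\<^sub>R w) + real_of_int n *\<^sub>R v))\<^sup>2 =
      (real_of_int n + real_of_int m * x)\<^sup>2 * (norm v)\<^sup>2 + (real_of_int m)\<^sup>2 * c\<^sup>2 * (norm w)\<^sup>2" for m n c
    unfolding power2_norm_eq_inner using vw
    by (simp add: inner_add_left inner_add_right inner_commute[of w v] power2_eq_square algebra_simps)
  have main: "E A2_opt \<le> E (planar_lattice u v) \<and> (E (planar_lattice u v) = E A2_opt \<longrightarrow> isometric_lat A2_opt (planar_lattice u v))"
  proof (cases "norm w \<le> r0")
    case True
    have "(norm w)\<^sup>2 * (norm v)\<^sup>2 \<le> r0\<^sup>2 * r0\<^sup>2" using True v by (intro mult_mono power_mono) auto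
    hence "gram u v \<le> r0 ^ 4" by (simp add: gw flip: power_add)
    thus ?thesis using small_area[OF g] by blast
  next
    case False
    \<comment> \<open>The row distance becomes exactly r0. Every vector off the central row gets
      shorter but stays at least r0 long, where \<open>phibar\<close> increases, so its contribution
      drops.\<close>
    define c where "c = r0 / norm w"
    have c: "0 < c" "c < 1" "c * norm w = r0" using False w0 r0_pos by (auto simp: c_def)
    let ?u = "x *\<^sub>R v + c *\<^sub>R w"
    have g': "gram ?u v > 0" using gram_w[of c] c w0 vv by simp
    have "(norm w)\<^sup>2 * (norm v)\<^sup>2 * c\<^sup>2 \<le> r0\<^sup>2 * r0\<^sup>2"
    proof -
      have "(norm w)\<^sup>2 * (norm v)\<^sup>2 * c\<^sup>2 = (c * norm w)\<^sup>2 * (norm v)\<^sup>2" by (simp add: power_mult_distrib)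
      also have "\<dots> \<le> r0\<^sup>2 * r0\<^sup>2" unfolding c(3) using v by (intro mult_left_mono power_mono) auto
      finally show ?thesis .
    qed
    hence g4: "gram ?u v \<le> r0 ^ 4" unfolding gram_w by (simp add: mult_ac flip: power_add)
    have less: "phibar \<alpha> s (norm (real_of_int m *\<^sub>R ?u + real_of_int n *\<^sub>R v)) < phibar \<alpha> s (norm (real_of_int m *\<^sub>R u + real_of_int n *\<^sub>R v))"
      if m: "m \<noteq> 0" for m n
    proof (rule phibar_strict_mono)
      have "1 \<le> \<bar>real_of_int m\<bar>" using m by linarith
      hence "1\<^sup>2 \<le> \<bar>real_of_int m\<bar>\<^sup>2" by (intro power_mono) auto
      hence m1: "1 \<le> (real_of_int m)\<^sup>2" by simp
      have "r0\<^sup>2 = c\<^sup>2 * (norm w)\<^sup>2" unfolding c(3)[symmetric] by (simp add: power_mult_distrib)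
      also have "\<dots> \<le> (real_of_int m)\<^sup>2 * (c\<^sup>2 * (norm w)\<^sup>2)" using mult_right_mono[OF m1, of "c\<^sup>2 * (norm w)\<^sup>2"] by simp
      also have "\<dots> \<le> (norm (real_of_int m *\<^sub>R ?u + real_of_int n *\<^sub>R v))\<^sup>2" unfolding nrm by simp
      finally show "r0 \<le> norm (real_of_int m *\<^sub>R ?u + real_of_int n *\<^sub>R v)" by (rule power2_le_imp_le) simp
      have "c\<^sup>2 < 1\<^sup>2" using c by (intro power_strict_mono) auto
      hence "(real_of_int m)\<^sup>2 * (norm w)\<^sup>2 * c\<^sup>2 < (real_of_int m)\<^sup>2 * (norm w)\<^sup>2 * 1\<^sup>2" using m w0 by (intro mult_strict_left_mono) auto
      hence "(norm (real_of_int m *\<^sub>R ?u + real_of_int n *\<^sub>R v))\<^sup>2 < (norm (real_of_int m *\<^sub>R (x *\<^sub>R v + 1 *\<^sub>R w) + real_of_int n *\<^sub>R v))\<^sup>2"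
        unfolding nrm by (simp add: mult_ac)
      hence "(norm (real_of_int m *\<^sub>R ?u + real_of_int n *\<^sub>R v))\<^sup>2 < (norm (real_of_int m *\<^sub>R u + real_of_int n *\<^sub>R v))\<^sup>2"
        unfolding u[symmetric] .
      thus "norm (real_of_int m *\<^sub>R ?u + real_of_int n *\<^sub>R v) < norm (real_of_int m *\<^sub>R u + real_of_int n *\<^sub>R v)"
        by (rule power2_less_imp_less) simp
    qed (use s in auto)
    have "E (planar_lattice ?u v) < E (planar_lattice u v)"
    proof (rule phibar_planar_strict_mono[OF g g' s])
      fix m n :: int
      show "phibar \<alpha> s (norm (real_of_int m *\<^sub>R ?u + real_of_int n *\<^sub>R v)) \<le> phibar \<alpha> s (norm (real_of_int m *\<^sub>R u + real_of_int n *\<^sub>R v))"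
        using less[of m n] by (cases "m = 0") auto
      show "phibar \<alpha> s (norm ?u) < phibar \<alpha> s (norm u)" using less[of 1 0] by simp
    qed
    thus ?thesis using small_area(1)[OF g' g4] by auto
  qed
  thus "E A2_opt \<le> E (planar_lattice u v)" "E (planar_lattice u v) = E A2_opt \<Longrightarrow> isometric_lat A2_opt (planar_lattice u v)"
    by auto
qed

lemma A2_unique_min_phibar: "unique_min_lat lattices E A2_opt"
proof -
  have A2: "A2 \<in> lattices" using A2_in_lattices1 lattices1_subset by blast
  have main: "E A2_opt \<le> E L \<and> (E L = E A2_opt \<longrightarrow> isometric_lat A2_opt L)" if L: "L \<in> lattices" for L
  proof -
    obtain u v where uv: "L = planar_lattice u v" "gram u v > 0" "v \<bullet> v \<le> u \<bullet> u" "0 \<le> u \<bullet> v" "2 * (u \<bullet> v) \<le> v \<bullet> v"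
      using planar_lattice_reduced[OF L] by blast
    show ?thesis
    proof (cases "norm v \<le> r0")
      case True
      thus ?thesis using short_vector[OF uv(2)] uv(1) by auto
    next
      case False
      \<comment> \<open>Shrinks until the shortest vector has length r0; all vectors remain in the
        range where \<open>phibar\<close> increases, so the energy drops.\<close>
      define c where "c = r0 / norm v"
      have v0: "norm v > 0" using norm_planar(1)[OF uv(2)] by auto
      have c: "0 < c" "c < 1" "c * norm v = r0" using False v0 r0_pos by (auto simp: c_def)
      have g': "gram (c *\<^sub>R u) (c *\<^sub>R v) > 0" unfolding gram_scale using c uv(2) by simp
      \<comment> \<open>Reducedness gives |m u + n v|^2 \<ge> (m^2 + n^2 - |m n|) |v|^2, and the
        integer in front is positive unless m = n = 0.\<close>
      have shortest: "norm v \<le> norm (real_of_int m *\<^sub>R u + real_of_int n *\<^sub>R v)" if mn: "(m, n) \<noteq> 0" for m n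
      proof -
        let ?m = "real_of_int m" and ?n = "real_of_int n"
        have "0 \<le> (2 * \<bar>m\<bar> - \<bar>n\<bar>)\<^sup>2" by simp
        hence "4 * (m\<^sup>2 + n\<^sup>2 - \<bar>m * n\<bar>) \<ge> 3 * n\<^sup>2" by (simp add: power2_eq_square algebra_simps abs_mult)
        moreover have "0 \<le> (2 * \<bar>n\<bar> - \<bar>m\<bar>)\<^sup>2" by simp
        hence "4 * (m\<^sup>2 + n\<^sup>2 - \<bar>m * n\<bar>) \<ge> 3 * m\<^sup>2" by (simp add: power2_eq_square algebra_simps abs_mult)
        moreover have "m \<noteq> 0 \<or> n \<noteq> 0" using mn by (auto simp: zero_prod_def)
        hence "m\<^sup>2 > 0 \<or> n\<^sup>2 > 0" by auto
        moreover have "1 \<le> K" if "3 * p \<le> 4 * K" "0 < p" for K p :: int using that by linarith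
        ultimately have "m\<^sup>2 + n\<^sup>2 - \<bar>m * n\<bar> \<ge> 1" by blast
        hence "real_of_int (m\<^sup>2 + n\<^sup>2 - \<bar>m * n\<bar>) \<ge> 1" by (simp only: of_int_1_le_iff)
        hence h: "1 \<le> ?m\<^sup>2 + ?n\<^sup>2 - \<bar>?m * ?n\<bar>" by simp
        have "(norm v)\<^sup>2 = 1 * (v \<bullet> v)" by (simp add: power2_norm_eq_inner)
        also have "\<dots> \<le> (?m\<^sup>2 + ?n\<^sup>2 - \<bar>?m * ?n\<bar>) * (v \<bullet> v)" using h by (intro mult_right_mono) auto
        also have "\<dots> = ?m\<^sup>2 * (v \<bullet> v) - \<bar>?m * ?n\<bar> * (v \<bullet> v) + ?n\<^sup>2 * (v \<bullet> v)" by (simp add: algebra_simps)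
        also have "\<dots> \<le> ?m\<^sup>2 * (u \<bullet> u) - \<bar>?m * ?n\<bar> * (2 * (u \<bullet> v)) + ?n\<^sup>2 * (v \<bullet> v)"
          using uv by (intro add_right_mono diff_mono mult_left_mono) auto
        also have "\<dots> \<le> ?m\<^sup>2 * (u \<bullet> u) + 2 * ?m * ?n * (u \<bullet> v) + ?n\<^sup>2 * (v \<bullet> v)"
        proof -
          have "0 \<le> (\<bar>?m * ?n\<bar> + ?m * ?n) * (2 * (u \<bullet> v))"
            using uv(4) by (intro mult_nonneg_nonneg) linarith+
          also have "\<dots> = \<bar>?m * ?n\<bar> * (2 * (u \<bullet> v)) + 2 * ?m * ?n * (u \<bullet> v)"
            by (simp only: distrib_right mult.assoc mult.left_commute[of 2])
          finally show ?thesis by linarith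
        qed
        also have "\<dots> = (norm (?m *\<^sub>R u + ?n *\<^sub>R v))\<^sup>2" by (simp add: norm_planar_sq)
        finally show ?thesis by (rule power2_le_imp_le) simp
      qed
      have less: "phibar \<alpha> s (norm (real_of_int m *\<^sub>R c *\<^sub>R u + real_of_int n *\<^sub>R c *\<^sub>R v)) < phibar \<alpha> s (norm (real_of_int m *\<^sub>R u + real_of_int n *\<^sub>R v))"
        if mn: "(m, n) \<noteq> 0" for m n
      proof (rule phibar_strict_mono)
        let ?q = "real_of_int m *\<^sub>R u + real_of_int n *\<^sub>R v"
        have eq: "norm (real_of_int m *\<^sub>R c *\<^sub>R u + real_of_int n *\<^sub>R c *\<^sub>R v) = c * norm ?q"
        proof -
          have "real_of_int m *\<^sub>R c *\<^sub>R u + real_of_int n *\<^sub>R c *\<^sub>R v = c *\<^sub>R ?q" by (simp add: algebra_simps)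
          thus ?thesis using c by simp
        qed
        show "r0 \<le> norm (real_of_int m *\<^sub>R c *\<^sub>R u + real_of_int n *\<^sub>R c *\<^sub>R v)"
          unfolding eq c(3)[symmetric] using shortest[OF mn] c by (intro mult_left_mono) auto
        have "norm ?q > 0" using shortest[OF mn] v0 by linarith
        thus "norm (real_of_int m *\<^sub>R c *\<^sub>R u + real_of_int n *\<^sub>R c *\<^sub>R v) < norm ?q"
          unfolding eq using c by simp
      qed (use s in auto)
      have "E (planar_lattice (c *\<^sub>R u) (c *\<^sub>R v)) < E (planar_lattice u v)"
      proof (rule phibar_planar_strict_mono[OF uv(2) g' s])
        show "phibar \<alpha> s (norm (c *\<^sub>R u)) < phibar \<alpha> s (norm u)" using less[of 1 0] by (simp add: zero_prod_def)
      qed (use less in \<open>auto intro: less_imp_le\<close>)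
      moreover have "norm (c *\<^sub>R v) \<le> r0" using c by simp
      ultimately show ?thesis using short_vector(1)[OF g'] uv(1) by fastforce
    qed
  qed
  have "A2_opt \<in> lattices"
    using unique_min_pos_phibar_A2 by (intro scale_lat_in_lattices A2) (simp add: unique_min_pos_def)
  thus ?thesis using main by (simp add: unique_min_lat_def)
qed

end

theorem theorem4p1:
  fixes F F' :: "real \<Rightarrow> real" and \<alpha> s :: real
  assumes sd: "s > real CARD('n)" and as: "\<alpha> > s"
    and F_deriv: "\<And>r. r > 0 \<Longrightarrow> (F has_real_derivative F' r) (at r)"
    and F'_cont: "continuous_on {0<..} F'"
    and g_mono: "strict_mono_on {r. r > 0 \<and> F' r < 0} (\<lambda>r. r powr (1 - \<alpha> / s) * F' r)"
    and g_image: "(\<lambda>r. r powr (1 - \<alpha> / s) * F' r) ` {r. r > 0 \<and> F' r < 0} = {..<0}"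
    and hg_decr: "\<And>x y. x < y \<Longrightarrow> y < 0 \<Longrightarrow>
        (let g = (\<lambda>r. r powr (1 - \<alpha> / s) * F' r);
             h = (\<lambda>r. F r - s / \<alpha> * r * F' r);
             ginv = the_inv_into {r. r > 0 \<and> F' r < 0} g
         in h (ginv x) > h (ginv y))"
  shows
    "(\<forall>L\<in>(lattices1 :: (real^'n) set set).
        \<exists>c. unique_min_pos (\<lambda>c. energyE F \<alpha> s (scale_lat c L)) c)
   \<and> (\<forall>L\<in>(lattices1 :: (real^'n) set set).
        unique_min_pos (\<lambda>c. lat_energy (phibar \<alpha> s) (scale_lat c L)) (lam_bar \<alpha> s L))
   \<and> (\<forall>Ld\<in>(lattices1 :: (real^'n) set set).
        (unique_min_lat lattices1 (e_star \<alpha> s) Ld \<longleftrightarrow>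
           unique_min_lat lattices (energyE F \<alpha> s) (scale_lat (lamE F \<alpha> s Ld) Ld))
      \<and> (unique_min_lat lattices1 (e_star \<alpha> s) Ld \<longleftrightarrow>
           unique_min_lat lattices (lat_energy (phibar \<alpha> s)) (scale_lat (lam_bar \<alpha> s Ld) Ld)))
   \<and> (CARD('n) = 2 \<longrightarrow> H_fun \<alpha> < H_fun s \<longrightarrow>
        unique_min_lat (lattices :: (real^2) set set) (energyE F \<alpha> s)
          (scale_lat (lamE F \<alpha> s A2) A2))
   \<and> (\<forall>Ld\<in>(lattices1 :: (real^'n) set set).
        unique_min_lat lattices1 (\<lambda>L. epstein L s) Ld \<and> (\<forall>L\<in>(lattices1 :: (real^'n) set set). e_star \<alpha> s Ld \<le> e_star \<alpha> s L)
        \<longrightarrow> unique_min_lat lattices1 (lamE F \<alpha> s) Ld)"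
proof (intro conjI ballI impI)
  have E: "embedding (\<alpha> / s) F F'"
    using F_deriv F'_cont g_mono g_image by (simp add: embedding_def)
  note sub = subsetD[OF lattices1_subset]
  show "\<exists>c. unique_min_pos (\<lambda>c. energyE F \<alpha> s (scale_lat c L)) c" if "L \<in> lattices1" for L :: "(real^'n) set"
    using unique_min_lamE[OF E sd as sub[OF that]] by blast
  show "unique_min_pos (\<lambda>c. lat_energy (phibar \<alpha> s) (scale_lat c L)) (lam_bar \<alpha> s L)"
    if "L \<in> lattices1" for L :: "(real^'n) set"
    by (rule unique_min_pos_phibar[OF sub[OF that] sd as])
  show "unique_min_lat lattices1 (e_star \<alpha> s) D \<longleftrightarrow>
      unique_min_lat lattices (energyE F \<alpha> s) (scale_lat (lamE F \<alpha> s D) D)"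
    if "D \<in> lattices1" for D :: "(real^'n) set"
    by (rule unique_min_e_star_iff[OF E sd as that])
  show "unique_min_lat lattices1 (e_star \<alpha> s) D \<longleftrightarrow>
      unique_min_lat lattices (lat_energy (phibar \<alpha> s)) (scale_lat (lam_bar \<alpha> s D) D)"
    if "D \<in> lattices1" for D :: "(real^'n) set"
    by (rule unique_min_e_star_iff_phibar[OF that sd as])
  show "unique_min_lat lattices1 (lamE F \<alpha> s) D"
    if D: "unique_min_lat lattices1 (\<lambda>L. epstein L s) D \<and>
      (\<forall>L\<in>(lattices1 :: (real^'n) set set). e_star \<alpha> s D \<le> e_star \<alpha> s L)" for D :: "(real^'n) set"
    using D by (intro unique_min_lamE_of_unique_min_epstein[OF E sd as]) auto
  assume n: "CARD('n) = 2" and H: "H_fun \<alpha> < H_fun s"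
  \<comment> \<open>The planar claim lives on \<open>real^2\<close> whatever type \<open>'n\<close>
    is; the cardinality turns the bound on s into the one required there.\<close>
  have s2: "s > 2" using sd n by simp
  hence sd2: "s > real CARD(2)" by simp
  \<comment> \<open>Minimality of \<open>A2\<close> passes from the energy of \<open>phibar\<close>
    to \<open>e_star\<close>, and from there to the energy with general F.\<close>
  have "unique_min_lat lattices1 (e_star \<alpha> s) A2"
    using A2_unique_min_phibar[OF s2 as H] unique_min_e_star_iff_phibar[OF A2_in_lattices1 sd2 as] by simp
  thus "unique_min_lat lattices (energyE F \<alpha> s) (scale_lat (lamE F \<alpha> s A2) A2)"
    using unique_min_e_star_iff[OF E sd2 as A2_in_lattices1] by simp
qed

end
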